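(* Let $\mathcal{E}$ be any one of the three families of deformed equations ${\rm H1}^\sigma_\epsilon$, ${\rm H2}^\sigma_\epsilon$, ${\rm H3}^\sigma_\epsilon$, $\sigma\in\{1,-1\}$, and let $$\mathbf{v}_n=\mathrm{R}^{[0]}_n\partial_{u_{n,m}},\quad \mathrm{R}^{[0]}_n=\frac{f(u_{n,m},u_{n+1,m};\alpha)}{u_{n+1,m}-u_{n-1,m}}-\frac12 f_{,u_{n+1,m}}(u_{n,m},u_{n+1,m};\alpha),$$ $$\mathbf{v}_m=\mathrm{R}^{[0]}_m\partial_{u_{n,m}},\quad \mathrm{R}^{[0]}_m=\frac{f(u_{n,m},u_{n,m+1};\beta)}{u_{n,m+1}-u_{n,m-1}}-\frac12 f_{,u_{n,m+1}}(u_{n,m},u_{n,m+1};\beta).$$ Then: (i) The equation $\mathcal{E}(u_{n,m},u_{n+1,m},u_{n,m+1},u_{n+1,m+1};n,m;\alpha,\beta;\sigma)=0$ admits the pair of extended three-point generalized symmetries with generators $$\mathbf{V}_n=n\,\mathbf{v}_n-r(\alpha)\,\partial_\alpha,\qquad \mathbf{V}_m=m\,\mathbf{v}_m-r(\beta)\,\partial_\beta,$$ where $r(x)=1$ for ${\rm H1}^\sigma_\epsilon$ and ${\rm H2}^\sigma_\epsilon$, and $r(x)=-x/2$ for ${\rm H3}^\sigma_\epsilon$. (ii) $\mathbf{V}_n,\mathbf{V}_m$ are master symmetries of $\mathbf{v}_n,\mathbf{v}_m$: for $i=n,m$, setting $\mathbf{v}^{[0]}_i=\mathbf{v}_i$ and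 $$\mathbf{v}^{[k+1]}_i=\mathrm{R}^{[k+1]}_i\,\partial_{u_{n,m}}:=\big[\mathbf{V}_i,\mathbf{v}^{[k]}_i\big],\qquad k=0,1,\dots,$$ all the vector fields $\mathbf{v}^{[k]}_i$, $k\ge0$, generate generalized symmetries of the equation. (iii) The characteristic $\mathrm{R}^{[k]}_i$ involves the values of $u$ at $2k+3$ points in the $i$ direction of the lattice, and is given by $$\mathrm{R}^{[k]}_i=\mathcal{R}^{\,k}\,\mathrm{R}^{[0]}_i,\qquad k=0,1,\dots,\quad i=n,m,$$ where $$\mathcal{R}=\sum_{\ell=-\infty}^{\infty}\ell\,\big(\mathcal{S}_n^{(\ell)}\mathrm{R}^{[0]}_n\big)\partial_{u_{n+\ell,m}}+\sum_{\ell=-\infty}^{\infty}\ell\,\big(\mathcal{S}_m^{(\ell)}\mathrm{R}^{[0]}_m\big)\partial_{u_{n,m+\ell}}-r(\alpha)\,\partial_\alpha-r(\beta)\,\partial_\beta.$$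
   Context: Let $\epsilon,\delta$ be complex constants, $\alpha,\beta$ the (complex, generic) lattice parameters, $\sigma\in\{1,-1\}$. Put $$\mathcal{X}_{n,m}=\frac{1+\sigma(-1)^{n+m}}{2},\qquad \mathcal{Y}_{n,m}=\frac{1-\sigma(-1)^{n+m}}{2}.$$ The polynomial $\mathcal{E}(x_1,x_2,x_3,x_4;n,m;\alpha,\beta;\sigma)$ and the polynomial $f(u,x;\alpha)$ (which depends also on $n,m,\sigma$ through $\mathcal{X}_{n,m},\mathcal{Y}_{n,m}$) are: - ${\rm H1}^\sigma_\epsilon$: $\mathcal{E}=(x_1-x_4)(x_2-x_3)-(\alpha-\beta)+\epsilon(\alpha-\beta)\{\mathcal{X}_{n,m}x_2x_3+\mathcal{Y}_{n,m}x_1x_4\}$, $\ f(u,x;\alpha)=1-\epsilon(\mathcal{Y}_{n,m}u^2+\mathcal{X}_{n,m}x^2)$; - ${\rm H2}^\sigma_\epsilon$: $\mathcal{E}=(x_1-x_4)(x_2-x_3)+(\beta-\alpha)(x_1+x_2+x_3+x_4)-\alpha^2+\beta^2-\epsilon(\beta-\alpha)^3-\epsilon(\beta-\alpha)\{2\mathcal{Y}_{n,m}x_1+2\mathcal{X}_{n,m}x_2+\alpha+\beta\}\{2\mathcal{Y}_{n,m}x_4+2\mathcal{X}_{n,m}x_3+\alpha+\beta\}$, $\ f(u,x;\alpha)=2\{u+x+\alpha-2\epsilon[\mathcal{Y}_{n,m}(u+\alpha)^2+\mathcal{X}_{n,m}(x+\alpha)^2]\}$; - ${\rm H3}^\sigma_\epsilon$: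 $\mathcal{E}=\alpha(x_1x_2+x_3x_4)-\beta(x_1x_3+x_2x_4)+(\alpha^2-\beta^2)\delta-\frac{\epsilon(\alpha^2-\beta^2)}{\alpha\beta}\{\mathcal{X}_{n,m}x_2x_3+\mathcal{Y}_{n,m}x_1x_4\}$, $\ f(u,x;\alpha)=ux+\delta\alpha-\frac{\epsilon}{\alpha}(\mathcal{Y}_{n,m}u^2+\mathcal{X}_{n,m}x^2)$ (lattice parameters nonzero). $f_{,u_{n+1,m}}$ and $f_{,u_{n,m+1}}$ denote the derivative of $f$ with respect to its second value argument. Shifts $\mathcal{S}_n^{(\ell)}$, $\mathcal{S}_m^{(\ell)}$ replace $n\mapsto n+\ell$, $m\mapsto m+\ell$ everywhere, both in the indices of $u$ and in the explicit dependence on $n,m$. A vector field $R\,\partial_{u_{n,m}}+\xi\,\partial_\alpha+\zeta\,\partial_\beta$, with $R$ a function of $n,m,\alpha,\beta$ and finitely many values of $u$, and $\xi,\zeta$ functions of $n,m,\alpha,\beta$, generates a symmetry of the equation if $$\sum_{i,j\in\{0,1\}}\big(\mathcal{S}_n^{(i)}\mathcal{S}_m^{(j)}R\big)\frac{\partial\mathcal{E}}{\partial u_{n+i,m+j}}+\xi\frac{\partial\mathcal{E}}{\partial\alpha}+\zeta\frac{\partial\mathcal{E}}{\partial\beta}=0$$ holds for every (generic) solution $u$ and all $(n,m)$. If $\xi=\zeta=0$ it is a generalized symmetry, otherwise an extended generalized symmetry; "three-point" means that $R$ depends on $u$ only through three consecutive values $u_{n-1,m},u_{n,m},u_{n+1,m}$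 (or $u_{n,m-1},u_{n,m},u_{n,m+1}$). The commutator $[\mathbf{V},\mathbf{v}]$ is that of the prolonged vector fields: for $\mathbf{V}=P\,\partial_{u_{n,m}}+\xi\,\partial_\alpha+\zeta\,\partial_\beta$ with $\xi,\zeta$ depending only on $\alpha,\beta$, and $\mathbf{v}=R\,\partial_{u_{n,m}}$, it is the vector field with characteristic $$\sum_{i,j}\big(\mathcal{S}_n^{(i)}\mathcal{S}_m^{(j)}P\big)\frac{\partial R}{\partial u_{n+i,m+j}}+\xi\frac{\partial R}{\partial\alpha}+\zeta\frac{\partial R}{\partial\beta}-\sum_{i,j}\big(\mathcal{S}_n^{(i)}\mathcal{S}_m^{(j)}R\big)\frac{\partial P}{\partial u_{n+i,m+j}}$$ (sums over all integers $i,j$; only finitely many terms are nonzero). *)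

theory Defs
  imports "HOL-Analysis.Analysis" "HOL-Library.Groups_Big_Fun"
begin

section \<open>The three families of deformed equations\<close>

text \<open>The arguments are \<open>\<epsilon>, \<sigma>\<close> for the first two families and \<open>\<epsilon>, \<delta>, \<sigma>\<close> for the third;
  \<open>\<sigma>\<close> is meant to be \<open>1\<close> or \<open>-1\<close>.\<close>

datatype quad_eq =
    H1 complex complex
  | H2 complex complex
  | H3 complex complex complex

definition X_weight :: "complex \<Rightarrow> int \<Rightarrow> int \<Rightarrow> complex" where
  "X_weight \<sigma> n m = (1 + \<sigma> * (-1) powi (n + m)) / 2"

definition Y_weight :: "complex \<Rightarrow> int \<Rightarrow> int \<Rightarrow> complex" where
  "Y_weight \<sigma> n m = (1 - \<sigma> * (-1) powi (n + m)) / 2"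

fun E_poly :: "quad_eq \<Rightarrow> complex \<Rightarrow> complex \<Rightarrow> complex \<Rightarrow> complex \<Rightarrow> int \<Rightarrow> int \<Rightarrow> complex \<Rightarrow> complex \<Rightarrow> complex"
where
  "E_poly (H1 \<epsilon> \<sigma>) x1 x2 x3 x4 n m \<alpha> \<beta> =
     (x1 - x4) * (x2 - x3) - (\<alpha> - \<beta>)
     + \<epsilon> * (\<alpha> - \<beta>) * (X_weight \<sigma> n m * x2 * x3 + Y_weight \<sigma> n m * x1 * x4)"
| "E_poly (H2 \<epsilon> \<sigma>) x1 x2 x3 x4 n m \<alpha> \<beta> =
     (x1 - x4) * (x2 - x3) + (\<beta> - \<alpha>) * (x1 + x2 + x3 + x4) - \<alpha>^2 + \<beta>^2 - \<epsilon> * (\<beta> - \<alpha>)^3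
     - \<epsilon> * (\<beta> - \<alpha>)
       * (2 * Y_weight \<sigma> n m * x1 + 2 * X_weight \<sigma> n m * x2 + \<alpha> + \<beta>)
       * (2 * Y_weight \<sigma> n m * x4 + 2 * X_weight \<sigma> n m * x3 + \<alpha> + \<beta>)"
| "E_poly (H3 \<epsilon> \<delta> \<sigma>) x1 x2 x3 x4 n m \<alpha> \<beta> =
     \<alpha> * (x1 * x2 + x3 * x4) - \<beta> * (x1 * x3 + x2 * x4) + (\<alpha>^2 - \<beta>^2) * \<delta>
     - \<epsilon> * (\<alpha>^2 - \<beta>^2) / (\<alpha> * \<beta>) * (X_weight \<sigma> n m * x2 * x3 + Y_weight \<sigma> n m * x1 * x4)"

fun f_poly :: "quad_eq \<Rightarrow> int \<Rightarrow> int \<Rightarrow> complex \<Rightarrow> complex \<Rightarrow> complex \<Rightarrow> complex" where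
  "f_poly (H1 \<epsilon> \<sigma>) n m u x \<alpha> =
     1 - \<epsilon> * (Y_weight \<sigma> n m * u^2 + X_weight \<sigma> n m * x^2)"
| "f_poly (H2 \<epsilon> \<sigma>) n m u x \<alpha> =
     2 * (u + x + \<alpha> - 2 * \<epsilon> * (Y_weight \<sigma> n m * (u + \<alpha>)^2 + X_weight \<sigma> n m * (x + \<alpha>)^2))"
| "f_poly (H3 \<epsilon> \<delta> \<sigma>) n m u x \<alpha> =
     u * x + \<delta> * \<alpha> - \<epsilon> / \<alpha> * (Y_weight \<sigma> n m * u^2 + X_weight \<sigma> n m * x^2)"

definition f_second :: "quad_eq \<Rightarrow> int \<Rightarrow> int \<Rightarrow> complex \<Rightarrow> complex \<Rightarrow> complex \<Rightarrow> complex" where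
  "f_second e n m u x \<alpha> = deriv (\<lambda>z. f_poly e n m u z \<alpha>) x"

fun r_fun :: "quad_eq \<Rightarrow> complex \<Rightarrow> complex" where
  "r_fun (H1 \<epsilon> \<sigma>) x = 1"
| "r_fun (H2 \<epsilon> \<sigma>) x = 1"
| "r_fun (H3 \<epsilon> \<delta> \<sigma>) x = - x / 2"

fun admissible :: "quad_eq \<Rightarrow> complex \<Rightarrow> complex \<Rightarrow> bool" where
  "admissible (H1 \<epsilon> \<sigma>) \<alpha> \<beta> \<longleftrightarrow> True"
| "admissible (H2 \<epsilon> \<sigma>) \<alpha> \<beta> \<longleftrightarrow> True"
| "admissible (H3 \<epsilon> \<delta> \<sigma>) \<alpha> \<beta> \<longleftrightarrow> \<alpha> \<noteq> 0 \<and> \<beta> \<noteq> 0"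

section \<open>Functions on the lattice, shifts and partial derivatives\<close>

text \<open>A \<open>lattice_fun\<close> is a function of \<open>n, m, \<alpha>, \<beta>\<close> and of the field \<open>u\<close>. The field is always indexed
  by absolute lattice positions, so the value \<open>u\<^sub>n\<^sub>+\<^sub>i\<^sub>,\<^sub>m\<^sub>+\<^sub>j\<close> occurring in \<open>R n m \<alpha> \<beta> u\<close> is
  \<open>u (n + i, m + j)\<close>, and replacing \<open>n, m\<close> shifts both the indices of \<open>u\<close> and the explicit
  dependence on \<open>n, m\<close>.\<close>

type_synonym field_values = "int \<times> int \<Rightarrow> complex"
type_synonym lattice_fun = "int \<Rightarrow> int \<Rightarrow> complex \<Rightarrow> complex \<Rightarrow> field_values \<Rightarrow> complex"

definition shift :: "int \<Rightarrow> int \<Rightarrow> lattice_fun \<Rightarrow> lattice_fun" where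
  "shift i j R = (\<lambda>n m. R (n + i) (m + j))"

definition partial_u :: "int \<Rightarrow> int \<Rightarrow> lattice_fun \<Rightarrow> lattice_fun" where
  "partial_u i j R =
     (\<lambda>n m \<alpha> \<beta> u. deriv (\<lambda>z. R n m \<alpha> \<beta> (u((n + i, m + j) := z))) (u (n + i, m + j)))"

definition partial_\<alpha> :: "lattice_fun \<Rightarrow> lattice_fun" where
  "partial_\<alpha> R = (\<lambda>n m \<alpha> \<beta> u. deriv (\<lambda>a. R n m a \<beta> u) \<alpha>)"

definition partial_\<beta> :: "lattice_fun \<Rightarrow> lattice_fun" where
  "partial_\<beta> R = (\<lambda>n m \<alpha> \<beta> u. deriv (\<lambda>b. R n m \<alpha> b u) \<beta>)"

text \<open>\<open>depends_only_on R D\<close>: \<open>R\<close> depends on \<open>u\<close> only through the \<open>u\<^sub>n\<^sub>+\<^sub>i\<^sub>,\<^sub>m\<^sub>+\<^sub>j\<close> with \<open>(i, j) \<in> D\<close>.\<close>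

definition depends_only_on :: "lattice_fun \<Rightarrow> (int \<times> int) set \<Rightarrow> bool" where
  "depends_only_on R D \<longleftrightarrow>
     (\<forall>n m \<alpha> \<beta> u w. (\<forall>(i, j) \<in> D. u (n + i, m + j) = w (n + i, m + j))
        \<longrightarrow> R n m \<alpha> \<beta> u = R n m \<alpha> \<beta> w)"

text \<open>Field configurations at which none of the denominators \<open>u\<^sub>n\<^sub>+\<^sub>1\<^sub>,\<^sub>m - u\<^sub>n\<^sub>-\<^sub>1\<^sub>,\<^sub>m\<close>,
  \<open>u\<^sub>n\<^sub>,\<^sub>m\<^sub>+\<^sub>1 - u\<^sub>n\<^sub>,\<^sub>m\<^sub>-\<^sub>1\<close> of the characteristics vanishes. Division by zero and \<open>deriv\<close> of a
  non-differentiable function have arbitrary values; on this set, for admissible parameters, all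
  characteristics considered below are rational without poles.\<close>

definition nonsingular :: "field_values \<Rightarrow> bool" where
  "nonsingular u \<longleftrightarrow>
     (\<forall>n m. u (n + 1, m) \<noteq> u (n - 1, m) \<and> u (n, m + 1) \<noteq> u (n, m - 1))"

text \<open>\<open>R\<close> at site \<open>(n, m)\<close> really involves the value \<open>u\<^sub>n\<^sub>+\<^sub>i\<^sub>,\<^sub>m\<^sub>+\<^sub>j\<close>: changing this value alone can
  change \<open>R\<close>.\<close>

definition involves :: "lattice_fun \<Rightarrow> int \<Rightarrow> int \<Rightarrow> int \<Rightarrow> int \<Rightarrow> complex \<Rightarrow> complex \<Rightarrow> bool" where
  "involves R i j n m \<alpha> \<beta> \<longleftrightarrow>
     (\<exists>u z. nonsingular u \<and> nonsingular (u((n + i, m + j) := z))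
        \<and> R n m \<alpha> \<beta> (u((n + i, m + j) := z)) \<noteq> R n m \<alpha> \<beta> u)"

section \<open>Symmetries\<close>

definition E_quad :: "quad_eq \<Rightarrow> lattice_fun" where
  "E_quad e = (\<lambda>n m \<alpha> \<beta> u.
     E_poly e (u (n, m)) (u (n + 1, m)) (u (n, m + 1)) (u (n + 1, m + 1)) n m \<alpha> \<beta>)"

text \<open>A generic solution avoids the poles of the characteristics, and on each elementary square the
  equation, being affine in each corner value, determines every corner value uniquely from the
  other three.\<close>

definition generic_solution :: "quad_eq \<Rightarrow> complex \<Rightarrow> complex \<Rightarrow> field_values \<Rightarrow> bool" where
  "generic_solution e \<alpha> \<beta> u \<longleftrightarrow>
     (\<forall>n m. E_quad e n m \<alpha> \<beta> u = 0) \<and> nonsingular u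
     \<and> (\<forall>n m. \<forall>i \<in> {0, 1}. \<forall>j \<in> {0, 1}. partial_u i j (E_quad e) n m \<alpha> \<beta> u \<noteq> 0)"

text \<open>The vector field \<open>chi \<partial>\<^sub>u + xi \<partial>\<^sub>\<alpha> + zeta \<partial>\<^sub>\<beta>\<close>.\<close>

record vector_field =
  chi :: lattice_fun
  xi :: "int \<Rightarrow> int \<Rightarrow> complex \<Rightarrow> complex \<Rightarrow> complex"
  zeta :: "int \<Rightarrow> int \<Rightarrow> complex \<Rightarrow> complex \<Rightarrow> complex"

definition generates_symmetry :: "quad_eq \<Rightarrow> vector_field \<Rightarrow> bool" where
  "generates_symmetry e V \<longleftrightarrow>
     (\<exists>D. finite D \<and> depends_only_on (chi V) D) \<and>
     (\<forall>\<alpha> \<beta> u. admissible e \<alpha> \<beta> \<longrightarrow> generic_solution e \<alpha> \<beta> u \<longrightarrow>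
        (\<forall>n m. (\<Sum>i\<in>{0, 1}. \<Sum>j\<in>{0, 1}.
                  shift i j (chi V) n m \<alpha> \<beta> u * partial_u i j (E_quad e) n m \<alpha> \<beta> u)
               + xi V n m \<alpha> \<beta> * partial_\<alpha> (E_quad e) n m \<alpha> \<beta> u
               + zeta V n m \<alpha> \<beta> * partial_\<beta> (E_quad e) n m \<alpha> \<beta> u = 0))"

definition no_parameter_part :: "vector_field \<Rightarrow> bool" where
  "no_parameter_part V \<longleftrightarrow> (\<forall>n m \<alpha> \<beta>. xi V n m \<alpha> \<beta> = 0 \<and> zeta V n m \<alpha> \<beta> = 0)"

definition generalized_symmetry :: "quad_eq \<Rightarrow> vector_field \<Rightarrow> bool" where
  "generalized_symmetry e V \<longleftrightarrow> generates_symmetry e V \<and> no_parameter_part V"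

definition extended_generalized_symmetry :: "quad_eq \<Rightarrow> vector_field \<Rightarrow> bool" where
  "extended_generalized_symmetry e V \<longleftrightarrow> generates_symmetry e V \<and> \<not> no_parameter_part V"

definition three_point :: "vector_field \<Rightarrow> bool" where
  "three_point V \<longleftrightarrow>
     depends_only_on (chi V) {(-1, 0), (0, 0), (1, 0)} \<or>
     depends_only_on (chi V) {(0, -1), (0, 0), (0, 1)}"

text \<open>The commutator of prolonged vector fields, for \<open>V\<close> with \<open>xi\<close>, \<open>zeta\<close> depending on \<open>\<alpha>, \<beta>\<close> only
  and \<open>v\<close> without parameter part. \<open>Sum_any\<close> is the sum over the whole index type of a function with
  finite support.\<close>

definition commutator :: "vector_field \<Rightarrow> vector_field \<Rightarrow> vector_field" where
  "commutator V v =
     \<lparr> chi = (\<lambda>n m \<alpha> \<beta> u.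
         Sum_any (\<lambda>(i, j). shift i j (chi V) n m \<alpha> \<beta> u * partial_u i j (chi v) n m \<alpha> \<beta> u)
         + xi V n m \<alpha> \<beta> * partial_\<alpha> (chi v) n m \<alpha> \<beta> u
         + zeta V n m \<alpha> \<beta> * partial_\<beta> (chi v) n m \<alpha> \<beta> u
         - Sum_any (\<lambda>(i, j). shift i j (chi v) n m \<alpha> \<beta> u * partial_u i j (chi V) n m \<alpha> \<beta> u)),
       xi = (\<lambda>n m \<alpha> \<beta>. 0), zeta = (\<lambda>n m \<alpha> \<beta>. 0) \<rparr>"

primrec hierarchy :: "vector_field \<Rightarrow> vector_field \<Rightarrow> nat \<Rightarrow> vector_field" where
  "hierarchy V v 0 = v"
| "hierarchy V v (Suc k) = commutator V (hierarchy V v k)"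

definition master_symmetry :: "quad_eq \<Rightarrow> vector_field \<Rightarrow> vector_field \<Rightarrow> bool" where
  "master_symmetry e V v \<longleftrightarrow> (\<forall>k. generalized_symmetry e (hierarchy V v k))"

section \<open>The particular vector fields and the recursion operator\<close>

definition R0_n :: "quad_eq \<Rightarrow> lattice_fun" where
  "R0_n e = (\<lambda>n m \<alpha> \<beta> u.
     f_poly e n m (u (n, m)) (u (n + 1, m)) \<alpha> / (u (n + 1, m) - u (n - 1, m))
     - 1 / 2 * f_second e n m (u (n, m)) (u (n + 1, m)) \<alpha>)"

definition R0_m :: "quad_eq \<Rightarrow> lattice_fun" where
  "R0_m e = (\<lambda>n m \<alpha> \<beta> u.
     f_poly e n m (u (n, m)) (u (n, m + 1)) \<beta> / (u (n, m + 1) - u (n, m - 1))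
     - 1 / 2 * f_second e n m (u (n, m)) (u (n, m + 1)) \<beta>)"

definition v_n :: "quad_eq \<Rightarrow> vector_field" where
  "v_n e = \<lparr> chi = R0_n e, xi = (\<lambda>n m \<alpha> \<beta>. 0), zeta = (\<lambda>n m \<alpha> \<beta>. 0) \<rparr>"

definition v_m :: "quad_eq \<Rightarrow> vector_field" where
  "v_m e = \<lparr> chi = R0_m e, xi = (\<lambda>n m \<alpha> \<beta>. 0), zeta = (\<lambda>n m \<alpha> \<beta>. 0) \<rparr>"

definition V_n :: "quad_eq \<Rightarrow> vector_field" where
  "V_n e = \<lparr> chi = (\<lambda>n m \<alpha> \<beta> u. of_int n * R0_n e n m \<alpha> \<beta> u),
             xi = (\<lambda>n m \<alpha> \<beta>. - r_fun e \<alpha>), zeta = (\<lambda>n m \<alpha> \<beta>. 0) \<rparr>"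

definition V_m :: "quad_eq \<Rightarrow> vector_field" where
  "V_m e = \<lparr> chi = (\<lambda>n m \<alpha> \<beta> u. of_int m * R0_m e n m \<alpha> \<beta> u),
             xi = (\<lambda>n m \<alpha> \<beta>. 0), zeta = (\<lambda>n m \<alpha> \<beta>. - r_fun e \<beta>) \<rparr>"

definition recursion_op :: "quad_eq \<Rightarrow> lattice_fun \<Rightarrow> lattice_fun" where
  "recursion_op e G = (\<lambda>n m \<alpha> \<beta> u.
     Sum_any (\<lambda>l. of_int l * shift l 0 (R0_n e) n m \<alpha> \<beta> u * partial_u l 0 G n m \<alpha> \<beta> u)
     + Sum_any (\<lambda>l. of_int l * shift 0 l (R0_m e) n m \<alpha> \<beta> u * partial_u 0 l G n m \<alpha> \<beta> u)
     - r_fun e \<alpha> * partial_\<alpha> G n m \<alpha> \<beta> u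
     - r_fun e \<beta> * partial_\<beta> G n m \<alpha> \<beta> u)"

end

theory Submission
  imports Defs
begin

text \<open>The bracket of two symmetries is a symmetry: if \<open>X\<close> is tangent to the solutions and
  \<open>Y \<E>\<close> vanishes on them, then \<open>X (Y \<E>)\<close> vanishes as well, and the second derivatives of \<open>\<E>\<close>
  cancel in \<open>X (Y \<E>) - Y (X \<E>)\<close>. Only finitely many squares between two neighbouring rows are
  involved, and since \<open>\<E>\<close> is affine in each corner there is a holomorphic curve of solutions on
  these squares with any prescribed tangent velocity. So everything reduces to \<open>v\<close> and \<open>V\<close>, which
  satisfy a polynomial identity modulo the equation on adjacent squares.

  The formula with the recursion operator says that \<open>[V, v\<^sub>k]\<close> and \<open>\<R> R\<^sub>k\<close> differ by
  \<open>n [v\<^sub>0, v\<^sub>k]\<close>, hence it amounts to \<open>[v\<^sub>0, v\<^sub>k] = 0\<close>. For \<open>\<beta> = \<alpha>\<close> a row and its shift by one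
  solve the equation, and \<open>v\<^sub>0\<close> is, up to a factor, the first-order term when \<open>\<beta>\<close> is moved away
  from \<open>\<alpha>\<close>. As \<open>v\<^sub>k\<close> is a symmetry for every \<open>\<beta>\<close>, the first-order term of its symmetry condition
  is \<open>[v\<^sub>0, v\<^sub>k] = 0\<close>.\<close>

section \<open>Rational functions on the state space\<close>

text \<open>\<open>nonsingular\<close> imposes infinitely many inequalities and is not open in the
  product topology; hence curves move finitely many variables only, and all functions in play see
  finitely many. The parameters are variables like the field values, so fields that move \<alpha>
  need no separate calculus. The bracket \<open>[v\<^sub>0, v\<^sub>k]\<close> must vanish at every
  nonsingular field, not just on solutions. This is within reach because at \<beta> = \<alpha> any
  row whatsoever, paired with its own shift, is a solution, and the hierarchy in the first direction
  sees one row and \<alpha> only. On that pair the characteristic at (n, m + 1) has to be the one at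
  (n + 1, m). For the next commutator this is known only through the recursion formula, whose proof
  needs the vanishing bracket, which in turn rests on the symmetry of the current field. So support,
  rationality, symmetry and this invariance climb the hierarchy in a single induction, with symmetry
  stated on finite windows of squares that grow by one on either side at each step.\<close>

datatype var = PA | PB | U "int \<times> int"

type_synonym state = "var \<Rightarrow> complex"

definition regular :: "quad_eq \<Rightarrow> state set" where
  "regular e = {y. admissible e (y PA) (y PB) \<and> nonsingular (\<lambda>p. y (U p))}"

definition pd :: "var \<Rightarrow> (state \<Rightarrow> complex) \<Rightarrow> state \<Rightarrow> complex" where
  "pd v g y = deriv (\<lambda>z. g (y(v := z))) (y v)"

text \<open>\<open>rat_cong\<close> ignores values outside \<open>regular e\<close>, which absorbs
  the defaults of division by zero and of \<open>deriv\<close>. Closure under \<open>pd\<close> is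
  not a rule but a theorem, \<open>rat_pd\<close>.\<close>

inductive rational_on :: "quad_eq \<Rightarrow> (state \<Rightarrow> complex) \<Rightarrow> bool" for e where
  rat_const: "rational_on e (\<lambda>y. c)"
| rat_var: "rational_on e (\<lambda>y. y v)"
| rat_add: "rational_on e g \<Longrightarrow> rational_on e h \<Longrightarrow> rational_on e (\<lambda>y. g y + h y)"
| rat_mult: "rational_on e g \<Longrightarrow> rational_on e h \<Longrightarrow> rational_on e (\<lambda>y. g y * h y)"
| rat_inverse: "rational_on e g \<Longrightarrow> (\<And>y. y \<in> regular e \<Longrightarrow> g y \<noteq> 0) \<Longrightarrow> rational_on e (\<lambda>y. inverse (g y))"
| rat_cong: "rational_on e g \<Longrightarrow> (\<And>y. y \<in> regular e \<Longrightarrow> h y = g y) \<Longrightarrow> rational_on e h"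

text \<open>Differentiability is asked coordinatewise and at 0 only. This suffices for the chain
  rule, since a rational function sees finitely many variables.\<close>

definition curve :: "quad_eq \<Rightarrow> state \<Rightarrow> (var \<Rightarrow> complex) \<Rightarrow> (complex \<Rightarrow> state) \<Rightarrow> bool" where
  "curve e y X c \<longleftrightarrow> c 0 = y \<and> (\<forall>v. ((\<lambda>z. c z v) has_field_derivative X v) (at 0))
     \<and> (\<forall>\<^sub>F z in nhds 0. c z \<in> regular e)"

lemma curve_regular: "curve e y X c \<Longrightarrow> y \<in> regular e"
  unfolding curve_def by (metis eventually_nhds_x_imp_x)

lemma has_field_derivative_eventually_cong:
  assumes "(f has_field_derivative D) (at (0::complex))" "\<forall>\<^sub>F z in nhds 0. g z = f z"
  shows "(g has_field_derivative D) (at 0)"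
  using DERIV_cong_ev[OF refl assms(2) refl] assms(1) by simp

text \<open>The formal derivatives \<open>D\<close> are built along the construction of
  \<open>g\<close> by the sum, product and inverse rules. \<open>pd\<close> cannot serve yet, as
  \<open>deriv\<close> means nothing before differentiability is known.\<close>

lemma rat_chain_ex:
  assumes "rational_on e g"
  shows "\<exists>D S. finite S \<and> (\<forall>v. rational_on e (D v)) \<and> (\<forall>v y. v \<notin> S \<longrightarrow> D v y = 0) \<and>
    (\<forall>y X c. curve e y X c \<longrightarrow>
       ((\<lambda>z. g (c z)) has_field_derivative (\<Sum>v\<in>S. X v * D v y)) (at 0))"
  using assms
proof induction
  case (rat_const c)
  show ?case
    by (rule exI[of _ "\<lambda>_ _. 0"], rule exI[of _ "{}"]) (auto intro: rational_on.rat_const)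
next
  case (rat_var w)
  show ?case
    by (rule exI[of _ "\<lambda>v _. if v = w then 1 else 0"], rule exI[of _ "{w}"])
       (auto intro: rational_on.rat_const simp: curve_def)
next
  case (rat_add g h)
  then obtain D S D' S' where
    D: "finite S" "\<forall>v. rational_on e (D v)" "\<forall>v y. v \<notin> S \<longrightarrow> D v y = 0"
      "\<And>y X c. curve e y X c \<Longrightarrow>
       ((\<lambda>z. g (c z)) has_field_derivative (\<Sum>v\<in>S. X v * D v y)) (at 0)" and
    D': "finite S'" "\<forall>v. rational_on e (D' v)" "\<forall>v y. v \<notin> S' \<longrightarrow> D' v y = 0"
      "\<And>y X c. curve e y X c \<Longrightarrow>
       ((\<lambda>z. h (c z)) has_field_derivative (\<Sum>v\<in>S'. X v * D' v y)) (at 0)"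
    by blast
  have "((\<lambda>z. g (c z) + h (c z)) has_field_derivative
      (\<Sum>v\<in>S \<union> S'. X v * (D v y + D' v y))) (at 0)" if "curve e y X c" for y X c
  proof -
    have 1: "(\<Sum>v\<in>S. X v * D v y) = (\<Sum>v\<in>S \<union> S'. X v * D v y)"
      using D D' by (intro sum.mono_neutral_left) auto
    have 2: "(\<Sum>v\<in>S'. X v * D' v y) = (\<Sum>v\<in>S \<union> S'. X v * D' v y)"
      using D D' by (intro sum.mono_neutral_left) auto
    show ?thesis
      using DERIV_add[OF D(4)[OF that] D'(4)[OF that]]
      unfolding 1 2 by (simp add: algebra_simps sum.distrib)
  qed
  then show ?case
    by (intro exI[of _ "\<lambda>v y. D v y + D' v y"] exI[of _ "S \<union> S'"])
       (use D D' in \<open>auto intro: rational_on.rat_add\<close>)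
next
  case (rat_mult g h)
  then obtain D S D' S' where
    D: "finite S" "\<forall>v. rational_on e (D v)" "\<forall>v y. v \<notin> S \<longrightarrow> D v y = 0"
      "\<And>y X c. curve e y X c \<Longrightarrow>
       ((\<lambda>z. g (c z)) has_field_derivative (\<Sum>v\<in>S. X v * D v y)) (at 0)" and
    D': "finite S'" "\<forall>v. rational_on e (D' v)" "\<forall>v y. v \<notin> S' \<longrightarrow> D' v y = 0"
      "\<And>y X c. curve e y X c \<Longrightarrow>
       ((\<lambda>z. h (c z)) has_field_derivative (\<Sum>v\<in>S'. X v * D' v y)) (at 0)"
    by blast
  have "((\<lambda>z. g (c z) * h (c z)) has_field_derivative
      (\<Sum>v\<in>S \<union> S'. X v * (D v y * h y + g y * D' v y))) (at 0)" if "curve e y X c" for y X c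
  proof -
    have 1: "(\<Sum>v\<in>S. X v * D v y) = (\<Sum>v\<in>S \<union> S'. X v * D v y)"
      using D D' by (intro sum.mono_neutral_left) auto
    have 2: "(\<Sum>v\<in>S'. X v * D' v y) = (\<Sum>v\<in>S \<union> S'. X v * D' v y)"
      using D D' by (intro sum.mono_neutral_left) auto
    have 3: "c 0 = y" using that by (simp add: curve_def)
    have "(\<Sum>v\<in>S \<union> S'. X v * (D v y * h y + g y * D' v y)) =
      (\<Sum>v\<in>S \<union> S'. X v * D v y) * h y + (\<Sum>v\<in>S \<union> S'. X v * D' v y) * g y"
      by (simp add: algebra_simps sum.distrib sum_distrib_left)
    then show ?thesis
      using DERIV_mult[OF D(4)[OF that] D'(4)[OF that]] 
      unfolding 1 2 3 by simp
  qed
  then show ?case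
    by (intro exI[of _ "\<lambda>v y. D v y * h y + g y * D' v y"] exI[of _ "S \<union> S'"])
       (use D D' rat_mult.hyps in \<open>auto intro!: rational_on.rat_add rational_on.rat_mult\<close>)
next
  case (rat_inverse g)
  then obtain D S where
    D: "finite S" "\<forall>v. rational_on e (D v)" "\<forall>v y. v \<notin> S \<longrightarrow> D v y = 0"
      "\<And>y X c. curve e y X c \<Longrightarrow>
       ((\<lambda>z. g (c z)) has_field_derivative (\<Sum>v\<in>S. X v * D v y)) (at 0)"
    by blast
  have "((\<lambda>z. inverse (g (c z))) has_field_derivative
      (\<Sum>v\<in>S. X v * (- 1 * (inverse (g y) * D v y * inverse (g y))))) (at 0)" if "curve e y X c" for y X c
  proof -
    have 3: "c 0 = y" using that by (simp add: curve_def)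
    have 4: "g (c 0) \<noteq> 0" using curve_regular[OF that] rat_inverse 3 by auto
    have "(\<Sum>v\<in>S. X v * (- 1 * (inverse (g y) * D v y * inverse (g y)))) =
      - (inverse (g y) * (\<Sum>v\<in>S. X v * D v y) * inverse (g y))"
      by (simp add: algebra_simps sum_distrib_left sum_negf)
    then show ?thesis
      using DERIV_inverse'[OF D(4)[OF that] 4] unfolding 3 by simp
  qed
  then show ?case
    by (intro exI[of _ "\<lambda>v y. - 1 * (inverse (g y) * D v y * inverse (g y))"] exI[of _ "S"])
       (use D rat_inverse.hyps in \<open>auto intro!: rational_on.rat_const rational_on.rat_mult[of e "\<lambda>_. - 1", simplified] rational_on.rat_mult rational_on.rat_inverse\<close>)
next
  case (rat_cong g h)
  then obtain D S where
    D: "finite S" "\<forall>v. rational_on e (D v)" "\<forall>v y. v \<notin> S \<longrightarrow> D v y = 0"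
      "\<And>y X c. curve e y X c \<Longrightarrow>
       ((\<lambda>z. g (c z)) has_field_derivative (\<Sum>v\<in>S. X v * D v y)) (at 0)"
    by blast
  have "((\<lambda>z. h (c z)) has_field_derivative
      (\<Sum>v\<in>S. X v * D v y)) (at 0)" if "curve e y X c" for y X c
    using D(4)[OF that]
    by (rule has_field_derivative_eventually_cong)
       (use that rat_cong.hyps(2) in \<open>auto simp: curve_def elim: eventually_mono\<close>)
  then show ?case
    by (intro exI[of _ D] exI[of _ "S"]) (use D in auto)
qed

section \<open>Regularity along curves\<close>

definition nb :: "int \<times> int \<Rightarrow> (int \<times> int) set" where
  "nb p = {(fst p + 2, snd p), (fst p - 2, snd p), (fst p, snd p + 2), (fst p, snd p - 2)}"

lemma finite_nb [simp]: "finite (nb p)"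
  by (simp add: nb_def)

lemma nb_sym: "q \<in> nb p \<Longrightarrow> p \<in> nb q"
  by (auto simp: nb_def)

text \<open>The two neighbours of a site are two steps apart, so \<open>nonsingular\<close> compares
  each value with the four in \<open>nb\<close>.\<close>

lemma nonsingular_iff: "nonsingular u \<longleftrightarrow> (\<forall>p. \<forall>q \<in> nb p. u p \<noteq> u q)"
proof
  assume n: "nonsingular u"
  show "\<forall>p. \<forall>q \<in> nb p. u p \<noteq> u q"
  proof (intro allI ballI)
    fix p q assume q: "q \<in> nb p"
    obtain i j where p: "p = (i, j)" by (cases p)
    have "u (i + 2, j) \<noteq> u (i, j)" "u (i, j) \<noteq> u (i - 2, j)"
         "u (i, j + 2) \<noteq> u (i, j)" "u (i, j) \<noteq> u (i, j - 2)"
      using n[unfolded nonsingular_def, rule_format, of "i + 1" j]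
        n[unfolded nonsingular_def, rule_format, of "i - 1" j]
        n[unfolded nonsingular_def, rule_format, of "i" "j + 1"]
        n[unfolded nonsingular_def, rule_format, of "i" "j - 1"] by (simp_all add: add.commute)
    then show "u p \<noteq> u q" using q p by (auto simp: nb_def)
  qed
next
  assume *: "\<forall>p. \<forall>q \<in> nb p. u p \<noteq> u q"
  show "nonsingular u" unfolding nonsingular_def
    by (intro allI conjI *[rule_format]) (auto simp: nb_def)
qed

lemma isCont_eventually_ne:
  assumes "isCont f (0::complex)" "f 0 \<noteq> (a::complex)"
  shows "\<forall>\<^sub>F z in nhds 0. f z \<noteq> a"
  using assms tendsto_imp_eventually_ne tendsto_at_iff_tendsto_nhds
  unfolding isCont_def by blast

text \<open>Only pairs with a moved site can become equal, and each site has four partners; that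
  leaves finitely many inequalities, each stable by continuity.\<close>

lemma eventually_regular:
  fixes c :: "complex \<Rightarrow> state"
  assumes y: "y \<in> regular e" and T: "finite T" and c: "\<And>v z. v \<notin> T \<Longrightarrow> c z v = y v"
    and cont: "\<And>v. isCont (\<lambda>z. c z v) 0" and c0: "c 0 = y"
  shows "\<forall>\<^sub>F z in nhds 0. c z \<in> regular e"
proof -
  define K where "K = {p. U p \<in> T}"
  have "K = U -` T" by (auto simp: K_def)
  then have K: "finite K" using T by (simp add: finite_vimageI inj_def)
  have yn: "y (U p) \<noteq> y (U q)" if "q \<in> nb p" for p q
    using y that unfolding regular_def nonsingular_iff by blast
  have "\<forall>\<^sub>F z in nhds 0. c z (U p) - c z (U q) \<noteq> 0" if "q \<in> nb p" for p q
    by (rule isCont_eventually_ne[where f = "\<lambda>z. c z (U p) - c z (U q)"]) (use yn[OF that] c0 in \<open>auto intro!: continuous_intros cont\<close>)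
  then have e1: "\<forall>\<^sub>F z in nhds 0. \<forall>p\<in>K. \<forall>q\<in>nb p. c z (U p) - c z (U q) \<noteq> 0"
    using K by (intro eventually_ball_finite ballI) auto
  have e2: "\<forall>\<^sub>F z in nhds 0. c z v \<noteq> 0" if "y v \<noteq> 0" for v
    by (rule isCont_eventually_ne) (use that c0 cont in auto)
  have e3: "\<forall>\<^sub>F z in nhds 0. admissible e (c z PA) (c z PB)"
  proof (cases "\<exists>a b d. e = H3 a b d")
    case True
    then obtain a b d where e: "e = H3 a b d" by blast
    have "y PA \<noteq> 0" "y PB \<noteq> 0" using y e by (auto simp: regular_def)
    then show ?thesis using eventually_conj[OF e2 e2, of PA PB] e by simp
  next
    case False
    then show ?thesis by (cases e) auto
  qed
  show ?thesis using eventually_conj[OF e1 e3]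
  proof (rule eventually_mono)
    fix z assume z: "(\<forall>p\<in>K. \<forall>q\<in>nb p. c z (U p) - c z (U q) \<noteq> 0) \<and> admissible e (c z PA) (c z PB)"
    have "c z (U p) \<noteq> c z (U q)" if "q \<in> nb p" for p q
    proof (cases "U p \<in> T \<or> U q \<in> T")
      case True
      then show ?thesis using z that nb_sym[OF that] unfolding K_def by fastforce
    next
      case False
      then show ?thesis using c yn that by auto
    qed
    then show "c z \<in> regular e" using z by (auto simp: regular_def nonsingular_iff)
  qed
qed

lemma straight_curve:
  assumes "y \<in> regular e" "finite T"
  shows "curve e y (\<lambda>v. if v \<in> T then X v else 0) (\<lambda>z v. if v \<in> T then y v + z * X v else y v)"
  unfolding curve_def
proof (intro conjI allI)
  show "((\<lambda>z. if v \<in> T then y v + z * X v else y v) has_field_derivative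
          (if v \<in> T then X v else 0)) (at 0)" for v
    by (auto intro!: derivative_eq_intros)
  show "\<forall>\<^sub>F z in nhds 0. (\<lambda>v. if v \<in> T then y v + z * X v else y v) \<in> regular e"
    by (rule eventually_regular[OF assms])
       (simp_all add: isCont_def, (subst if_distrib)?, auto intro!: tendsto_eq_intros)
qed auto

lemma pd_coord_curve:
  assumes "y \<in> regular e"
  shows "curve e y (\<lambda>w. if w = v then 1 else 0) (\<lambda>z. y(v := y v + z))"
proof -
  have "(\<lambda>w. if w = v then y w + z * 1 else y w) = y(v := y v + z)" for z
    by auto
  then show ?thesis using straight_curve[OF assms, of "{v}" "\<lambda>_. 1"] by simp
qed

lemma pd_eqI:
  assumes "((\<lambda>z. g (y(v := y v + z))) has_field_derivative D) (at 0)"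
  shows "pd v g y = D"
proof -
  have "((\<lambda>z. g (y(v := z))) has_field_derivative D) (at (0 + y v))"
    using assms by (subst DERIV_shift) (simp add: add.commute)
  then show ?thesis unfolding pd_def by (simp add: DERIV_imp_deriv)
qed

text \<open>Evaluated on coordinate lines, the chain rule of \<open>rat_chain_ex\<close> identifies
  its formal derivatives with \<open>pd\<close> on regular states.\<close>

lemma rat_facts:
  assumes "rational_on e g"
  shows "\<exists>S. finite S \<and> (\<forall>v. rational_on e (pd v g)) \<and> (\<forall>v. \<forall>y\<in>regular e. v \<notin> S \<longrightarrow> pd v g y = 0) \<and>
    (\<forall>y X c. curve e y X c \<longrightarrow>
       ((\<lambda>z. g (c z)) has_field_derivative (\<Sum>v\<in>S. X v * pd v g y)) (at 0))"
proof -
  obtain D S where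
    D: "finite S" "\<forall>v. rational_on e (D v)" "\<forall>v y. v \<notin> S \<longrightarrow> D v y = 0"
      "\<And>y X c. curve e y X c \<Longrightarrow>
       ((\<lambda>z. g (c z)) has_field_derivative (\<Sum>v\<in>S. X v * D v y)) (at 0)"
    using rat_chain_ex[OF assms] by blast
  have eq: "pd v g y = D v y" if y: "y \<in> regular e" for v y
  proof -
    have "(\<Sum>w\<in>S. (if w = v then 1 else 0) * D w y) = (\<Sum>w\<in>S. if w = v then D w y else 0)"
      by (rule sum.cong) auto
    also have "\<dots> = D v y" using D(1,3) by (simp add: sum.delta)
    finally show ?thesis
      using pd_eqI[of g y v, OF D(4)[OF pd_coord_curve[OF y]]] by simp
  qed
  show ?thesis
  proof (intro exI[of _ S] conjI allI ballI impI)
    show "rational_on e (pd v g)" for v using rat_cong[of e "D v" "pd v g"] D eq by auto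
    show "((\<lambda>z. g (c z)) has_field_derivative (\<Sum>v\<in>S. X v * pd v g y)) (at 0)"
      if "curve e y X c" for y X c
      using D(4)[OF that] eq[OF curve_regular[OF that]] by simp
  qed (use D eq in auto)
qed

lemma rat_pd: "rational_on e g \<Longrightarrow> rational_on e (pd v g)"
  using rat_facts by blast

text \<open>The derivative along the velocity \<open>X\<close>, with no finite support supplied from
  outside. An infinite index set would make the sum 0; for rational functions at regular states
  \<open>rat_finite_supp\<close> excludes this.\<close>

definition act :: "(var \<Rightarrow> complex) \<Rightarrow> (state \<Rightarrow> complex) \<Rightarrow> state \<Rightarrow> complex" where
  "act X g y = (\<Sum>v | pd v g y \<noteq> 0. X v * pd v g y)"

lemma act_eq:
  assumes "finite S" "\<And>v. v \<notin> S \<Longrightarrow> pd v g y = 0"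
  shows "act X g y = (\<Sum>v\<in>S. X v * pd v g y)"
  unfolding act_def using assms by (intro sum.mono_neutral_left) auto

lemma rat_finite_supp:
  assumes "rational_on e g"
  obtains S where "finite S" "\<And>v y. y \<in> regular e \<Longrightarrow> v \<notin> S \<Longrightarrow> pd v g y = 0"
  using rat_facts[OF assms] by blast

lemma rat_chain:
  assumes g: "rational_on e g" and c: "curve e y X c"
  shows "((\<lambda>z. g (c z)) has_field_derivative act X g y) (at 0)"
proof -
  obtain S where S: "finite S" "\<forall>v. \<forall>y\<in>regular e. v \<notin> S \<longrightarrow> pd v g y = 0"
    "\<forall>y X c. curve e y X c \<longrightarrow>
       ((\<lambda>z. g (c z)) has_field_derivative (\<Sum>v\<in>S. X v * pd v g y)) (at 0)"
    using rat_facts[OF g] by blast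
  have "act X g y = (\<Sum>v\<in>S. X v * pd v g y)"
    by (rule act_eq) (use S curve_regular[OF c] in auto)
  then show ?thesis using S c by simp
qed

lemma pd_has_derivative:
  assumes "rational_on e g" "y \<in> regular e"
  shows "((\<lambda>z. g (y(v := y v + z))) has_field_derivative pd v g y) (at 0)"
proof -
  have "((\<lambda>z. g (y(v := y v + z))) has_field_derivative act (\<lambda>w. if w = v then 1 else 0) g y) (at 0)"
    by (rule rat_chain[OF assms(1) pd_coord_curve[OF assms(2)]])
  then show ?thesis using pd_eqI by metis
qed

text \<open>Near a regular state the coordinate line stays regular, so values elsewhere do not enter
  the derivative.\<close>

lemma pd_cong:
  assumes "\<And>y. y \<in> regular e \<Longrightarrow> g y = h y" "rational_on e h" "y \<in> regular e"
  shows "pd v g y = pd v h y"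
proof (rule pd_eqI)
  show "((\<lambda>z. g (y(v := y v + z))) has_field_derivative pd v h y) (at 0)"
    by (rule has_field_derivative_eventually_cong[OF pd_has_derivative[OF assms(2,3)]])
       (use pd_coord_curve[OF assms(3), of v] assms(1) in \<open>auto simp: curve_def elim: eventually_mono\<close>)
qed

lemma pd_const [simp]: "pd v (\<lambda>_. a) y = 0"
  by (simp add: pd_def)

lemma pd_var [simp]: "pd v (\<lambda>y. y w) y = (if v = w then 1 else 0)"
  by (auto simp: pd_def)

lemma pd_add:
  "rational_on e g \<Longrightarrow> rational_on e h \<Longrightarrow> y \<in> regular e \<Longrightarrow> pd v (\<lambda>y. g y + h y) y = pd v g y + pd v h y"
  by (rule pd_eqI, rule DERIV_add) (auto intro: pd_has_derivative)

lemma pd_mult: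
  "rational_on e g \<Longrightarrow> rational_on e h \<Longrightarrow> y \<in> regular e \<Longrightarrow>
    pd v (\<lambda>y. g y * h y) y = pd v g y * h y + pd v h y * g y"
  by (rule pd_eqI) (use DERIV_mult[OF pd_has_derivative pd_has_derivative, of e g y e h y v v] in simp)

lemma pd_inverse:
  "rational_on e g \<Longrightarrow> y \<in> regular e \<Longrightarrow> g y \<noteq> 0 \<Longrightarrow>
    pd v (\<lambda>y. inverse (g y)) y = - (inverse (g y) * pd v g y * inverse (g y))"
  by (rule pd_eqI) (use DERIV_inverse'[OF pd_has_derivative, of e g y v] in simp)

text \<open>Symmetry of mixed derivatives comes from algebra: each construction rule yields a
  formula for the second derivative that is symmetric in \<open>v\<close> and \<open>w\<close> once
  those of its constituents are.\<close>

lemma pd_commute: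
  assumes "rational_on e g" "y \<in> regular e"
  shows "pd v (pd w g) y = pd w (pd v g) y"
  using assms
proof (induction arbitrary: y v w)
  case (rat_const c)
  then show ?case by simp
next
  case (rat_var x)
  then show ?case by simp
next
  case (rat_add g h)
  have *: "pd v (pd w (\<lambda>y. g y + h y)) y = pd v (pd w g) y + pd v (pd w h) y" for v w
  proof -
    have "pd v (pd w (\<lambda>y. g y + h y)) y = pd v (\<lambda>y. pd w g y + pd w h y) y"
      by (rule pd_cong[OF _ _ \<open>y \<in> regular e\<close>])
         (use rat_add.hyps in \<open>auto intro!: pd_add rational_on.rat_add rat_pd\<close>)
    then show ?thesis using rat_add pd_add[OF rat_pd rat_pd] by simp
  qed
  show ?case unfolding * using rat_add.IH[OF \<open>y \<in> regular e\<close>] by simp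
next
  case (rat_mult g h)
  have *: "pd v (pd w (\<lambda>y. g y * h y)) y = pd v (pd w g) y * h y + pd v h y * pd w g y
      + (pd v (pd w h) y * g y + pd v g y * pd w h y)" for v w
  proof -
    have "pd v (pd w (\<lambda>y. g y * h y)) y = pd v (\<lambda>y. pd w g y * h y + pd w h y * g y) y"
      by (rule pd_cong[OF _ _ \<open>y \<in> regular e\<close>])
         (use rat_mult.hyps in \<open>auto intro!: pd_mult rational_on.rat_add rational_on.rat_mult rat_pd\<close>)
    also have "\<dots> = pd v (\<lambda>y. pd w g y * h y) y + pd v (\<lambda>y. pd w h y * g y) y"
      by (rule pd_add) (use rat_mult in \<open>auto intro!: rational_on.rat_mult rat_pd\<close>)
    finally show ?thesis using rat_mult by (simp add: pd_mult[of e] rat_pd)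
  qed
  show ?case unfolding * using rat_mult.IH[OF \<open>y \<in> regular e\<close>] by simp
next
  case (rat_inverse g)
  have *: "pd v (pd w (\<lambda>y. inverse (g y))) y =
     - (inverse (g y) * pd v (pd w g) y * inverse (g y))
     + 2 * inverse (g y) * inverse (g y) * inverse (g y) * pd v g y * pd w g y" for v w
  proof -
    note r = rat_pd[OF rat_inverse.hyps(1)] rational_on.rat_inverse[OF rat_inverse.hyps]
    have "pd v (pd w (\<lambda>y. inverse (g y))) y =
        pd v (\<lambda>y. (- 1) * (inverse (g y) * pd w g y * inverse (g y))) y"
      by (rule pd_cong[OF _ _ \<open>y \<in> regular e\<close>])
         (use rat_inverse.hyps r in \<open>auto simp: pd_inverse intro!: rational_on.rat_mult[of e "\<lambda>_. - 1", simplified] rational_on.rat_const rational_on.rat_mult\<close>)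
    also have "\<dots> = (- 1) * pd v (\<lambda>y. inverse (g y) * pd w g y * inverse (g y)) y"
      by (subst pd_mult[of e]) (use rat_inverse r in \<open>auto intro!: rational_on.rat_mult rational_on.rat_const\<close>)
    also have "pd v (\<lambda>y. inverse (g y) * pd w g y * inverse (g y)) y =
        pd v (\<lambda>y. inverse (g y) * pd w g y) y * inverse (g y) +
        pd v (\<lambda>y. inverse (g y)) y * (inverse (g y) * pd w g y)"
      by (subst pd_mult[of e]) (use rat_inverse r in \<open>auto intro!: rational_on.rat_mult\<close>)
    also have "pd v (\<lambda>y. inverse (g y) * pd w g y) y =
        pd v (\<lambda>y. inverse (g y)) y * pd w g y + pd v (pd w g) y * inverse (g y)"
      by (subst pd_mult[of e]) (use rat_inverse r in \<open>auto intro!: rational_on.rat_mult\<close>)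
    also have "pd v (\<lambda>y. inverse (g y)) y = - (inverse (g y) * pd v g y * inverse (g y))"
      by (rule pd_inverse) (use rat_inverse in auto)
    finally show ?thesis by (simp add: algebra_simps)
  qed
  show ?case unfolding * using rat_inverse.IH[OF \<open>y \<in> regular e\<close>] by simp
next
  case (rat_cong g h)
  have "pd v (pd w h) y = pd v (pd w g) y" for v w
    by (rule pd_cong[OF _ _ \<open>y \<in> regular e\<close>])
       (use rat_cong.hyps in \<open>auto intro!: pd_cong rat_pd\<close>)
  then show ?case using rat_cong by simp
qed

lemma rat_diff: "rational_on e g \<Longrightarrow> rational_on e h \<Longrightarrow> rational_on e (\<lambda>y. g y - h y)"
  using rat_add[of e g "\<lambda>y. (- 1) * h y"] rat_mult[OF rat_const, of e h "- 1"] by simp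

lemma rat_minus: "rational_on e g \<Longrightarrow> rational_on e (\<lambda>y. - g y)"
  using rat_mult[OF rat_const, of e g "- 1"] by simp

lemma rat_power: "rational_on e g \<Longrightarrow> rational_on e (\<lambda>y. g y ^ k)"
  by (induction k) (auto intro: rat_const rat_mult)

lemma rat_sum: "finite I \<Longrightarrow> (\<And>i. i \<in> I \<Longrightarrow> rational_on e (g i)) \<Longrightarrow> rational_on e (\<lambda>y. \<Sum>i\<in>I. g i y)"
  by (induction I rule: finite_induct) (auto intro: rat_const rat_add)

lemma rat_divide:
  "rational_on e g \<Longrightarrow> rational_on e h \<Longrightarrow> (\<And>y. y \<in> regular e \<Longrightarrow> h y \<noteq> 0) \<Longrightarrow> rational_on e (\<lambda>y. g y / h y)"
  unfolding divide_inverse by (intro rat_mult rat_inverse) auto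

lemmas rat_intros = rat_const rat_var rat_add rat_diff rat_minus rat_mult rat_power

lemma pd_indep: "(\<And>z. g (y(v := z)) = g y) \<Longrightarrow> pd v g y = 0"
  by (simp add: pd_def)

lemma pd_affine:
  assumes "\<And>z. g (y(v := z)) = a + z * b"
  shows "pd v g y = b"
  by (rule pd_eqI) (auto simp: assms intro!: derivative_eq_intros)

section \<open>The equation and curves of solutions\<close>

definition Q :: "quad_eq \<Rightarrow> int \<Rightarrow> int \<Rightarrow> state \<Rightarrow> complex" where
  "Q e n m y = E_poly e (y (U (n, m))) (y (U (n + 1, m))) (y (U (n, m + 1))) (y (U (n + 1, m + 1)))
     n m (y PA) (y PB)"

text \<open>\<open>\<E>\<close> is affine in each corner value, so its four partial derivatives are differences.\<close>

definition D1 where "D1 e n m x2 x3 x4 a b = E_poly e 1 x2 x3 x4 n m a b - E_poly e 0 x2 x3 x4 n m a b"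
definition D2 where "D2 e n m x1 x3 x4 a b = E_poly e x1 1 x3 x4 n m a b - E_poly e x1 0 x3 x4 n m a b"
definition D3 where "D3 e n m x1 x2 x4 a b = E_poly e x1 x2 1 x4 n m a b - E_poly e x1 x2 0 x4 n m a b"
definition D4 where "D4 e n m x1 x2 x3 a b = E_poly e x1 x2 x3 1 n m a b - E_poly e x1 x2 x3 0 n m a b"

fun valid_sign :: "quad_eq \<Rightarrow> bool" where
  "valid_sign (H1 \<epsilon> \<sigma>) \<longleftrightarrow> \<sigma> \<in> {1, - 1}"
| "valid_sign (H2 \<epsilon> \<sigma>) \<longleftrightarrow> \<sigma> \<in> {1, - 1}"
| "valid_sign (H3 \<epsilon> \<delta> \<sigma>) \<longleftrightarrow> \<sigma> \<in> {1, - 1}"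

text \<open>For a sign \<sigma> the weights are the indicators of the two colours of a checkerboard.
  Splitting by colour turns identities with weights into pairs of identities without.\<close>

lemma weight_cases:
  assumes "\<sigma> \<in> {1, - 1}"
  obtains "X_weight \<sigma> n m = 1" "Y_weight \<sigma> n m = 0"
      "X_weight \<sigma> n (m + 1) = 0" "Y_weight \<sigma> n (m + 1) = 1"
      "X_weight \<sigma> (n + 1) m = 0" "Y_weight \<sigma> (n + 1) m = 1"
      "X_weight \<sigma> (n - 1) m = 0" "Y_weight \<sigma> (n - 1) m = 1"
  | "X_weight \<sigma> n m = 0" "Y_weight \<sigma> n m = 1"
      "X_weight \<sigma> n (m + 1) = 1" "Y_weight \<sigma> n (m + 1) = 0"
      "X_weight \<sigma> (n + 1) m = 1" "Y_weight \<sigma> (n + 1) m = 0"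
      "X_weight \<sigma> (n - 1) m = 1" "Y_weight \<sigma> (n - 1) m = 0"
  using assms by (cases "even (n + m)") (auto simp: X_weight_def Y_weight_def power_int_minus_left)

lemma E_affine:
  assumes "valid_sign e"
  shows "E_poly e x1 x2 x3 x4 n m a b = E_poly e 0 x2 x3 x4 n m a b + x1 * D1 e n m x2 x3 x4 a b"
    and "E_poly e x1 x2 x3 x4 n m a b = E_poly e x1 0 x3 x4 n m a b + x2 * D2 e n m x1 x3 x4 a b"
    and "E_poly e x1 x2 x3 x4 n m a b = E_poly e x1 x2 0 x4 n m a b + x3 * D3 e n m x1 x2 x4 a b"
    and "E_poly e x1 x2 x3 x4 n m a b = E_poly e x1 x2 x3 0 n m a b + x4 * D4 e n m x1 x2 x3 a b"
proof -
  show "E_poly e x1 x2 x3 x4 n m a b = E_poly e 0 x2 x3 x4 n m a b + x1 * D1 e n m x2 x3 x4 a b"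
  proof (cases e)
    case (H2 \<epsilon> \<sigma>)
    then show ?thesis using assms
      by (auto elim!: weight_cases[of \<sigma> n m] simp: D1_def algebra_simps)
  qed (use assms in \<open>auto simp: D1_def divide_inverse algebra_simps\<close>)
  show "E_poly e x1 x2 x3 x4 n m a b = E_poly e x1 0 x3 x4 n m a b + x2 * D2 e n m x1 x3 x4 a b"
  proof (cases e)
    case (H2 \<epsilon> \<sigma>)
    then show ?thesis using assms
      by (auto elim!: weight_cases[of \<sigma> n m] simp: D2_def algebra_simps)
  qed (use assms in \<open>auto simp: D2_def divide_inverse algebra_simps\<close>)
  show "E_poly e x1 x2 x3 x4 n m a b = E_poly e x1 x2 0 x4 n m a b + x3 * D3 e n m x1 x2 x4 a b"
  proof (cases e)
    case (H2 \<epsilon> \<sigma>)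
    then show ?thesis using assms
      by (auto elim!: weight_cases[of \<sigma> n m] simp: D3_def algebra_simps)
  qed (use assms in \<open>auto simp: D3_def divide_inverse algebra_simps\<close>)
  show "E_poly e x1 x2 x3 x4 n m a b = E_poly e x1 x2 x3 0 n m a b + x4 * D4 e n m x1 x2 x3 a b"
  proof (cases e)
    case (H2 \<epsilon> \<sigma>)
    then show ?thesis using assms
      by (auto elim!: weight_cases[of \<sigma> n m] simp: D4_def algebra_simps)
  qed (use assms in \<open>auto simp: D4_def divide_inverse algebra_simps\<close>)
qed

lemma pd_Q_corner:
  assumes "valid_sign e"
  shows "pd (U (n, m)) (Q e n m) y =
      D1 e n m (y (U (n + 1, m))) (y (U (n, m + 1))) (y (U (n + 1, m + 1))) (y PA) (y PB)"
    and "pd (U (n + 1, m)) (Q e n m) y =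
      D2 e n m (y (U (n, m))) (y (U (n, m + 1))) (y (U (n + 1, m + 1))) (y PA) (y PB)"
    and "pd (U (n, m + 1)) (Q e n m) y =
      D3 e n m (y (U (n, m))) (y (U (n + 1, m))) (y (U (n + 1, m + 1))) (y PA) (y PB)"
    and "pd (U (n + 1, m + 1)) (Q e n m) y =
      D4 e n m (y (U (n, m))) (y (U (n + 1, m))) (y (U (n, m + 1))) (y PA) (y PB)"
  by (rule pd_affine, simp add: Q_def, rule E_affine[OF assms])+

text \<open>\<open>Da\<close> and \<open>Db\<close> are \<open>\<partial>\<E>/\<partial>\<alpha>\<close> and \<open>\<partial>\<E>/\<partial>\<beta>\<close>; for \<open>H3\<close> note
  \<open>(\<alpha>\<^sup>2 - \<beta>\<^sup>2) / (\<alpha> \<beta>) = \<alpha> / \<beta> - \<beta> / \<alpha>\<close>.\<close>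

fun Da :: "quad_eq \<Rightarrow> int \<Rightarrow> int \<Rightarrow> complex \<Rightarrow> complex \<Rightarrow> complex \<Rightarrow> complex \<Rightarrow> complex \<Rightarrow> complex \<Rightarrow> complex" where
  "Da (H1 \<epsilon> \<sigma>) n m x1 x2 x3 x4 \<alpha> \<beta> =
     - 1 + \<epsilon> * (X_weight \<sigma> n m * x2 * x3 + Y_weight \<sigma> n m * x1 * x4)"
| "Da (H2 \<epsilon> \<sigma>) n m x1 x2 x3 x4 \<alpha> \<beta> =
     - (x1 + x2 + x3 + x4) - 2 * \<alpha> + 3 * \<epsilon> * (\<beta> - \<alpha>)^2
     + \<epsilon> * (2 * Y_weight \<sigma> n m * x1 + 2 * X_weight \<sigma> n m * x2 + \<alpha> + \<beta>)
         * (2 * Y_weight \<sigma> n m * x4 + 2 * X_weight \<sigma> n m * x3 + \<alpha> + \<beta>)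
     - \<epsilon> * (\<beta> - \<alpha>) * ((2 * Y_weight \<sigma> n m * x1 + 2 * X_weight \<sigma> n m * x2 + \<alpha> + \<beta>)
         + (2 * Y_weight \<sigma> n m * x4 + 2 * X_weight \<sigma> n m * x3 + \<alpha> + \<beta>))"
| "Da (H3 \<epsilon> \<delta> \<sigma>) n m x1 x2 x3 x4 \<alpha> \<beta> =
     x1 * x2 + x3 * x4 + 2 * \<alpha> * \<delta>
     - \<epsilon> * (1 / \<beta> + \<beta> / \<alpha>^2) * (X_weight \<sigma> n m * x2 * x3 + Y_weight \<sigma> n m * x1 * x4)"

fun Db :: "quad_eq \<Rightarrow> int \<Rightarrow> int \<Rightarrow> complex \<Rightarrow> complex \<Rightarrow> complex \<Rightarrow> complex \<Rightarrow> complex \<Rightarrow> complex \<Rightarrow> complex" where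
  "Db (H1 \<epsilon> \<sigma>) n m x1 x2 x3 x4 \<alpha> \<beta> =
     1 - \<epsilon> * (X_weight \<sigma> n m * x2 * x3 + Y_weight \<sigma> n m * x1 * x4)"
| "Db (H2 \<epsilon> \<sigma>) n m x1 x2 x3 x4 \<alpha> \<beta> =
     (x1 + x2 + x3 + x4) + 2 * \<beta> - 3 * \<epsilon> * (\<beta> - \<alpha>)^2
     - \<epsilon> * (2 * Y_weight \<sigma> n m * x1 + 2 * X_weight \<sigma> n m * x2 + \<alpha> + \<beta>)
         * (2 * Y_weight \<sigma> n m * x4 + 2 * X_weight \<sigma> n m * x3 + \<alpha> + \<beta>)
     - \<epsilon> * (\<beta> - \<alpha>) * ((2 * Y_weight \<sigma> n m * x1 + 2 * X_weight \<sigma> n m * x2 + \<alpha> + \<beta>)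
         + (2 * Y_weight \<sigma> n m * x4 + 2 * X_weight \<sigma> n m * x3 + \<alpha> + \<beta>))"
| "Db (H3 \<epsilon> \<delta> \<sigma>) n m x1 x2 x3 x4 \<alpha> \<beta> =
     - (x1 * x3 + x2 * x4) - 2 * \<beta> * \<delta>
     + \<epsilon> * (1 / \<alpha> + \<alpha> / \<beta>^2) * (X_weight \<sigma> n m * x2 * x3 + Y_weight \<sigma> n m * x1 * x4)"

text \<open>\<open>s\<close> and \<open>t\<close> are the sums of corner products multiplied by
  \<alpha> and \<beta>, \<open>w\<close> is the weighted sum of diagonal products. The equation
  changes sign when \<alpha>, \<beta> and \<open>s\<close>, \<open>t\<close> are interchanged, so
  the formula serves for both parameters.\<close>

lemma H3_parameter_derivative:
  fixes a b :: complex
  assumes "a \<noteq> 0" "b \<noteq> 0"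
  shows "((\<lambda>z. (a + z) * s - b * t + ((a + z)^2 - b^2) * d - k * ((a + z)^2 - b^2) / ((a + z) * b) * w)
    has_field_derivative s + 2 * a * d - k * (1 / b + b / a^2) * w) (at 0)"
proof -
  have q: "((\<lambda>z. ((a + z)^2 - b^2) / ((a + z) * b)) has_field_derivative
      (2 * a * ((a + 0) * b) - ((a + 0)^2 - b^2) * b) / (((a + 0) * b) * ((a + 0) * b))) (at 0)"
    by (rule DERIV_divide) (use assms in \<open>auto intro!: derivative_eq_intros\<close>)
  have q': "(2 * a * ((a + 0) * b) - ((a + 0)^2 - b^2) * b) / (((a + 0) * b) * ((a + 0) * b))
      = 1 / b + b / a^2"
    using assms by (simp add: field_simps power2_eq_square)
  have r: "((\<lambda>z. (a + z) * s - b * t + ((a + z)^2 - b^2) * d) has_field_derivative s + 2 * a * d) (at 0)"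
    by (auto intro!: derivative_eq_intros)
  show ?thesis
    using DERIV_diff[OF r DERIV_cmult[OF q[unfolded q'], of "k * w"]]
    by (simp add: mult_ac)
qed

lemma H2_parameter_derivative:
  fixes a b :: complex
  shows "((\<lambda>z. w + (b - (a + z)) * s - (a + z)^2 + b^2 - k * (b - (a + z))^3
      - k * (b - (a + z)) * (p + (a + z) + b) * (q + (a + z) + b)) has_field_derivative
     - s - 2 * a + 3 * k * (b - a)^2 + k * (p + a + b) * (q + a + b)
     - k * (b - a) * ((p + a + b) + (q + a + b))) (at 0)"
    and "((\<lambda>z. w + (b + z - a) * s - a^2 + (b + z)^2 - k * (b + z - a)^3
      - k * (b + z - a) * (p + a + (b + z)) * (q + a + (b + z))) has_field_derivative
     s + 2 * b - 3 * k * (b - a)^2 - k * (p + a + b) * (q + a + b)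
     - k * (b - a) * ((p + a + b) + (q + a + b))) (at 0)"
  by (auto intro!: derivative_eq_intros simp: algebra_simps power2_eq_square)

lemma pd_Q_PA:
  assumes "y \<in> regular e"
  shows "pd PA (Q e n m) y = Da e n m (y (U (n, m))) (y (U (n + 1, m))) (y (U (n, m + 1)))
    (y (U (n + 1, m + 1))) (y PA) (y PB)"
proof (cases e)
  case (H1 \<epsilon> \<sigma>)
  show ?thesis
    by (rule pd_eqI) (auto simp: Q_def H1 algebra_simps intro!: derivative_eq_intros)
next
  case (H2 \<epsilon> \<sigma>)
  show ?thesis
    by (rule pd_eqI, simp add: H2 Q_def, rule DERIV_cong[OF H2_parameter_derivative(1)]) simp
next
  case (H3 \<epsilon> \<delta> \<sigma>)
  then have ne: "y PA \<noteq> 0" "y PB \<noteq> 0" using assms by (auto simp: regular_def)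
  let ?x1 = "y (U (n, m))" and ?x2 = "y (U (n + 1, m))" and ?x3 = "y (U (n, m + 1))"
    and ?x4 = "y (U (n + 1, m + 1))"
  have *: "Q e n m (y(PA := y PA + z)) = (y PA + z) * (?x1 * ?x2 + ?x3 * ?x4) -
      y PB * (?x1 * ?x3 + ?x2 * ?x4) + ((y PA + z)^2 - (y PB)^2) * \<delta> -
      \<epsilon> * ((y PA + z)^2 - (y PB)^2) / ((y PA + z) * y PB)
        * (X_weight \<sigma> n m * ?x2 * ?x3 + Y_weight \<sigma> n m * ?x1 * ?x4)" for z
    unfolding H3 Q_def by simp
  show ?thesis
    by (rule pd_eqI, unfold *, rule DERIV_cong[OF H3_parameter_derivative[OF ne]])
       (simp add: H3 algebra_simps)
qed

lemma pd_Q_PB: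
  assumes "y \<in> regular e"
  shows "pd PB (Q e n m) y = Db e n m (y (U (n, m))) (y (U (n + 1, m))) (y (U (n, m + 1)))
    (y (U (n + 1, m + 1))) (y PA) (y PB)"
proof (cases e)
  case (H1 \<epsilon> \<sigma>)
  show ?thesis
    by (rule pd_eqI) (auto simp: Q_def H1 algebra_simps intro!: derivative_eq_intros)
next
  case (H2 \<epsilon> \<sigma>)
  show ?thesis
    by (rule pd_eqI, simp add: H2 Q_def, rule DERIV_cong[OF H2_parameter_derivative(2)]) simp
next
  case (H3 \<epsilon> \<delta> \<sigma>)
  then have ne: "y PB \<noteq> 0" "y PA \<noteq> 0" using assms by (auto simp: regular_def)
  let ?x1 = "y (U (n, m))" and ?x2 = "y (U (n + 1, m))" and ?x3 = "y (U (n, m + 1))"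
    and ?x4 = "y (U (n + 1, m + 1))"
  have *: "Q e n m (y(PB := y PB + z)) = - ((y PB + z) * (?x1 * ?x3 + ?x2 * ?x4) -
      y PA * (?x1 * ?x2 + ?x3 * ?x4) + ((y PB + z)^2 - (y PA)^2) * \<delta> -
      \<epsilon> * ((y PB + z)^2 - (y PA)^2) / ((y PB + z) * y PA)
        * (X_weight \<sigma> n m * ?x2 * ?x3 + Y_weight \<sigma> n m * ?x1 * ?x4))" for z
    unfolding H3 Q_def by (simp add: algebra_simps diff_divide_distrib)
  show ?thesis
    by (rule pd_eqI, unfold *, rule DERIV_cong[OF DERIV_minus[OF H3_parameter_derivative[OF ne]]])
       (simp add: H3 algebra_simps)
qed

lemma rat_Q: "rational_on e (Q e n m)"
proof (cases e)
  case (H3 \<epsilon> \<delta> \<sigma>)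
  show ?thesis unfolding Q_def H3 E_poly.simps
    by (intro rat_intros rat_divide) (auto simp: regular_def)
qed (simp_all add: Q_def[abs_def], intro rat_intros, intro rat_intros)

definition corners :: "int \<Rightarrow> int \<Rightarrow> (int \<times> int) set" where
  "corners n m = {(n, m), (n + 1, m), (n, m + 1), (n + 1, m + 1)}"

lemma finite_corners [simp]: "finite (corners n m)"
  by (simp add: corners_def)

lemma pd_Q_zero: "v \<notin> insert PA (insert PB (U ` corners n m)) \<Longrightarrow> pd v (Q e n m) y = 0"
  by (rule pd_indep) (auto simp: Q_def corners_def)

lemma sum_corners:
  "(\<Sum>p\<in>corners n m. g p) = g (n, m) + g (n + 1, m) + g (n, m + 1) + (g (n + 1, m + 1) :: complex)"
  by (simp add: corners_def add.assoc)

lemma act_Q: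
  "act X (Q e n m) y = (\<Sum>p\<in>corners n m. X (U p) * pd (U p) (Q e n m) y)
     + X PA * pd PA (Q e n m) y + X PB * pd PB (Q e n m) y"
proof -
  have "act X (Q e n m) y =
      (\<Sum>v\<in>insert PA (insert PB (U ` corners n m)). X v * pd v (Q e n m) y)"
    by (rule act_eq) (auto intro: pd_Q_zero)
  also have "(\<Sum>v\<in>U ` corners n m. X v * pd v (Q e n m) y) =
      (\<Sum>p\<in>corners n m. X (U p) * pd (U p) (Q e n m) y)"
    by (subst sum.reindex) (auto simp: inj_on_def)
  ultimately show ?thesis by (simp add: image_iff add_ac)
qed

text \<open>Of the four corner derivatives only \<open>\<partial>\<E>/\<partial>x\<^sub>3\<close> is required not to vanish: for
  \<open>\<beta> = \<alpha>\<close> and the solution formed by a row and its shift, those by \<open>x\<^sub>1\<close> and \<open>x\<^sub>4\<close> are zero.\<close>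

definition row_solution :: "quad_eq \<Rightarrow> int \<Rightarrow> int \<Rightarrow> int \<Rightarrow> state \<Rightarrow> bool" where
  "row_solution e m L H y \<longleftrightarrow> y \<in> regular e \<and>
     (\<forall>i\<in>{L..H}. Q e i m y = 0 \<and> pd (U (i, m + 1)) (Q e i m) y \<noteq> 0)"

lemma row_solution_mono: "row_solution e m L H y \<Longrightarrow> L \<le> L' \<Longrightarrow> H' \<le> H \<Longrightarrow> row_solution e m L' H' y"
  by (auto simp: row_solution_def)

lemma curve_isCont:
  assumes "rational_on e g" "curve e y X c"
  shows "isCont (\<lambda>z. g (c z)) 0"
  using rat_chain[OF assms] by (rule DERIV_isCont)

text \<open>Starting from a straight line, the values on row \<open>m + 1\<close> are corrected from right to left by
  a Newton step in \<open>x\<^sub>3\<close>, which is exact because \<open>\<E>\<close> is affine; tangency of \<open>X\<close> keeps the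
  velocity unchanged.\<close>

lemma tangent_curve:
  assumes e: "valid_sign e" and y: "row_solution e m L H y"
    and X: "\<And>i. i \<in> {L..H} \<Longrightarrow> act X (Q e i m) y = 0" and T: "finite T"
  shows "\<exists>X' c. curve e y X' c \<and> (\<forall>v\<in>T. X' v = X v) \<and> (\<forall>\<^sub>F z in nhds 0. row_solution e m L H (c z))"
proof -
  \<comment> \<open>All variables that the squares read are included, so cutting \<open>X\<close>
    down to finitely many coordinates keeps it tangent.\<close>
  define T' where "T' = T \<union> {PA, PB} \<union> (\<Union>i\<in>{L..H}. U ` corners i m)"
  have T': "finite T'" using T by (auto simp: T'_def)
  define X' where "X' = (\<lambda>v. if v \<in> T' then X v else 0)"
  have yr: "y \<in> regular e" using y by (simp add: row_solution_def)
  have X'Q: "act X' (Q e i m) y = 0" if "i \<in> {L..H}" for i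
  proof -
    have "X' (U p) = X (U p)" if "p \<in> corners i m" for p
      using that \<open>i \<in> {L..H}\<close> unfolding X'_def T'_def by auto
    moreover have "X' PA = X PA" "X' PB = X PB" by (simp_all add: X'_def T'_def)
    ultimately have "act X' (Q e i m) y = act X (Q e i m) y"
      unfolding act_Q by simp
    then show ?thesis using X that by simp
  qed
  have main: "\<exists>c. curve e y X' c \<and> (\<forall>z. \<forall>v. v \<notin> T' \<longrightarrow> c z v = y v) \<and>
      (\<forall>\<^sub>F z in nhds 0. \<forall>i\<in>{H - int d<..H}. Q e i m (c z) = 0)" if "int d \<le> H - L + 1" for d
    using that
  proof (induction d)
    case 0
    have "curve e y X' (\<lambda>z v. if v \<in> T' then y v + z * X v else y v)"
      unfolding X'_def by (rule straight_curve[OF yr T'])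
    then show ?case by (intro exI[of _ "\<lambda>z v. if v \<in> T' then y v + z * X v else y v"]) simp
  next
    case (Suc d)
    then obtain c where c: "curve e y X' c" "\<And>z v. v \<notin> T' \<Longrightarrow> c z v = y v"
      "\<forall>\<^sub>F z in nhds 0. \<forall>i\<in>{H - int d<..H}. Q e i m (c z) = 0" by auto
    define j where "j = H - int d"
    have j: "j \<in> {L..H}" using Suc.prems by (auto simp: j_def)
    define w where "w = U (j, m + 1)"
    have w: "w \<in> T'" using j by (auto simp: T'_def w_def corners_def)
    \<comment> \<open>The squares to the right of \<open>j\<close> read upper sites beyond
      \<open>j\<close> only, so correcting the value at \<open>(j, m + 1)\<close> leaves them
      solved.\<close>
    define c' where "c' = (\<lambda>z. (c z)(w := c z w - Q e j m (c z) / pd w (Q e j m) (c z)))"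
    have c0: "c 0 = y" using c by (simp add: curve_def)
    have Qj: "Q e j m y = 0" "pd w (Q e j m) y \<noteq> 0"
      using y j by (auto simp: row_solution_def w_def)
    have d: "((\<lambda>z. c' z v) has_field_derivative X' v) (at 0)" for v
    proof (cases "v = w")
      case True
      have "((\<lambda>z. c z w - Q e j m (c z) / pd w (Q e j m) (c z)) has_field_derivative
          X' w - (act X' (Q e j m) y * pd w (Q e j m) (c 0) - Q e j m (c 0) * act X' (pd w (Q e j m)) y) /
             (pd w (Q e j m) (c 0) * pd w (Q e j m) (c 0))) (at 0)"
        using c(1) Qj(2) c0
        by (intro DERIV_diff DERIV_divide rat_chain rat_Q rat_pd) (auto simp: curve_def intro: rat_Q)
      then show ?thesis using True X'Q[OF j] Qj c0 by (simp add: c'_def)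
    next
      case False
      then show ?thesis using c(1) by (simp add: c'_def curve_def)
    qed
    have c'0: "c' 0 = y" using Qj c0 by (simp add: c'_def)
    have c'T: "c' z v = y v" if "v \<notin> T'" for z v using that c(2) w by (auto simp: c'_def)
    have "curve e y X' c'" unfolding curve_def
      using c'0 d eventually_regular[OF yr T', of c'] c'T DERIV_isCont[OF d] by blast
    moreover have "\<forall>\<^sub>F z in nhds 0. pd w (Q e j m) (c z) \<noteq> 0"
      by (rule isCont_eventually_ne[OF curve_isCont[OF rat_pd[OF rat_Q] c(1)]]) (use Qj c0 in simp)
    then have "\<forall>\<^sub>F z in nhds 0. \<forall>i\<in>{H - int (Suc d)<..H}. Q e i m (c' z) = 0"
      using c(3)
    proof eventually_elim
      case (elim z)
      show ?case
      proof
        fix i assume i: "i \<in> {H - int (Suc d)<..H}"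
        show "Q e i m (c' z) = 0"
        proof (cases "i = j")
          case True
          let ?y = "c z"
          let ?D = "D3 e j m (?y (U (j, m))) (?y (U (j + 1, m))) (?y (U (j + 1, m + 1))) (?y PA) (?y PB)"
          have D: "pd w (Q e j m) ?y = ?D" using pd_Q_corner(3)[OF e] by (simp add: w_def)
          have "Q e j m (c' z) = Q e j m ?y + (c' z w - ?y w) * ?D"
            unfolding Q_def c'_def w_def
            by (simp, subst (1 2) E_affine(3)[OF e]) (simp add: algebra_simps)
          then show ?thesis using True elim(1) unfolding D[symmetric] by (simp add: c'_def)
        next
          case False
          then have "i \<in> {H - int d<..H}" using i by (auto simp: j_def)
          moreover from this have "Q e i m (c' z) = Q e i m (c z)"
            by (auto simp: Q_def c'_def w_def j_def)
          ultimately show ?thesis using elim by simp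
        qed
      qed
    qed
    ultimately show ?case using c'T by blast
  qed
  obtain c where c: "curve e y X' c" "\<forall>\<^sub>F z in nhds 0. \<forall>i\<in>{L..H}. Q e i m (c z) = 0"
  proof (cases "L \<le> H")
    case True
    then have "{H - int (nat (H - L + 1))<..H} = {L..H}" by auto
    then show ?thesis using main[of "nat (H - L + 1)"] that True by auto
  next
    case False
    then show ?thesis using that straight_curve[OF yr T', of X] by (simp add: X'_def)
  qed
  have "\<forall>\<^sub>F z in nhds 0. pd (U (i, m + 1)) (Q e i m) (c z) \<noteq> 0" if "i \<in> {L..H}" for i
    by (rule isCont_eventually_ne[OF curve_isCont[OF rat_pd[OF rat_Q] c(1)]])
       (use y that c(1) in \<open>auto simp: row_solution_def curve_def\<close>)
  then have "\<forall>\<^sub>F z in nhds 0. \<forall>i\<in>{L..H}. pd (U (i, m + 1)) (Q e i m) (c z) \<noteq> 0"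
    by (intro eventually_ball_finite) auto
  moreover have "\<forall>\<^sub>F z in nhds 0. c z \<in> regular e" using c(1) by (simp add: curve_def)
  ultimately have "\<forall>\<^sub>F z in nhds 0. row_solution e m L H (c z)"
    using c(2) by eventually_elim (simp add: row_solution_def)
  moreover have "\<forall>v\<in>T. X' v = X v" by (auto simp: X'_def T'_def)
  ultimately show ?thesis using c(1) by blast
qed

section \<open>The three-point symmetries\<close>

text \<open>\<open>f_polar\<close> is the symmetric bilinear polarisation of \<open>f\<close> in its second value argument; the
  characteristic \<open>R0\<close> equals \<open>f_polar u x y / (x - y)\<close> with \<open>x\<close>, \<open>y\<close> the two neighbours of \<open>u\<close>.\<close>

fun f_polar :: "quad_eq \<Rightarrow> int \<Rightarrow> int \<Rightarrow> complex \<Rightarrow> complex \<Rightarrow> complex \<Rightarrow> complex \<Rightarrow> complex" where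
  "f_polar (H1 \<epsilon> \<sigma>) n m u x y \<alpha> =
     1 - \<epsilon> * (Y_weight \<sigma> n m * u^2 + X_weight \<sigma> n m * x * y)"
| "f_polar (H2 \<epsilon> \<sigma>) n m u x y \<alpha> =
     2 * u + x + y + 2 * \<alpha> - 4 * \<epsilon> * (Y_weight \<sigma> n m * (u + \<alpha>)^2 + X_weight \<sigma> n m * (x + \<alpha>) * (y + \<alpha>))"
| "f_polar (H3 \<epsilon> \<delta> \<sigma>) n m u x y \<alpha> =
     u * (x + y) / 2 + \<delta> * \<alpha> - \<epsilon> / \<alpha> * (Y_weight \<sigma> n m * u^2 + X_weight \<sigma> n m * x * y)"

lemma f_polar_sym: "f_polar e n m u x y a = f_polar e n m u y x a"
  by (cases e) (auto simp: algebra_simps)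

lemma f_polar_diag: "f_polar e n m u x x a = f_poly e n m u x a"
  by (cases e) (auto simp: algebra_simps power2_eq_square)

definition f_slope :: "quad_eq \<Rightarrow> int \<Rightarrow> int \<Rightarrow> complex \<Rightarrow> complex \<Rightarrow> complex \<Rightarrow> complex" where
  "f_slope e n m u y a = f_polar e n m u 1 y a - f_polar e n m u 0 y a"

lemma f_polar_affine: "f_polar e n m u x y a = f_polar e n m u 0 y a + x * f_slope e n m u y a"
  by (cases e) (auto simp: f_slope_def algebra_simps add_divide_distrib)

text \<open>\<open>f\<close> is the diagonal of a symmetric form that is affine in each slot, hence
  the factor 2.\<close>

lemma f_second_eq: "f_second e n m u x a = 2 * f_slope e n m u x a"
proof (cases e)
  case (H1 \<epsilon> \<sigma>)
  show ?thesis unfolding f_second_def H1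
    by (rule DERIV_imp_deriv) (auto intro!: derivative_eq_intros simp: f_slope_def algebra_simps)
next
  case (H2 \<epsilon> \<sigma>)
  show ?thesis unfolding f_second_def H2
    by (rule DERIV_imp_deriv) (auto intro!: derivative_eq_intros simp: f_slope_def algebra_simps)
next
  case (H3 \<epsilon> \<delta> \<sigma>)
  define k where "k = \<epsilon> / a"
  show ?thesis unfolding f_second_def f_slope_def H3 f_poly.simps f_polar.simps k_def[symmetric]
    by (rule DERIV_imp_deriv) (auto intro!: derivative_eq_intros simp: algebra_simps)
qed

text \<open>The term with half the derivative of \<open>f\<close> is exactly what replaces one of
  the two equal arguments of the polarisation by the other neighbour. The quotient so obtained is
  antisymmetric in the two neighbours, which \<open>right_identity\<close> exploits.\<close>

lemma R0_n_eq:
  assumes "u (n + 1, m) \<noteq> u (n - 1, m)"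
  shows "R0_n e n m a b u = f_polar e n m (u (n, m)) (u (n + 1, m)) (u (n - 1, m)) a
    / (u (n + 1, m) - u (n - 1, m))"
proof -
  let ?x = "u (n + 1, m)" and ?y = "u (n - 1, m)" and ?u = "u (n, m)"
  have "f_polar e n m ?u ?x ?y a = f_polar e n m ?u ?x ?x a - (?x - ?y) * f_slope e n m ?u ?x a"
    using f_polar_affine[of e n m ?u ?x ?x a] f_polar_affine[of e n m ?u ?y ?x a]
      f_polar_sym[of e n m ?u ?x ?y a] by (simp add: algebra_simps)
  then show ?thesis unfolding R0_n_def f_second_eq f_polar_diag using assms
    by (simp add: divide_simps)
qed

definition lift :: "lattice_fun \<Rightarrow> int \<Rightarrow> int \<Rightarrow> state \<Rightarrow> complex" where
  "lift R n m y = R n m (y PA) (y PB) (\<lambda>p. y (U p))"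

abbreviation r0 :: "quad_eq \<Rightarrow> int \<Rightarrow> int \<Rightarrow> state \<Rightarrow> complex" where
  "r0 e \<equiv> lift (R0_n e)"

lemma regular_ne: "y \<in> regular e \<Longrightarrow> y (U (n + 1, m)) \<noteq> y (U (n - 1, m))"
  by (auto simp: regular_def nonsingular_def)

lemma r0_eq:
  "y \<in> regular e \<Longrightarrow> r0 e n m y = f_polar e n m (y (U (n, m))) (y (U (n + 1, m))) (y (U (n - 1, m))) (y PA)
    / (y (U (n + 1, m)) - y (U (n - 1, m)))"
  unfolding lift_def by (rule R0_n_eq) (rule regular_ne)

lemma rat_f_polar: "rational_on e (\<lambda>y. f_polar e n m (y u) (y v) (y w) (y PA))"
proof (cases e)
  case (H3 \<epsilon> \<delta> \<sigma>)
  show ?thesis unfolding H3 f_polar.simps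
    by (intro rat_intros rat_divide) (auto simp: regular_def)
qed (simp_all, (intro rat_intros)+)

lemma rat_r0: "rational_on e (r0 e n m)"
  by (rule rat_cong[OF rat_divide[OF rat_f_polar rat_diff[OF rat_var rat_var]]])
     (use regular_ne r0_eq in auto)

text \<open>In this and the next two lemmas \<open>b\<close>, \<open>c\<close>, \<open>a\<close> are
  the values at n, n + 1, n - 1 of the lower row, capitals those of the upper row. The hypotheses
  are the equations on the two squares sharing the side \<open>b\<close>, \<open>B\<close>, the left
  one mirrored; the two parts belong to the two colours of the checkerboard. The conclusion is one
  half of the symmetry condition, cleared of denominators.\<close>

lemma polar_identity_H1:
  fixes b c a B C A k e :: complex
  shows "(b-C)*(c-B)-k+e*k*c*B = 0 \<Longrightarrow> (b-A)*(a-B)-k+e*k*a*B = 0 \<Longrightarrow>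
      (1-e*a*c)*(C-A)*(c-B) + (1-e*B^2)*(c-a)*(-(b-C)+e*k*c) + (-1+e*c*B)*(c-a)*(C-A) = 0"
    and "(b-C)*(c-B)-k+e*k*b*C = 0 \<Longrightarrow> (b-A)*(a-B)-k+e*k*b*A = 0 \<Longrightarrow>
      (1-e*b^2)*(C-A)*(c-B+e*k*C) + (1-e*A*C)*(c-a)*(-(b-C)) + (-1+e*b*C)*(c-a)*(C-A) = 0"
  by algebra+

lemma polar_identity_H2:
  fixes b c a B C A k e x y :: complex
  shows "(b-C)*(c-B)+(y-x)*(b+c+B+C)-x^2+y^2-e*(y-x)^3-e*(y-x)*(2*c+x+y)*(2*B+x+y) = 0 \<Longrightarrow>
      (b-A)*(a-B)+(y-x)*(b+a+B+A)-x^2+y^2-e*(y-x)^3-e*(y-x)*(2*a+x+y)*(2*B+x+y) = 0 \<Longrightarrow>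
      (2*b+(a+c)+2*x-4*e*(a+x)*(c+x))*(C-A)*((c-B)+(y-x))
      + (2*B+(A+C)+2*x-4*e*(B+x)^2)*(c-a)*(-(b-C)+(y-x)-2*e*(y-x)*(2*c+x+y))
      + (-(b+c+B+C)-2*x+3*e*(y-x)^2+e*(2*c+x+y)*(2*B+x+y)-e*(y-x)*(2*c+x+y+2*B+x+y))*(c-a)*(C-A) = 0"
    and "(b-C)*(c-B)+(y-x)*(b+c+B+C)-x^2+y^2-e*(y-x)^3-e*(y-x)*(2*b+x+y)*(2*C+x+y) = 0 \<Longrightarrow>
      (b-A)*(a-B)+(y-x)*(b+a+B+A)-x^2+y^2-e*(y-x)^3-e*(y-x)*(2*b+x+y)*(2*A+x+y) = 0 \<Longrightarrow>
      (2*b+(a+c)+2*x-4*e*(b+x)^2)*(C-A)*((c-B)+(y-x)-2*e*(y-x)*(2*C+x+y))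
      + (2*B+(A+C)+2*x-4*e*(A+x)*(C+x))*(c-a)*(-(b-C)+(y-x))
      + (-(b+c+B+C)-2*x+3*e*(y-x)^2+e*(2*b+x+y)*(2*C+x+y)-e*(y-x)*(2*b+x+y+2*C+x+y))*(c-a)*(C-A) = 0"
  by algebra+

text \<open>Here \<open>k\<close> is \<open>\<epsilon> / (\<alpha> \<beta>)\<close>.\<close>

lemma polar_identity_H3:
  fixes b c a B C A k d x y :: complex
  shows "x*(b*c+B*C)-y*(b*B+c*C)+(x^2-y^2)*(d-k*c*B) = 0 \<Longrightarrow>
      x*(b*a+B*A)-y*(b*B+a*A)+(x^2-y^2)*(d-k*a*B) = 0 \<Longrightarrow>
      (b*(a+c)+2*d*x-2*k*y*a*c)*(C-A)*(x*c-y*B)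
      + (B*(A+C)+2*d*x-2*k*y*B^2)*(c-a)*(x*C-y*b-(x^2-y^2)*k*c)
      - (x*(b*c+B*C)+2*x^2*d-k*(x^2+y^2)*c*B)*(c-a)*(C-A) = 0"
    and "x*(b*c+B*C)-y*(b*B+c*C)+(x^2-y^2)*(d-k*b*C) = 0 \<Longrightarrow>
      x*(b*a+B*A)-y*(b*B+a*A)+(x^2-y^2)*(d-k*b*A) = 0 \<Longrightarrow>
      (b*(a+c)+2*d*x-2*k*y*b^2)*(C-A)*(x*c-y*B-(x^2-y^2)*k*C)
      + (B*(A+C)+2*d*x-2*k*y*A*C)*(c-a)*(x*C-y*b)
      - (x*(b*c+B*C)+2*x^2*d-k*(x^2+y^2)*b*C)*(c-a)*(C-A) = 0"
  by algebra+

lemma divide_sum_eq: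
  assumes "c \<noteq> (a :: complex)" "C \<noteq> A" "p * (C - A) * s + q * (c - a) * t + w * (c - a) * (C - A) = 0"
  shows "p / (c - a) * s + q / (C - A) * t = - w"
proof -
  have ne: "c - a \<noteq> 0" "C - A \<noteq> 0" using assms by auto
  have "p / (c - a) * s + q / (C - A) * t + w =
      (p * (C - A) * s + q * (c - a) * t + w * (c - a) * (C - A)) / ((c - a) * (C - A))"
    using ne by (simp add: divide_simps) (simp add: algebra_simps)?
  also have "\<dots> = 0" using assms(3) by simp
  finally show ?thesis by (simp add: eq_neg_iff_add_eq_0)
qed

text \<open>The symmetry condition on one square splits into two halves, one for each of its vertical
  sides; each half needs only the squares adjacent to that side.\<close>

lemma left_identity:
  assumes e: "valid_sign e" and ad: "admissible e \<alpha> \<beta>"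
    and E: "E_poly e b c B C n m \<alpha> \<beta> = 0" "E_poly e b a B A n m \<alpha> \<beta> = 0"
    and ne: "c \<noteq> a" "C \<noteq> A"
  shows "f_polar e n m b c a \<alpha> / (c - a) * D1 e n m c B C \<alpha> \<beta>
     + f_polar e n (m + 1) B C A \<alpha> / (C - A) * D3 e n m b c C \<alpha> \<beta> = - (r_fun e \<alpha> * Da e n m b c B C \<alpha> \<beta>)"
proof (rule divide_sum_eq[OF ne])
  show "f_polar e n m b c a \<alpha> * (C - A) * D1 e n m c B C \<alpha> \<beta>
     + f_polar e n (m + 1) B C A \<alpha> * (c - a) * D3 e n m b c C \<alpha> \<beta>
     + r_fun e \<alpha> * Da e n m b c B C \<alpha> \<beta> * (c - a) * (C - A) = 0"
  proof (cases e)
    case (H1 \<epsilon> \<sigma>)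
    with e have "\<sigma> \<in> {1, - 1}" by simp
    then show ?thesis
    proof (rule weight_cases[of \<sigma> n m], goal_cases)
      case 1
      then show ?case using polar_identity_H1(1)[of b C c B "\<alpha> - \<beta>" \<epsilon> A a] E
        by (simp add: H1 D1_def D3_def) (simp add: algebra_simps)
    next
      case 2
      then show ?case using polar_identity_H1(2)[of b C c B "\<alpha> - \<beta>" \<epsilon> A a] E
        by (simp add: H1 D1_def D3_def) (simp add: algebra_simps)
    qed
  next
    case (H2 \<epsilon> \<sigma>)
    with e have "\<sigma> \<in> {1, - 1}" by simp
    then show ?thesis
    proof (rule weight_cases[of \<sigma> n m], goal_cases)
      case 1
      have "f_polar e n m b c a \<alpha> = 2*b+(a+c)+2*\<alpha>-4*\<epsilon>*(a+\<alpha>)*(c+\<alpha>)"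
        "f_polar e n (m + 1) B C A \<alpha> = 2*B+(A+C)+2*\<alpha>-4*\<epsilon>*(B+\<alpha>)^2"
        "D1 e n m c B C \<alpha> \<beta> = (c-B)+(\<beta>-\<alpha>)"
        "D3 e n m b c C \<alpha> \<beta> = -(b-C)+(\<beta>-\<alpha>)-2*\<epsilon>*(\<beta>-\<alpha>)*(2*c+\<alpha>+\<beta>)"
        "r_fun e \<alpha> * Da e n m b c B C \<alpha> \<beta> = -(b+c+B+C)-2*\<alpha>+3*\<epsilon>*(\<beta>-\<alpha>)^2+\<epsilon>*(2*c+\<alpha>+\<beta>)*(2*B+\<alpha>+\<beta>)-\<epsilon>*(\<beta>-\<alpha>)*(2*c+\<alpha>+\<beta>+2*B+\<alpha>+\<beta>)"
        using 1 by (simp_all add: H2 D1_def D3_def) (simp_all add: algebra_simps power2_eq_square)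
      note eqs = this
      show ?case unfolding eqs
        by (rule polar_identity_H2(1)) (use E 1 in \<open>simp_all add: H2\<close>)
    next
      case 2
      have "f_polar e n m b c a \<alpha> = 2*b+(a+c)+2*\<alpha>-4*\<epsilon>*(b+\<alpha>)^2"
        "f_polar e n (m + 1) B C A \<alpha> = 2*B+(A+C)+2*\<alpha>-4*\<epsilon>*(A+\<alpha>)*(C+\<alpha>)"
        "D1 e n m c B C \<alpha> \<beta> = (c-B)+(\<beta>-\<alpha>)-2*\<epsilon>*(\<beta>-\<alpha>)*(2*C+\<alpha>+\<beta>)"
        "D3 e n m b c C \<alpha> \<beta> = -(b-C)+(\<beta>-\<alpha>)"
        "r_fun e \<alpha> * Da e n m b c B C \<alpha> \<beta> = -(b+c+B+C)-2*\<alpha>+3*\<epsilon>*(\<beta>-\<alpha>)^2+\<epsilon>*(2*b+\<alpha>+\<beta>)*(2*C+\<alpha>+\<beta>)-\<epsilon>*(\<beta>-\<alpha>)*(2*b+\<alpha>+\<beta>+2*C+\<alpha>+\<beta>)"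
        using 2 by (simp_all add: H2 D1_def D3_def) (simp_all add: algebra_simps power2_eq_square)
      note eqs = this
      show ?case unfolding eqs
        by (rule polar_identity_H2(2)) (use E 2 in \<open>simp_all add: H2\<close>)
    qed
  next
    case (H3 \<epsilon> \<delta> \<sigma>)
    with e have \<sigma>: "\<sigma> \<in> {1, - 1}" by simp
    define k where "k = \<epsilon> / (\<alpha> * \<beta>)"
    have \<epsilon>: "\<epsilon> = k * \<alpha> * \<beta>" and ab: "\<alpha> \<noteq> 0" "\<beta> \<noteq> 0" using ad H3 by (auto simp: k_def)
    have "\<epsilon> * (1 / \<beta> + \<beta> / \<alpha>^2) = k * (\<alpha>^2 + \<beta>^2) / \<alpha>" "\<epsilon> / \<alpha> = k * \<beta>"
      "\<epsilon> * (\<alpha>^2 - \<beta>^2) / (\<alpha> * \<beta>) = k * (\<alpha>^2 - \<beta>^2)"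
      using ab by (simp_all add: \<epsilon> field_simps power2_eq_square)
    note s = this
    \<comment> \<open>The halves in \<open>f_polar\<close> and in \<open>r_fun\<close> are pulled
      out, since \<open>polar_identity_H3\<close> is stated without them.\<close>
    have half: "p / 2 * u * s + q / 2 * v * t + - (w / 2) * v * u = 0"
      if "p * u * s + q * v * t - w * v * u = 0" for p q s t u v w :: complex
      using that by (simp add: field_simps)
    from \<sigma> show ?thesis
    proof (rule weight_cases[of \<sigma> n m], goal_cases)
      case 1
      have "f_polar e n m b c a \<alpha> = (b*(a+c)+2*\<delta>*\<alpha>-2*k*\<beta>*a*c) / 2"
        "f_polar e n (m + 1) B C A \<alpha> = (B*(A+C)+2*\<delta>*\<alpha>-2*k*\<beta>*B^2) / 2"
        "D1 e n m c B C \<alpha> \<beta> = \<alpha>*c-\<beta>*B"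
        "D3 e n m b c C \<alpha> \<beta> = \<alpha>*C-\<beta>*b-(\<alpha>^2-\<beta>^2)*k*c"
        "r_fun e \<alpha> * Da e n m b c B C \<alpha> \<beta> =
          - ((\<alpha>*(b*c+B*C)+2*\<alpha>^2*\<delta>-k*(\<alpha>^2+\<beta>^2)*c*B) / 2)"
        using 1 ab by (simp_all add: H3 D1_def D3_def s) (simp_all add: field_simps power2_eq_square)
      note eqs = this
      show ?case unfolding eqs
        by (rule half, rule polar_identity_H3(1))
           (use E 1 in \<open>simp_all add: H3 s\<close>, simp_all add: algebra_simps)
    next
      case 2
      have "f_polar e n m b c a \<alpha> = (b*(a+c)+2*\<delta>*\<alpha>-2*k*\<beta>*b^2) / 2"
        "f_polar e n (m + 1) B C A \<alpha> = (B*(A+C)+2*\<delta>*\<alpha>-2*k*\<beta>*A*C) / 2"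
        "D1 e n m c B C \<alpha> \<beta> = \<alpha>*c-\<beta>*B-(\<alpha>^2-\<beta>^2)*k*C"
        "D3 e n m b c C \<alpha> \<beta> = \<alpha>*C-\<beta>*b"
        "r_fun e \<alpha> * Da e n m b c B C \<alpha> \<beta> =
          - ((\<alpha>*(b*c+B*C)+2*\<alpha>^2*\<delta>-k*(\<alpha>^2+\<beta>^2)*b*C) / 2)"
        using 2 ab by (simp_all add: H3 D1_def D3_def s) (simp_all add: field_simps power2_eq_square)
      note eqs = this
      show ?case unfolding eqs
        by (rule half, rule polar_identity_H3(2))
           (use E 2 in \<open>simp_all add: H3 s\<close>, simp_all add: algebra_simps)
    qed
  qed
qed

lemma weight_shift:
  "X_weight \<sigma> (n + 1) m = Y_weight \<sigma> n m" "Y_weight \<sigma> (n + 1) m = X_weight \<sigma> n m"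
  "X_weight \<sigma> n (m + 1) = Y_weight \<sigma> n m" "Y_weight \<sigma> n (m + 1) = X_weight \<sigma> n m"
proof -
  have "(-1 :: complex) powi (n + 1 + m) = - ((-1) powi (n + m))"
    using power_int_add[of "-1 :: complex" "n + m" 1] by (simp add: add_ac)
  then show "X_weight \<sigma> (n + 1) m = Y_weight \<sigma> n m" "Y_weight \<sigma> (n + 1) m = X_weight \<sigma> n m"
    "X_weight \<sigma> n (m + 1) = Y_weight \<sigma> n m" "Y_weight \<sigma> n (m + 1) = X_weight \<sigma> n m"
    by (simp_all add: X_weight_def Y_weight_def add_ac)
qed

text \<open>Mirroring a square in its vertical axis exchanges the corners within each row, and
  stepping from n to n + 1 exchanges the two weights, which compensates. It also gives the equation
  of the square on the left in the form needed by \<open>left_identity\<close>.\<close>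

lemma E_reflect: "E_poly e x2 x1 x4 x3 (n + 1) m a b = E_poly e x1 x2 x3 x4 n m a b"
  by (cases e) (simp_all only: E_poly.simps Da.simps weight_shift, simp_all add: divide_inverse algebra_simps)

lemma Da_reflect: "Da e (n + 1) m x2 x1 x4 x3 a b = Da e n m x1 x2 x3 x4 a b"
  by (cases e) (simp_all only: E_poly.simps Da.simps weight_shift, simp_all add: divide_inverse algebra_simps)

lemma f_polar_shift: "f_polar e n (m + 1) u x y a = f_polar e (n + 1) m u x y a"
  by (cases e) (simp_all add: weight_shift)

text \<open>Mirror image of \<open>left_identity\<close>. The denominators change sign under the
  reflection while \<open>Da\<close> does not, hence the opposite sign on the right-hand
  side.\<close>

lemma right_identity:
  assumes e: "valid_sign e" and ad: "admissible e \<alpha> \<beta>"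
    and E: "E_poly e b c B C n m \<alpha> \<beta> = 0" "E_poly e c d C D (n + 1) m \<alpha> \<beta> = 0"
    and ne: "d \<noteq> b" "D \<noteq> B"
  shows "f_polar e (n + 1) m c d b \<alpha> / (d - b) * D2 e n m b B C \<alpha> \<beta>
     + f_polar e (n + 1) (m + 1) C D B \<alpha> / (D - B) * D4 e n m b c B \<alpha> \<beta> = r_fun e \<alpha> * Da e n m b c B C \<alpha> \<beta>"
proof -
  have "f_polar e (n + 1) m c b d \<alpha> / (b - d) * D1 e (n + 1) m b C B \<alpha> \<beta>
     + f_polar e (n + 1) (m + 1) C B D \<alpha> / (B - D) * D3 e (n + 1) m c b B \<alpha> \<beta>
     = - (r_fun e \<alpha> * Da e (n + 1) m c b C B \<alpha> \<beta>)"
    by (rule left_identity[OF e ad]) (use E ne in \<open>simp_all add: E_reflect\<close>)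
  moreover have "D1 e (n + 1) m b C B \<alpha> \<beta> = D2 e n m b B C \<alpha> \<beta>"
    "D3 e (n + 1) m c b B \<alpha> \<beta> = D4 e n m b c B \<alpha> \<beta>"
    by (simp_all add: D1_def D2_def D3_def D4_def E_reflect)
  moreover have "x / (b - d) = - (x / (d - b))" "x / (B - D) = - (x / (D - B))" for x
    by (metis minus_diff_eq minus_divide_right)+
  ultimately have h: "- (f_polar e (n + 1) m c d b \<alpha> / (d - b)) * D2 e n m b B C \<alpha> \<beta>
     + - (f_polar e (n + 1) (m + 1) C D B \<alpha> / (D - B)) * D4 e n m b c B \<alpha> \<beta>
     = - (r_fun e \<alpha> * Da e n m b c B C \<alpha> \<beta>)"
    by (simp only: Da_reflect f_polar_sym[of e _ _ _ b d] f_polar_sym[of e _ _ _ B D])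
  have neg: "p * s + q * t = w" if "- p * s + - q * t = - w" for p q s t w :: complex
    using that by (metis add.inverse_inverse minus_add_distrib mult_minus_left)
  show ?thesis by (rule neg[OF h])
qed

section \<open>Prolonged fields and the symmetry condition on one square\<close>

definition field_vec :: "(int \<Rightarrow> int \<Rightarrow> state \<Rightarrow> complex) \<Rightarrow> (state \<Rightarrow> complex) \<Rightarrow> state \<Rightarrow> var \<Rightarrow> complex" where
  "field_vec R s y v = (case v of PA \<Rightarrow> s y | PB \<Rightarrow> 0 | U p \<Rightarrow> R (fst p) (snd p) y)"

lemma field_vec_simps [simp]:
  "field_vec R s y PA = s y" "field_vec R s y PB = 0" "field_vec R s y (U (i, j)) = R i j y"
  by (simp_all add: field_vec_def)

lemma act_vec_Q:
  "act (field_vec R s y) (Q e n m) y = (R n m y * pd (U (n, m)) (Q e n m) y + R n (m + 1) y * pd (U (n, m + 1)) (Q e n m) y)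
     + (R (n + 1) m y * pd (U (n + 1, m)) (Q e n m) y + R (n + 1) (m + 1) y * pd (U (n + 1, m + 1)) (Q e n m) y)
     + s y * pd PA (Q e n m) y"
  unfolding act_Q sum_corners by simp

text \<open>The halves are opposite, so \<open>v_n\<close> is a symmetry. Weighted with n and n + 1
  they leave exactly one copy of r times the \<alpha>-derivative of the equation, which the
  parameter part of \<open>V_n\<close> cancels: this is the origin of r. The left half reads the
  squares n - 1 and n, the right half n and n + 1.\<close>

lemma r0_halves:
  assumes e: "valid_sign e" and y: "row_solution e m (n - 1) (n + 1) y"
  shows "r0 e n m y * pd (U (n, m)) (Q e n m) y + r0 e n (m + 1) y * pd (U (n, m + 1)) (Q e n m) y
      = - (r_fun e (y PA) * pd PA (Q e n m) y)"
    and "r0 e (n + 1) m y * pd (U (n + 1, m)) (Q e n m) y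
      + r0 e (n + 1) (m + 1) y * pd (U (n + 1, m + 1)) (Q e n m) y
      = r_fun e (y PA) * pd PA (Q e n m) y"
proof -
  have yr: "y \<in> regular e" and ad: "admissible e (y PA) (y PB)"
    using y by (auto simp: row_solution_def regular_def)
  have q: "Q e (n - 1) m y = 0" "Q e n m y = 0" "Q e (n + 1) m y = 0"
    using y by (auto simp: row_solution_def)
  show "r0 e n m y * pd (U (n, m)) (Q e n m) y + r0 e n (m + 1) y * pd (U (n, m + 1)) (Q e n m) y
      = - (r_fun e (y PA) * pd PA (Q e n m) y)"
    unfolding r0_eq[OF yr] pd_Q_corner[OF e] pd_Q_PA[OF yr]
  proof (rule left_identity[OF e ad])
    show "E_poly e (y (U (n, m))) (y (U (n + 1, m))) (y (U (n, m + 1))) (y (U (n + 1, m + 1))) n m (y PA) (y PB) = 0"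
      using q(2) by (simp add: Q_def)
    show "E_poly e (y (U (n, m))) (y (U (n - 1, m))) (y (U (n, m + 1))) (y (U (n - 1, m + 1))) n m (y PA) (y PB) = 0"
      using q(1) E_reflect[of e "y (U (n, m))" "y (U (n - 1, m))" "y (U (n, m + 1))" "y (U (n - 1, m + 1))" "n - 1"]
      by (simp add: Q_def)
  qed (use regular_ne[OF yr] in auto)
  show "r0 e (n + 1) m y * pd (U (n + 1, m)) (Q e n m) y
      + r0 e (n + 1) (m + 1) y * pd (U (n + 1, m + 1)) (Q e n m) y
      = r_fun e (y PA) * pd PA (Q e n m) y"
    unfolding r0_eq[OF yr] pd_Q_corner[OF e] pd_Q_PA[OF yr] add_diff_cancel_right'
  proof (rule right_identity[OF e ad])
    show "E_poly e (y (U (n, m))) (y (U (n + 1, m))) (y (U (n, m + 1))) (y (U (n + 1, m + 1))) n m (y PA) (y PB) = 0"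
      using q(2) by (simp add: Q_def)
    show "E_poly e (y (U (n + 1, m))) (y (U (n + 1 + 1, m))) (y (U (n + 1, m + 1))) (y (U (n + 1 + 1, m + 1))) (n + 1) m (y PA) (y PB) = 0"
      using q(3) by (simp add: Q_def)
  qed (use regular_ne[OF yr, of "n + 1"] in \<open>simp_all\<close>)
qed

definition master_vec :: "quad_eq \<Rightarrow> state \<Rightarrow> var \<Rightarrow> complex" where
  "master_vec e = field_vec (\<lambda>i j y. of_int i * r0 e i j y) (\<lambda>y. - r_fun e (y PA))"

lemma master_vec_symmetry:
  assumes "valid_sign e" "row_solution e m (n - 1) (n + 1) y"
  shows "act (master_vec e y) (Q e n m) y = 0"
proof -
  have *: "(N * r1 * p1 + N * r3 * p3) + ((N + 1) * r2 * p2 + (N + 1) * r4 * p4) + - r * pa = 0"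
    if "r1 * p1 + r3 * p3 = - (r * pa)" "r2 * p2 + r4 * p4 = r * pa"
    for N r1 r2 r3 r4 p1 p2 p3 p4 r pa :: complex
  proof -
    have "(N * r1 * p1 + N * r3 * p3) + ((N + 1) * r2 * p2 + (N + 1) * r4 * p4) + - r * pa
      = N * (r1 * p1 + r3 * p3) + (N + 1) * (r2 * p2 + r4 * p4) - r * pa"
      by (simp add: algebra_simps)
    then show ?thesis unfolding that by (simp add: algebra_simps)
  qed
  show ?thesis
    unfolding master_vec_def act_vec_Q of_int_add of_int_1 by (rule *[OF r0_halves[OF assms]])
qed

lemma r0_symmetry:
  assumes "valid_sign e" "row_solution e m (n - 1) (n + 1) y"
  shows "act (field_vec (r0 e) (\<lambda>_. 0) y) (Q e n m) y = 0"
  unfolding act_vec_Q using r0_halves[OF assms] by simp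

section \<open>Commutators of symmetries\<close>

lemma act_cong:
  assumes "\<And>v. pd v g y \<noteq> 0 \<Longrightarrow> X v = X' v"
  shows "act X g y = act X' g y"
  unfolding act_def using assms by (intro sum.cong) auto

definition qvars :: "int \<Rightarrow> int \<Rightarrow> var set" where
  "qvars n m = insert PA (insert PB (U ` corners n m))"

lemma finite_qvars [simp]: "finite (qvars n m)"
  by (simp add: qvars_def)

lemma act_Q_qvars: "act X (Q e n m) y = (\<Sum>v\<in>qvars n m. X v * pd v (Q e n m) y)"
  by (rule act_eq) (auto intro: pd_Q_zero simp: qvars_def)

text \<open>If the field \<open>Y\<close> annihilates the equation on solutions and \<open>X\<close> is tangent to the
  solutions, then differentiating \<open>Y E = 0\<close> along a curve of solutions with velocity \<open>X\<close>
  gives \<open>X (Y E) = 0\<close>.\<close>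

lemma tangent_derivative:
  assumes e: "valid_sign e" and y: "row_solution e m a b y"
    and X: "\<And>i. i \<in> {a..b} \<Longrightarrow> act X (Q e i m) y = 0"
    and Yrat: "\<And>v. v \<in> qvars n m \<Longrightarrow> rational_on e (\<lambda>y. Y y v)"
    and Y: "\<And>y. row_solution e m a b y \<Longrightarrow> act (Y y) (Q e n m) y = 0"
  shows "(\<Sum>v\<in>qvars n m. act X (\<lambda>y. Y y v) y * pd v (Q e n m) y + act X (pd v (Q e n m)) y * Y y v) = 0"
proof -
  have yr: "y \<in> regular e" using y by (simp add: row_solution_def)
  \<comment> \<open>\<open>tangent_curve\<close> realises \<open>X\<close> on a finite set only; it
    is chosen to contain every variable in which one of the functions differentiated below has a
    nonzero derivative at \<open>y\<close>.\<close>
  have "\<exists>T. finite T \<and> (\<forall>v\<in>qvars n m. {w. pd w (\<lambda>y. Y y v) y \<noteq> 0} \<union> {w. pd w (pd v (Q e n m)) y \<noteq> 0} \<subseteq> T)"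
  proof -
    have "finite {w. pd w (\<lambda>y. Y y v) y \<noteq> 0}" if "v \<in> qvars n m" for v
      using rat_finite_supp[OF Yrat[OF that]] yr by (smt (verit) finite_subset mem_Collect_eq subsetI)
    moreover have "finite {w. pd w (pd v (Q e n m)) y \<noteq> 0}" for v
      using rat_finite_supp[OF rat_pd[OF rat_Q]] yr by (smt (verit) finite_subset mem_Collect_eq subsetI)
    ultimately show ?thesis
      by (intro exI[of _ "\<Union>v\<in>qvars n m. {w. pd w (\<lambda>y. Y y v) y \<noteq> 0} \<union> {w. pd w (pd v (Q e n m)) y \<noteq> 0}"]) auto
  qed
  then obtain T where T: "finite T"
    "\<And>v w. v \<in> qvars n m \<Longrightarrow> pd w (\<lambda>y. Y y v) y \<noteq> 0 \<Longrightarrow> w \<in> T"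
    "\<And>v w. v \<in> qvars n m \<Longrightarrow> pd w (pd v (Q e n m)) y \<noteq> 0 \<Longrightarrow> w \<in> T"
    by blast
  obtain X' c where c: "curve e y X' c" "\<forall>v\<in>T. X' v = X v" "\<forall>\<^sub>F z in nhds 0. row_solution e m a b (c z)"
    using tangent_curve[OF e y X T(1)] by blast
  have c0: "c 0 = y" using c by (simp add: curve_def)
  have "((\<lambda>z. \<Sum>v\<in>qvars n m. Y (c z) v * pd v (Q e n m) (c z)) has_field_derivative
      (\<Sum>v\<in>qvars n m. act X' (\<lambda>y. Y y v) y * pd v (Q e n m) (c 0) + act X' (pd v (Q e n m)) y * Y (c 0) v)) (at 0)"
    by (intro DERIV_sum DERIV_mult rat_chain[OF _ c(1)] Yrat rat_pd rat_Q)
  moreover have "((\<lambda>z. \<Sum>v\<in>qvars n m. Y (c z) v * pd v (Q e n m) (c z)) has_field_derivative 0) (at 0)"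
  proof (rule has_field_derivative_eventually_cong[OF DERIV_const[of 0]])
    show "\<forall>\<^sub>F z in nhds 0. (\<Sum>v\<in>qvars n m. Y (c z) v * pd v (Q e n m) (c z)) = 0"
      using c(3) by eventually_elim (use Y act_Q_qvars in simp)
  qed
  ultimately have "(\<Sum>v\<in>qvars n m. act X' (\<lambda>y. Y y v) y * pd v (Q e n m) y + act X' (pd v (Q e n m)) y * Y y v) = 0"
    using c0 DERIV_unique by fastforce
  moreover have "act X' (\<lambda>y. Y y v) y = act X (\<lambda>y. Y y v) y"
      "act X' (pd v (Q e n m)) y = act X (pd v (Q e n m)) y" if "v \<in> qvars n m" for v
    by (intro act_cong; use that T c(2) in blast)+
  ultimately show ?thesis by simp
qed

lemma act_pd_Q:
  assumes "y \<in> regular e"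
  shows "act X (pd v (Q e n m)) y = (\<Sum>w\<in>qvars n m. X w * pd v (pd w (Q e n m)) y)"
proof -
  have "pd w (pd v (Q e n m)) y = 0" if "w \<notin> qvars n m" for w
  proof -
    have "pd w (pd v (Q e n m)) y = pd v (pd w (Q e n m)) y"
      by (rule pd_commute[OF rat_Q assms])
    also have "pd w (Q e n m) = (\<lambda>_. 0)"
      using that pd_Q_zero unfolding qvars_def by blast
    finally show ?thesis by simp
  qed
  then have "act X (pd v (Q e n m)) y = (\<Sum>w\<in>qvars n m. X w * pd w (pd v (Q e n m)) y)"
    by (intro act_eq) auto
  then show ?thesis using pd_commute[OF rat_Q assms] by simp
qed

text \<open>Both sides are the Hessian of the equation evaluated at \<open>X\<close> and
  \<open>Z\<close>.\<close>

lemma act_pd_Q_swap: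
  assumes "y \<in> regular e"
  shows "(\<Sum>v\<in>qvars n m. act X (pd v (Q e n m)) y * Z v) = (\<Sum>v\<in>qvars n m. act Z (pd v (Q e n m)) y * X v)"
proof -
  have "(\<Sum>v\<in>qvars n m. act X (pd v (Q e n m)) y * Z v) =
      (\<Sum>v\<in>qvars n m. \<Sum>w\<in>qvars n m. X w * pd v (pd w (Q e n m)) y * Z v)"
    by (simp add: act_pd_Q[OF assms] sum_distrib_right)
  also have "\<dots> = (\<Sum>w\<in>qvars n m. \<Sum>v\<in>qvars n m. X w * pd v (pd w (Q e n m)) y * Z v)"
    by (rule sum.swap)
  also have "\<dots> = (\<Sum>w\<in>qvars n m. \<Sum>v\<in>qvars n m. Z v * pd w (pd v (Q e n m)) y * X w)"
    by (intro sum.cong refl, subst pd_commute[OF rat_Q assms]) (simp add: mult_ac)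
  finally show ?thesis by (simp add: act_pd_Q[OF assms] sum_distrib_right)
qed

text \<open>Differentiating the condition of \<open>V\<close> along \<open>W\<close> requires
  \<open>W\<close> to be tangent to all squares in the window of \<open>V\<close>, and conversely;
  hence the two windows and the crossed hypotheses \<open>tW\<close> and \<open>tV\<close>.\<close>

lemma bracket_symmetry:
  assumes e: "valid_sign e"
    and y: "row_solution e m a b y" "row_solution e m a' b' y"
    and Vrat: "\<And>v. v \<in> qvars n m \<Longrightarrow> rational_on e (\<lambda>y. V y v)"
    and Wrat: "\<And>v. v \<in> qvars n m \<Longrightarrow> rational_on e (\<lambda>y. W y v)"
    and V: "\<And>y. row_solution e m a b y \<Longrightarrow> act (V y) (Q e n m) y = 0"
    and W: "\<And>y. row_solution e m a' b' y \<Longrightarrow> act (W y) (Q e n m) y = 0"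
    and tW: "\<And>i. i \<in> {a..b} \<Longrightarrow> act (W y) (Q e i m) y = 0"
    and tV: "\<And>i. i \<in> {a'..b'} \<Longrightarrow> act (V y) (Q e i m) y = 0"
  shows "act (\<lambda>v. act (V y) (\<lambda>y. W y v) y - act (W y) (\<lambda>y. V y v) y) (Q e n m) y = 0"
proof -
  let ?S = "qvars n m" and ?q = "Q e n m"
  have yr: "y \<in> regular e" using y by (simp add: row_solution_def)
  have 1: "(\<Sum>v\<in>?S. act (W y) (\<lambda>y. V y v) y * pd v ?q y + act (W y) (pd v ?q) y * V y v) = 0"
    by (rule tangent_derivative[OF e y(1) tW Vrat V])
  have 2: "(\<Sum>v\<in>?S. act (V y) (\<lambda>y. W y v) y * pd v ?q y + act (V y) (pd v ?q) y * W y v) = 0"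
    by (rule tangent_derivative[OF e y(2) tV Wrat W])
  have swap: "(\<Sum>v\<in>?S. act (W y) (pd v ?q) y * V y v) = (\<Sum>v\<in>?S. act (V y) (pd v ?q) y * W y v)"
    by (rule act_pd_Q_swap[OF yr])
  have cancel: "s = r" if "r + p = 0" "s + q = 0" "p = q" for r s p q :: complex
    using that by (metis add_right_cancel)
  have "(\<Sum>v\<in>?S. act (V y) (\<lambda>y. W y v) y * pd v ?q y) = (\<Sum>v\<in>?S. act (W y) (\<lambda>y. V y v) y * pd v ?q y)"
    by (rule cancel[OF 1[unfolded sum.distrib] 2[unfolded sum.distrib] swap])
  then show ?thesis by (simp add: act_Q_qvars algebra_simps sum_subtractf)
qed

section \<open>The hierarchy in the first lattice direction\<close>

text \<open>Independence of \<beta> later permits setting \<beta> = \<alpha>, and it removes the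
  \<beta>-derivative from the recursion operator.\<close>

definition chain :: "int \<Rightarrow> lattice_fun \<Rightarrow> bool" where
  "chain K R \<longleftrightarrow> depends_only_on R ({- K..K} \<times> {0}) \<and>
     (\<forall>n m a b b' u. R n m a b u = R n m a b' u)"

lemma depends_only_onD:
  assumes "depends_only_on R D" "\<And>i j. (i, j) \<in> D \<Longrightarrow> u (n + i, m + j) = w (n + i, m + j)"
  shows "R n m a b u = R n m a b w"
  using assms unfolding depends_only_on_def by blast

lemma partial_u_zero:
  assumes "depends_only_on R D" "(i, j) \<notin> D"
  shows "partial_u i j R n m a b u = 0"
proof -
  have "R n m a b (u((n + i, m + j) := z)) = R n m a b u" for z
    by (rule depends_only_onD[OF assms(1)]) (use assms(2) in auto)
  then show ?thesis by (simp add: partial_u_def)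
qed

lemma depends_partial_u:
  assumes "depends_only_on R D"
  shows "depends_only_on (partial_u i j R) D"
  unfolding depends_only_on_def
proof (intro allI impI)
  fix n m a b and u w :: field_values
  assume uw: "\<forall>(i, j)\<in>D. u (n + i, m + j) = w (n + i, m + j)"
  show "partial_u i j R n m a b u = partial_u i j R n m a b w"
  proof (cases "(i, j) \<in> D")
    case True
    have "R n m a b (u((n + i, m + j) := z)) = R n m a b (w((n + i, m + j) := z))" for z
      by (rule depends_only_onD[OF assms]) (use uw in auto)
    then show ?thesis using uw True by (auto simp: partial_u_def)
  next
    case False
    then show ?thesis using partial_u_zero[OF assms] by simp
  qed
qed

lemma depends_partial_\<alpha>:
  assumes "depends_only_on R D"
  shows "depends_only_on (partial_\<alpha> R) D"
  unfolding depends_only_on_def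
proof (intro allI impI)
  fix n m a b and u w :: field_values
  assume uw: "\<forall>(i, j)\<in>D. u (n + i, m + j) = w (n + i, m + j)"
  have "R n m z b u = R n m z b w" for z
    by (rule depends_only_onD[OF assms]) (use uw in auto)
  then show "partial_\<alpha> R n m a b u = partial_\<alpha> R n m a b w" by (simp add: partial_\<alpha>_def)
qed

lemma chain_depends: "chain K R \<Longrightarrow> depends_only_on R ({- K..K} \<times> {0})"
  by (simp add: chain_def)

lemma chain_beta: "chain K R \<Longrightarrow> R n m a b u = R n m a b' u"
  by (simp add: chain_def)

lemma chain_partial_u:
  assumes "chain K R"
  shows "chain K (partial_u i j R)"
  unfolding chain_def
proof (intro conjI allI depends_partial_u[OF chain_depends[OF assms]])
  fix n m a b b' u
  have "(\<lambda>z. R n m a b (u((n + i, m + j) := z))) = (\<lambda>z. R n m a b' (u((n + i, m + j) := z)))"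
    by (rule ext) (rule chain_beta[OF assms])
  then show "partial_u i j R n m a b u = partial_u i j R n m a b' u" by (simp add: partial_u_def)
qed

lemma chain_partial_\<alpha>:
  assumes "chain K R"
  shows "chain K (partial_\<alpha> R)"
  unfolding chain_def
proof (intro conjI allI depends_partial_\<alpha>[OF chain_depends[OF assms]])
  fix n m a b b' u
  have "(\<lambda>z. R n m z b u) = (\<lambda>z. R n m z b' u)"
    by (rule ext) (rule chain_beta[OF assms])
  then show "partial_\<alpha> R n m a b u = partial_\<alpha> R n m a b' u" by (simp add: partial_\<alpha>_def)
qed

lemma chain_R0: "chain 1 (R0_n e)"
  unfolding chain_def depends_only_on_def
proof (intro conjI allI impI)
  fix n m a b and u w :: field_values
  assume "\<forall>(i, j)\<in>{-1..1} \<times> {0}. u (n + i, m + j) = w (n + i, m + j)"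
  from this[rule_format, of "(0, 0)"] this[rule_format, of "(1, 0)"] this[rule_format, of "(-1, 0)"]
  show "R0_n e n m a b u = R0_n e n m a b w" by (simp add: R0_n_def)
qed (simp add: R0_n_def)

lemma chain_V_n: "chain 1 (chi (V_n e))"
  unfolding chain_def depends_only_on_def
proof (intro conjI allI impI)
  fix n m a b and u w :: field_values
  assume "\<forall>(i, j)\<in>{-1..1} \<times> {0}. u (n + i, m + j) = w (n + i, m + j)"
  then have "R0_n e n m a b u = R0_n e n m a b w"
    by (intro depends_only_onD[OF chain_depends[OF chain_R0]]) auto
  then show "chi (V_n e) n m a b u = chi (V_n e) n m a b w" by (simp add: V_n_def)
qed (simp add: V_n_def R0_n_def)

lemma lift_partial_u: "lift (partial_u i j R) n m y = pd (U (n + i, m + j)) (lift R n m) y"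
proof -
  have "(\<lambda>p. (y(U q := z)) (U p)) = (\<lambda>p. y (U p))(q := z)" for q z
    by auto
  then show ?thesis by (simp add: lift_def pd_def partial_u_def)
qed

lemma lift_partial_\<alpha>: "lift (partial_\<alpha> R) n m y = pd PA (lift R n m) y"
  by (simp add: lift_def pd_def partial_\<alpha>_def)

lemma lift_cong:
  assumes "chain K R" "y PA = y' PA" "\<And>i. y (U (n + i, m)) = y' (U (n + i, m))"
  shows "lift R n m y = lift R n m y'"
proof -
  have "R n m (y PA) (y PB) (\<lambda>p. y (U p)) = R n m (y PA) (y PB) (\<lambda>p. y' (U p))"
    by (rule depends_only_onD[of _ "{- K..K} \<times> {0}"]) (use assms in \<open>auto simp: chain_def\<close>)
  also have "\<dots> = R n m (y' PA) (y' PB) (\<lambda>p. y' (U p))"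
    unfolding assms(2) by (rule chain_beta[OF assms(1)])
  finally show ?thesis by (simp add: lift_def)
qed

lemma pd_lift_zero:
  assumes "chain K R" "v \<noteq> PA" "\<And>i. i \<in> {- K..K} \<Longrightarrow> v \<noteq> U (n + i, m)"
  shows "pd v (lift R n m) y = 0"
proof (cases v)
  case PB
  then show ?thesis
    by (intro pd_indep lift_cong[OF assms(1)]) auto
next
  case (U p)
  then obtain i j where p: "p = (n + i, m + j)"
    by (metis diff_add_cancel add.commute surj_pair)
  have "(i, j) \<notin> {- K..K} \<times> {0}" using assms(3)[of i] U p by auto
  then show ?thesis unfolding U p lift_partial_u[symmetric]
    unfolding lift_def by (rule partial_u_zero[OF chain_depends[OF assms(1)]])
qed (use assms in auto)

lemma act_lift:
  assumes "chain K R"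
  shows "act X (lift R n m) y =
    (\<Sum>i\<in>{- K..K}. X (U (n + i, m)) * pd (U (n + i, m)) (lift R n m) y) + X PA * pd PA (lift R n m) y"
proof -
  let ?S = "(\<lambda>i. U (n + i, m)) ` {- K..K}"
  have "act X (lift R n m) y = (\<Sum>v\<in>insert PA ?S. X v * pd v (lift R n m) y)"
    by (rule act_eq) (auto intro!: pd_lift_zero[OF assms])
  also have "\<dots> = X PA * pd PA (lift R n m) y + (\<Sum>v\<in>?S. X v * pd v (lift R n m) y)"
    by (subst sum.insert) auto
  also have "(\<Sum>v\<in>?S. X v * pd v (lift R n m) y) =
      (\<Sum>i\<in>{- K..K}. X (U (n + i, m)) * pd (U (n + i, m)) (lift R n m) y)"
    by (subst sum.reindex) (auto simp: inj_on_def)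
  finally show ?thesis by (simp add: add.commute)
qed

lemma Sum_any_row:
  fixes K :: int
  assumes "\<And>i j. (i, j) \<notin> {- K..K} \<times> {0 :: int} \<Longrightarrow> g i j = (0 :: complex)"
  shows "Sum_any (\<lambda>(i, j). g i j) = (\<Sum>i\<in>{- K..K}. g i 0)"
proof -
  have "Sum_any (\<lambda>(i, j). g i j) = (\<Sum>(i, j)\<in>{- K..K} \<times> {0}. g i j)"
    by (rule Sum_any.expand_superset) (use assms in \<open>force+\<close>)
  then show ?thesis by (simp add: sum.cartesian_product[symmetric])
qed

lemma chi_commutator_V_n:
  assumes "depends_only_on (chi v) ({- K..K} \<times> {0})"
  shows "chi (commutator (V_n e) v) n m a b u =
    (\<Sum>i\<in>{- K..K}. of_int (n + i) * R0_n e (n + i) m a b u * partial_u i 0 (chi v) n m a b u)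
    - r_fun e a * partial_\<alpha> (chi v) n m a b u
    - (\<Sum>i\<in>{-1..1}. chi v (n + i) m a b u * partial_u i 0 (chi (V_n e)) n m a b u)"
proof -
  have V: "depends_only_on (chi (V_n e)) ({-1..1} \<times> {0})"
    by (rule chain_depends[OF chain_V_n])
  have "Sum_any (\<lambda>(i, j). shift i j (chi (V_n e)) n m a b u * partial_u i j (chi v) n m a b u) =
      (\<Sum>i\<in>{- K..K}. shift i 0 (chi (V_n e)) n m a b u * partial_u i 0 (chi v) n m a b u)"
    by (rule Sum_any_row) (use partial_u_zero[OF assms] in auto)
  moreover have "Sum_any (\<lambda>(i, j). shift i j (chi v) n m a b u * partial_u i j (chi (V_n e)) n m a b u) =
      (\<Sum>i\<in>{-1..1}. shift i 0 (chi v) n m a b u * partial_u i 0 (chi (V_n e)) n m a b u)"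
    by (rule Sum_any_row) (use partial_u_zero[OF V] in auto)
  ultimately show ?thesis
    by (simp add: commutator_def shift_def V_n_def)
qed

text \<open>Either \<open>R0_n\<close> is displaced by up to \<open>K\<close> sites or
  \<open>v\<close> by one; both reach \<open>K + 1\<close>.\<close>

lemma chain_commutator_V_n:
  assumes "chain K (chi v)" "K \<ge> 0"
  shows "chain (K + 1) (chi (commutator (V_n e) v))"
proof -
  have d: "depends_only_on (chi v) ({- K..K} \<times> {0})" using assms by (simp add: chain_def)
  note V = chain_V_n[of e]
  show ?thesis unfolding chain_def depends_only_on_def
  proof (intro conjI allI impI)
    fix n m a b and u w :: field_values
    assume uw: "\<forall>(i, j)\<in>{- (K + 1)..K + 1} \<times> {0}. u (n + i, m + j) = w (n + i, m + j)"
    have uw': "u (n + i, m) = w (n + i, m)" if "i \<in> {- (K + 1)..K + 1}" for i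
      using uw that by auto
    have dep: "R (n + i) m a b u = R (n + i) m a b w" if "chain L R" "i \<in> {- M..M}" "L + M \<le> K + 1" for R i L M
    proof (rule depends_only_onD[of R "{- L..L} \<times> {0}"])
      fix i' j' assume "(i', j') \<in> {- L..L} \<times> {0 :: int}"
      then show "u (n + i + i', m + j') = w (n + i + i', m + j')"
        using uw'[of "i + i'"] that by (auto simp: add.assoc)
    qed (use that in \<open>simp add: chain_def\<close>)
    have dep0: "R n m a b u = R n m a b w" if "chain L R" "L \<le> K + 1" for R L
      using dep[OF that(1), of 0 0] that(2) by simp
    have "(\<Sum>i\<in>{- K..K}. of_int (n + i) * R0_n e (n + i) m a b u * partial_u i 0 (chi v) n m a b u) =
        (\<Sum>i\<in>{- K..K}. of_int (n + i) * R0_n e (n + i) m a b w * partial_u i 0 (chi v) n m a b w)"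
      by (intro sum.cong refl arg_cong2[of _ _ _ _ "(*)"] dep[OF chain_R0, of _ K] dep0[OF chain_partial_u[OF assms(1)]]) auto
    moreover have "partial_\<alpha> (chi v) n m a b u = partial_\<alpha> (chi v) n m a b w"
      by (rule dep0[OF chain_partial_\<alpha>[OF assms(1)]]) simp
    moreover have "(\<Sum>i\<in>{-1..1}. chi v (n + i) m a b u * partial_u i 0 (chi (V_n e)) n m a b u) =
        (\<Sum>i\<in>{-1..1}. chi v (n + i) m a b w * partial_u i 0 (chi (V_n e)) n m a b w)"
      by (intro sum.cong refl arg_cong2[of _ _ _ _ "(*)"] dep[OF assms(1), of _ 1] dep0[OF chain_partial_u[OF V]])
         (use assms(2) in auto)
    ultimately show "chi (commutator (V_n e) v) n m a b u = chi (commutator (V_n e) v) n m a b w"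
      unfolding chi_commutator_V_n[OF d] by simp
  next
    fix n m a b b' and u :: field_values
    have bb: "R n m a b u = R n m a b' u" if "chain L R" for R L n
      by (rule chain_beta[OF that])
    show "chi (commutator (V_n e) v) n m a b u = chi (commutator (V_n e) v) n m a b' u"
      unfolding chi_commutator_V_n[OF d]
      by (intro arg_cong2[of _ _ _ _ "(-)"] sum.cong refl arg_cong2[of _ _ _ _ "(*)"]
          bb[OF chain_R0] bb[OF assms(1)] bb[OF chain_partial_u[OF assms(1)]]
          bb[OF chain_partial_\<alpha>[OF assms(1)]] bb[OF chain_partial_u[OF V]])
  qed
qed

lemma lift_commutator_V_n:
  assumes "chain K (chi v)"
  shows "lift (chi (commutator (V_n e) v)) n m y =
    act (master_vec e y) (lift (chi v) n m) y
    - act (field_vec (lift (chi v)) (\<lambda>_. 0) y) (\<lambda>y. of_int n * r0 e n m y) y"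
proof -
  note V = chain_V_n[of e]
  have [simp]: "lift (chi (V_n e)) n m = (\<lambda>y. of_int n * r0 e n m y)"
    by (simp add: lift_def V_n_def fun_eq_iff)
  have d: "depends_only_on (chi v) ({- K..K} \<times> {0})" using assms by (simp add: chain_def)
  have 1: "act (master_vec e y) (lift (chi v) n m) y =
     (\<Sum>i\<in>{- K..K}. of_int (n + i) * r0 e (n + i) m y * lift (partial_u i 0 (chi v)) n m y)
     - r_fun e (y PA) * lift (partial_\<alpha> (chi v)) n m y"
    unfolding act_lift[OF assms] by (simp add: lift_partial_u lift_partial_\<alpha> master_vec_def)
  have 2: "act (field_vec (lift (chi v)) (\<lambda>_. 0) y) (\<lambda>y. of_int n * r0 e n m y) y =
     (\<Sum>i\<in>{-1..1}. lift (chi v) (n + i) m y * lift (partial_u i 0 (chi (V_n e))) n m y)"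
    using act_lift[OF V, of _ n m y] by (simp add: lift_partial_u)
  show ?thesis unfolding 1 2 unfolding lift_def chi_commutator_V_n[OF d] ..
qed

lemma act_scale:
  assumes "rational_on e g" "y \<in> regular e"
  shows "act X (\<lambda>y. a * g y) y = a * act X g y"
proof -
  obtain S where S: "finite S" "\<And>v y. y \<in> regular e \<Longrightarrow> v \<notin> S \<Longrightarrow> pd v g y = 0"
    using rat_finite_supp[OF assms(1)] by blast
  have *: "pd v (\<lambda>y. a * g y) y = a * pd v g y" for v
    using pd_mult[OF rat_const assms(1,2), of v a] by simp
  have "act X (\<lambda>y. a * g y) y = (\<Sum>v\<in>S. X v * pd v (\<lambda>y. a * g y) y)"
    by (rule act_eq) (use S assms * in auto)
  moreover have "act X g y = (\<Sum>v\<in>S. X v * pd v g y)"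
    by (rule act_eq) (use S assms in auto)
  ultimately show ?thesis by (simp add: * sum_distrib_left mult_ac)
qed

lemma rat_r_fun: "rational_on e (\<lambda>y. - r_fun e (y PA))"
  by (cases e) (simp_all add: rat_const rat_divide[OF rat_var rat_const])

lemma rat_commutator_V_n:
  assumes v: "chain K (chi v)" and r: "\<And>n m. rational_on e (lift (chi v) n m)"
  shows "rational_on e (lift (chi (commutator (V_n e) v)) n m)"
proof -
  have "rational_on e (\<lambda>y. ((\<Sum>i\<in>{- K..K}. (of_int (n + i) * r0 e (n + i) m y) * pd (U (n + i, m)) (lift (chi v) n m) y)
     + - r_fun e (y PA) * pd PA (lift (chi v) n m) y)
     - of_int n * (\<Sum>i\<in>{-1..1}. lift (chi v) (n + i) m y * pd (U (n + i, m)) (r0 e n m) y))"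
    by (intro rat_diff rat_add rat_mult rat_sum rat_r_fun rat_r0 rat_pd r rat_const) auto
  then show ?thesis
    by (rule rat_cong)
       (simp add: lift_commutator_V_n[OF v] act_scale[OF rat_r0] act_lift[OF v] act_lift[OF chain_R0] master_vec_def)
qed

text \<open>The condition is imposed for solutions on a finite window, not only for solutions on the
  whole lattice: \<open>tangent_curve\<close> controls the squares of a window and nothing
  else.\<close>

definition symmetric_n :: "quad_eq \<Rightarrow> int \<Rightarrow> lattice_fun \<Rightarrow> bool" where
  "symmetric_n e K R \<longleftrightarrow> (\<forall>n m y. row_solution e m (n - K) (n + K) y \<longrightarrow>
     act (field_vec (lift R) (\<lambda>_. 0) y) (Q e n m) y = 0)"

text \<open>Tangency of \<open>v\<close> is needed on the squares n - 1 to n + 1, that of the master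
  field on n - K to n + K; both read up to \<open>K + 1\<close> squares away from n, which is the
  new window.\<close>

lemma symmetric_commutator_V_n:
  assumes e: "valid_sign e" and v: "chain K (chi v)" "K \<ge> 0" and r: "\<And>n m. rational_on e (lift (chi v) n m)"
    and s: "symmetric_n e K (chi v)"
  shows "symmetric_n e (K + 1) (chi (commutator (V_n e) v))"
  unfolding symmetric_n_def
proof (intro allI impI)
  fix n m y assume y: "row_solution e m (n - (K + 1)) (n + (K + 1)) y"
  let ?V = "master_vec e" and ?W = "field_vec (lift (chi v)) (\<lambda>_. 0)"
  have "act (\<lambda>w. act (?V y) (\<lambda>y. ?W y w) y - act (?W y) (\<lambda>y. ?V y w) y) (Q e n m) y = 0"
  proof (rule bracket_symmetry[OF e])
    show "row_solution e m (n - 1) (n + 1) y" "row_solution e m (n - K) (n + K) y"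
      using row_solution_mono[OF y] v(2) by auto
    show "rational_on e (\<lambda>y. ?V y w)" for w
      by (cases w) (auto simp: master_vec_def field_vec_def intro!: rat_const rat_mult rat_r0 rat_r_fun)
    show "rational_on e (\<lambda>y. ?W y w)" for w
      by (cases w) (auto simp: field_vec_def intro!: rat_const r)
    show "act (?V y) (Q e n m) y = 0" if "row_solution e m (n - 1) (n + 1) y" for y
      by (rule master_vec_symmetry[OF e that])
    show "act (?W y) (Q e n m) y = 0" if "row_solution e m (n - K) (n + K) y" for y
      using s that by (auto simp: symmetric_n_def)
    show "act (?W y) (Q e i m) y = 0" if "i \<in> {n - 1..n + 1}" for i
      using s row_solution_mono[OF y, of "i - K" "i + K"] that by (auto simp: symmetric_n_def)
    show "act (?V y) (Q e i m) y = 0" if "i \<in> {n - K..n + K}" for i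
      by (rule master_vec_symmetry[OF e]) (use row_solution_mono[OF y, of "i - 1" "i + 1"] that in auto)
  qed
  moreover have "act (?V y) (\<lambda>y. ?W y w) y - act (?W y) (\<lambda>y. ?V y w) y =
      field_vec (lift (chi (commutator (V_n e) v))) (\<lambda>_. 0) y w" for w
  proof (cases w)
    \<comment> \<open>The bracket has no \<alpha> component: \<alpha> is at rest under
      \<open>v\<close>, and \<open>r_fun\<close> depends on \<alpha> alone.\<close>
    case PA
    have "pd w (\<lambda>y. - r_fun e (y PA)) y = 0" if "w \<noteq> PA" for w
      by (rule pd_indep) (use that in auto)
    then have "act (?W y) (\<lambda>y. - r_fun e (y PA)) y = (\<Sum>w\<in>{PA}. ?W y w * pd w (\<lambda>y. - r_fun e (y PA)) y)"
      by (intro act_eq) auto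
    then show ?thesis by (simp add: PA act_def master_vec_def)
  next
    case PB
    then show ?thesis by (simp add: act_def master_vec_def)
  next
    case (U p)
    then show ?thesis
      by (cases p) (simp add: lift_commutator_V_n[OF v(1)], simp add: master_vec_def)
  qed
  ultimately show "act (field_vec (lift (chi (commutator (V_n e) v))) (\<lambda>_. 0) y) (Q e n m) y = 0"
    by simp
qed

section \<open>Commutation with the first symmetry\<close>

fun rho :: "quad_eq \<Rightarrow> complex \<Rightarrow> complex" where
  "rho (H1 \<epsilon> \<sigma>) a = 1"
| "rho (H2 \<epsilon> \<sigma>) a = 1"
| "rho (H3 \<epsilon> \<delta> \<sigma>) a = a"

text \<open>At equal parameters all weighted terms disappear and a product remains; the factor
  \<open>x2 - x3\<close> vanishes when the upper row is the lower one shifted by one site.\<close>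

lemma E_diag: "E_poly e x1 x2 x3 x4 n m a a = rho e a * ((x1 - x4) * (x2 - x3))"
  by (cases e) (auto simp: algebra_simps)

lemma D3_diag: "D3 e n m x1 x2 x4 a a = rho e a * (x4 - x1)"
  by (simp add: D3_def E_diag algebra_simps)

lemma D4_diag: "D4 e n m x1 x2 x3 a a = rho e a * (x3 - x2)"
  by (simp add: D4_def E_diag algebra_simps)

lemma rho_ne: "admissible e a b \<Longrightarrow> rho e a \<noteq> 0"
  by (cases e) auto

lemma r_fun_ne: "admissible e a b \<Longrightarrow> r_fun e a \<noteq> 0"
  by (cases e) auto

text \<open>The link between \<open>f\<close> and the equation: on the solution formed by a row and
  its shift, the \<beta>-derivative is the polarised \<open>f\<close> at three consecutive values,
  with the middle one at n + 1. This makes the first-order motion of the upper row a multiple of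
  \<open>R0_n\<close>.\<close>

lemma Db_diag:
  assumes e: "valid_sign e" and ad: "admissible e a b"
  shows "r_fun e a * Db e n m x1 x2 x2 x4 a a = rho e a * f_polar e (n + 1) m x2 x4 x1 a"
proof (cases e)
  case (H1 \<epsilon> \<sigma>)
  show ?thesis unfolding H1 Db.simps f_polar.simps weight_shift
    by (simp add: algebra_simps power2_eq_square)
next
  case (H2 \<epsilon> \<sigma>)
  then have "\<sigma> \<in> {1, - 1}" using e by simp
  then show ?thesis unfolding H2 Db.simps f_polar.simps weight_shift
    by (rule weight_cases[of \<sigma> n m]) (simp_all, simp_all add: algebra_simps power2_eq_square)
next
  case (H3 \<epsilon> \<delta> \<sigma>)
  then have a: "a \<noteq> 0" using ad by simp
  have k: "\<epsilon> * (1 / a + a / a^2) = 2 * (\<epsilon> / a)" using a by (simp add: field_simps power2_eq_square)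
  show ?thesis unfolding H3 Db.simps f_polar.simps weight_shift r_fun.simps rho.simps k
    using a by (simp add: field_simps power2_eq_square)
qed

text \<open>Since the weights depend on \<open>n + m\<close> only, the characteristics are invariant under
  \<open>(n, m) \<mapsto> (n + 1, m - 1)\<close>. For the commutators this is not apparent from the definition, because
  the master symmetry contains \<open>n\<close> explicitly.\<close>

definition covariant :: "quad_eq \<Rightarrow> lattice_fun \<Rightarrow> bool" where
  "covariant e R \<longleftrightarrow> (\<forall>n m y y'. y \<in> regular e \<longrightarrow> y' \<in> regular e \<longrightarrow> y PA = y' PA \<longrightarrow>
     (\<forall>i. y (U (n + 1 + i, m)) = y' (U (n + i, m + 1))) \<longrightarrow> lift R (n + 1) m y = lift R n (m + 1) y')"

lemma covariantD:
  assumes "covariant e R" "y \<in> regular e" "y' \<in> regular e" "y PA = y' PA"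
    "\<And>i. y (U (i + 1, m)) = y' (U (i, m + 1))"
  shows "lift R (n + 1) m y = lift R n (m + 1) y'"
  using assms(1)[unfolded covariant_def, rule_format, OF assms(2-4), of n m] assms(5)[of "n + _"]
  by (simp add: add_ac)

lemma covariant_R0: "covariant e (R0_n e)"
  unfolding covariant_def
proof (intro allI impI)
  fix n m y y'
  assume y: "y \<in> regular e" "y' \<in> regular e" and a: "y PA = y' PA"
    and c: "\<forall>i. y (U (n + 1 + i, m)) = y' (U (n + i, m + 1))"
  show "r0 e (n + 1) m y = r0 e n (m + 1) y'"
    unfolding r0_eq[OF y(1)] r0_eq[OF y(2)] f_polar_shift
    using c[rule_format, of 0] c[rule_format, of 1] c[rule_format, of "- 1"] a by simp
qed

lemma covariant_pd:
  assumes R: "covariant e R" and rational_on: "\<And>n m. rational_on e (lift R n m)"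
    and y: "y \<in> regular e" "y' \<in> regular e" and a: "y PA = y' PA"
    and c: "\<And>i. y (U (i + 1, m)) = y' (U (i, m + 1))"
  shows "pd (U (j + 1, m)) (lift R (n + 1) m) y = pd (U (j, m + 1)) (lift R n (m + 1)) y'"
    and "pd PA (lift R (n + 1) m) y = pd PA (lift R n (m + 1)) y'"
proof -
  have *: "pd v (lift R (n + 1) m) y = pd v' (lift R n (m + 1)) y'"
    if v: "v = U (j + 1, m) \<and> v' = U (j, m + 1) \<or> v = PA \<and> v' = PA" for v v'
  proof (rule pd_eqI, rule has_field_derivative_eventually_cong[OF pd_has_derivative[OF rational_on y(2)]])
    have "\<forall>\<^sub>F z in nhds 0. y(v := y v + z) \<in> regular e" "\<forall>\<^sub>F z in nhds 0. y'(v' := y' v' + z) \<in> regular e"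
      using pd_coord_curve[OF y(1)] pd_coord_curve[OF y(2)] by (simp_all add: curve_def)
    then show "\<forall>\<^sub>F z in nhds 0. lift R (n + 1) m (y(v := y v + z)) = lift R n (m + 1) (y'(v' := y' v' + z))"
      by eventually_elim (rule covariantD[OF R], use v a c in auto)
  qed
  show "pd (U (j + 1, m)) (lift R (n + 1) m) y = pd (U (j, m + 1)) (lift R n (m + 1)) y'"
    and "pd PA (lift R (n + 1) m) y = pd PA (lift R n (m + 1)) y'"
    by (rule *; simp)+
qed

lemma r0_next:
  "y \<in> regular e \<Longrightarrow> r0 e (n + 1) m y = f_polar e (n + 1) m (y (U (n + 1, m))) (y (U (n + 2, m))) (y (U (n, m))) (y PA)
    / (y (U (n + 2, m)) - y (U (n, m)))"
  using r0_eq[of y e "n + 1" m] by (simp add: add.commute)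

lemma sum_qvars:
  "(\<Sum>v\<in>qvars n m. g v) = (\<Sum>p\<in>corners n m. g (U p)) + g PA + (g PB :: complex)"
  unfolding qvars_def by (subst sum.insert, simp, force)+ (simp add: sum.reindex inj_on_def add_ac)

text \<open>At \<open>\<beta> = \<alpha>\<close> the equation has the solution \<open>u\<^sub>n\<^sub>,\<^sub>m\<^sub>+\<^sub>1 = u\<^sub>n\<^sub>+\<^sub>1\<^sub>,\<^sub>m\<close>, and varying \<open>\<beta>\<close> away
  from \<open>\<alpha>\<close> moves the upper row with velocity \<open>- R0 / r\<close>. Differentiating the symmetry condition
  for \<open>R\<close> along this family yields \<open>[v\<^sub>0, R] = 0\<close>.\<close>

lemma commutes_diag:
  assumes e: "valid_sign e" and R: "chain K R" "covariant e R" "\<And>n m. rational_on e (lift R n m)"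
    "symmetric_n e K R"
    and p: "p \<in> regular e" "p PB = p PA" "\<And>i. p (U (i, m + 1)) = p (U (i + 1, m))"
  shows "act (field_vec (r0 e) (\<lambda>_. 0) p) (lift R (n + 1) m) p = act (field_vec (lift R) (\<lambda>_. 0) p) (r0 e (n + 1) m) p"
proof -
  let ?a = "p PA" and ?Q = "Q e n m"
  let ?W = "field_vec (lift R) (\<lambda>_. 0)"
  have ad: "admissible e ?a ?a" using p by (auto simp: regular_def)
  note r = r_fun_ne[OF ad] and rho = rho_ne[OF ad]
  define X where "X v = (case v of PA \<Rightarrow> 0 | PB \<Rightarrow> 1 | U q \<Rightarrow>
    if snd q = m + 1 then - r0 e (fst q + 1) m p / r_fun e ?a else 0)" for v
  have X[simp]: "X PA = 0" "X PB = 1" "X (U (i, m)) = 0"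
    "X (U (i, m + 1)) = - r0 e (i + 1) m p / r_fun e ?a" for i
    by (simp_all add: X_def)
  have ne: "p (U (i + 2, m)) - p (U (i, m)) \<noteq> 0" for i
    using regular_ne[OF p(1), of "i + 1" m] by (simp add: add.commute)
  have X3: "X (U (i, m + 1)) * (rho e ?a * (p (U (i + 2, m)) - p (U (i, m))))
      = - (rho e ?a * f_polar e (i + 1) m (p (U (i + 1, m))) (p (U (i + 2, m))) (p (U (i, m))) ?a / r_fun e ?a)" for i
    using ne[of i] r by (simp add: r0_next[OF p(1)])
  have Db: "Db e i m x1 x2 x2 x4 ?a ?a = rho e ?a * f_polar e (i + 1) m x2 x4 x1 ?a / r_fun e ?a" for i x1 x2 x4
    using Db_diag[OF e ad, of i m x1 x2 x4] r by (simp add: field_simps)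
  have p3': "p (U (i + 1, m + 1)) = p (U (i + 2, m))" for i
    using p(3)[of "i + 1"] by (simp add: add.commute)
  have Q0: "Q e i m p = 0" for i
    by (simp add: Q_def p E_diag)
  have pd3: "pd (U (i, m + 1)) (Q e i m) p = rho e ?a * (p (U (i + 2, m)) - p (U (i, m)))" for i
    by (simp add: pd_Q_corner[OF e] p(2) p(3)[of i] p3'[of i] D3_diag)
  have pd4: "pd (U (i + 1, m + 1)) (Q e i m) p = 0" for i
    by (simp add: pd_Q_corner[OF e] p(2) p(3)[of i] p3'[of i] D4_diag)
  have pdB: "pd PB (Q e i m) p = rho e ?a * f_polar e (i + 1) m (p (U (i + 1, m))) (p (U (i + 2, m))) (p (U (i, m))) ?a / r_fun e ?a" for i
    using Db[of i] by (simp add: pd_Q_PB[OF p(1)] p(2) p(3)[of i] p3'[of i])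
  have row_solution: "row_solution e m L H p" for L H
    using p(1) Q0 rho ne by (auto simp: row_solution_def pd3)
  \<comment> \<open>Only \<open>x3\<close> and \<beta> contribute: the lower row is at rest, and the
    derivative by \<open>x4\<close> vanishes here.\<close>
  have tangent: "act X (Q e i m) p = 0" for i
    unfolding act_Q sum_corners pd3 pd4 pdB X3 by simp
  have "(\<Sum>v\<in>qvars n m. act X (\<lambda>y. ?W y v) p * pd v ?Q p + act X (pd v ?Q) p * ?W p v) = 0"
  proof (rule tangent_derivative[OF e row_solution tangent])
    show "rational_on e (\<lambda>y. ?W y v)" for v
      by (cases v) (auto simp: field_vec_def intro!: rat_const R(3))
    show "act (?W y) ?Q y = 0" if "row_solution e m (n - K) (n + K) y" for y
      using R(4) that by (auto simp: symmetric_n_def)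
  qed
  then have sum0: "(\<Sum>v\<in>qvars n m. act X (\<lambda>y. ?W y v) p * pd v ?Q p) + (\<Sum>v\<in>qvars n m. act X (pd v ?Q) p * ?W p v) = 0"
    by (simp add: sum.distrib)
  let ?A = "act (field_vec (r0 e) (\<lambda>_. 0) p) (lift R (n + 1) m) p"
  let ?B = "act (?W p) (r0 e (n + 1) m) p"
  let ?d = "p (U (n + 2, m)) - p (U (n, m))"
  \<comment> \<open>By covariance \<open>R\<close> and its derivatives at (n, m + 1) are those at (n
    + 1, m), so the moving upper row differentiates \<open>R\<close> along the first
    symmetry.\<close>
  have upper: "act X (lift R n (m + 1)) p = - ?A / r_fun e ?a"
  proof -
    have "pd (U (n + i, m + 1)) (lift R n (m + 1)) p = pd (U (n + 1 + i, m)) (lift R (n + 1) m) p" for i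
      using covariant_pd(1)[OF R(2,3) p(1) p(1) refl, of m "n + i" n] p(3) by (simp add: add_ac)
    moreover have Xi: "X (U (n + i, m + 1)) = - r0 e (n + 1 + i) m p / r_fun e ?a" for i
    proof -
      have "n + i + 1 = n + 1 + i" by simp
      then show ?thesis using X(4)[of "n + i"] by (simp only:)
    qed
    ultimately have "act X (lift R n (m + 1)) p =
      (\<Sum>i\<in>{- K..K}. - r0 e (n + 1 + i) m p / r_fun e ?a * pd (U (n + 1 + i, m)) (lift R (n + 1) m) p)"
      unfolding act_lift[OF R(1)] by (simp add: Xi del: X(4))
    also have "\<dots> = - ?A / r_fun e ?a"
      unfolding act_lift[OF R(1)] by (simp add: sum_negf[symmetric] sum_divide_distrib)
    finally show ?thesis .
  qed
  have lower: "act X (lift R i m) p = 0" for i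
    unfolding act_lift[OF R(1)] by simp
  have zero: "act X (\<lambda>_. 0) p = 0" by (simp add: act_def)
  have 1: "(\<Sum>v\<in>qvars n m. act X (\<lambda>y. ?W y v) p * pd v ?Q p) = - ?A / r_fun e ?a * (rho e ?a * ?d)"
    unfolding sum_qvars sum_corners by (simp add: upper lower zero pd3 pd4)
  \<comment> \<open>By symmetry of the Hessian the remaining sum can be computed by moving along
    \<open>R\<close> instead. The line moves only the sites read by the square and by
    \<open>R0_n\<close> at (n + 1, m); it keeps the upper values equal to the shifted lower ones, so
    the formulas for \<beta> = \<alpha> hold all along it.\<close>
  define T where "T = {U (n, m), U (n + 1, m), U (n + 2, m), U (n, m + 1), U (n + 1, m + 1)}"
  define Z where "Z v = (if v \<in> T then ?W p v else 0)" for v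
  define c where "c = (\<lambda>z v. if v \<in> T then p v + z * ?W p v else p v)"
  have c: "curve e p Z c" unfolding Z_def c_def
    by (rule straight_curve[OF p(1)]) (simp add: T_def)
  have shift: "lift R n (m + 1) p = lift R (n + 1) m p" "lift R (n + 1) (m + 1) p = lift R (n + 2) m p"
    using covariantD[OF R(2) p(1) p(1) refl, of m n] covariantD[OF R(2) p(1) p(1) refl, of m "n + 1"] p(3)
    by (simp_all add: add.commute)
  have c_eq: "c z (U (n, m + 1)) = c z (U (n + 1, m))" "c z (U (n + 1, m + 1)) = c z (U (n + 2, m))"
    "c z PA = ?a" "c z PB = ?a" for z
    using shift p(2) p(3)[of n] p3'[of n] by (simp_all add: c_def T_def)
  have c0: "c 0 = p" by (auto simp: c_def)
  have "(\<Sum>v\<in>qvars n m. act X (pd v ?Q) p * ?W p v) = (\<Sum>v\<in>qvars n m. act X (pd v ?Q) p * Z v)"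
    by (intro sum.cong refl) (auto simp: qvars_def corners_def Z_def T_def)
  also have "\<dots> = (\<Sum>v\<in>qvars n m. act Z (pd v ?Q) p * X v)"
    by (rule act_pd_Q_swap[OF p(1)])
  also have "\<dots> = rho e ?a * ?d / r_fun e ?a * ?B"
  proof (rule DERIV_unique)
    show "((\<lambda>z. \<Sum>v\<in>qvars n m. pd v ?Q (c z) * X v) has_field_derivative (\<Sum>v\<in>qvars n m. act Z (pd v ?Q) p * X v)) (at 0)"
      by (intro DERIV_sum DERIV_cmult_right rat_chain[OF _ c] rat_pd rat_Q)
    \<comment> \<open>\<open>X\<close> stays frozen at \<open>p\<close> while the derivatives of the
      equation move, so the tangency sum is the derivative by \<open>x3\<close>, divided by r, times
      the increment of \<open>R0_n\<close>. At 0 the increment vanishes and only its own derivative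
      survives.\<close>
    let ?\<psi> = "\<lambda>z. (rho e ?a * (c z (U (n + 2, m)) - c z (U (n, m))) / r_fun e ?a) * (r0 e (n + 1) m (c z) - r0 e (n + 1) m p)"
    have dc: "((\<lambda>z. c z v) has_field_derivative Z v) (at 0)" for v
      using c by (simp add: curve_def)
    have "act Z (r0 e (n + 1) m) p = ?B"
    proof (rule act_cong)
      fix v assume "pd v (r0 e (n + 1) m) p \<noteq> 0"
      then have "v = PA \<or> (\<exists>i\<in>{-1..1}. v = U (n + 1 + i, m))"
        using pd_lift_zero[OF chain_R0] by blast
      then have "v \<in> {PA, U (n, m), U (n + 1, m), U (n + 2, m)}"
      proof (elim disjE bexE)
        fix i :: int assume i: "i \<in> {-1..1}" "v = U (n + 1 + i, m)"
        then have "i = -1 \<or> i = 0 \<or> i = 1" by auto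
        then show ?thesis using i by auto
      qed simp
      then show "Z v = ?W p v" by (auto simp: Z_def T_def)
    qed
    then have dr: "((\<lambda>z. r0 e (n + 1) m (c z)) has_field_derivative ?B) (at 0)"
      using rat_chain[OF rat_r0 c] by metis
    have "(?\<psi> has_field_derivative
        (rho e ?a * (Z (U (n + 2, m)) - Z (U (n, m))) / r_fun e ?a) * (r0 e (n + 1) m (c 0) - r0 e (n + 1) m p)
        + (?B - 0) * (rho e ?a * (c 0 (U (n + 2, m)) - c 0 (U (n, m))) / r_fun e ?a)) (at 0)"
      by (intro DERIV_mult DERIV_cdivide DERIV_cmult DERIV_diff dc dr DERIV_const)
    then have d\<psi>: "(?\<psi> has_field_derivative rho e ?a * ?d / r_fun e ?a * ?B) (at 0)"
      by (simp add: c0 mult.commute)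
    show "((\<lambda>z. \<Sum>v\<in>qvars n m. pd v ?Q (c z) * X v) has_field_derivative rho e ?a * ?d / r_fun e ?a * ?B) (at 0)"
    proof (rule has_field_derivative_eventually_cong[OF d\<psi>])
      have "\<forall>\<^sub>F z in nhds 0. c z \<in> regular e" using c by (simp add: curve_def)
      then show "\<forall>\<^sub>F z in nhds 0. (\<Sum>v\<in>qvars n m. pd v ?Q (c z) * X v) = ?\<psi> z"
      proof eventually_elim
        case (elim z)
        have nz: "c z (U (n + 2, m)) - c z (U (n, m)) \<noteq> 0"
          using regular_ne[OF elim, of "n + 1" m] by (simp add: add.commute)
        have "pd (U (n, m + 1)) ?Q (c z) = rho e ?a * (c z (U (n + 2, m)) - c z (U (n, m)))"
          "pd (U (n + 1, m + 1)) ?Q (c z) = 0"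
          by (simp_all add: pd_Q_corner[OF e] c_eq D3_diag D4_diag)
        moreover have "pd PB ?Q (c z) = rho e ?a * f_polar e (n + 1) m (c z (U (n + 1, m))) (c z (U (n + 2, m))) (c z (U (n, m))) ?a / r_fun e ?a"
          by (simp add: pd_Q_PB[OF elim] c_eq Db)
        moreover have "f_polar e (n + 1) m (c z (U (n + 1, m))) (c z (U (n + 2, m))) (c z (U (n, m))) ?a =
            r0 e (n + 1) m (c z) * (c z (U (n + 2, m)) - c z (U (n, m)))"
          using nz by (simp add: r0_next[OF elim] c_eq)
        ultimately show ?case unfolding sum_qvars sum_corners
          by simp (simp add: algebra_simps diff_divide_distrib add_divide_distrib)
      qed
    qed
  qed
  finally have 2: "(\<Sum>v\<in>qvars n m. act X (pd v ?Q) p * ?W p v) = rho e ?a * ?d / r_fun e ?a * ?B" .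
  have fin: "s = t" if "- s / q * (x * d) + x * d / q * t = 0" "q \<noteq> 0" "x \<noteq> 0" "d \<noteq> 0" for s t q x d :: complex
    using that by (simp add: field_simps)
  show ?thesis by (rule fin[OF sum0[unfolded 1 2] r rho ne])
qed

lemma commutes:
  assumes e: "valid_sign e" and R: "chain K R" "covariant e R" "\<And>n m. rational_on e (lift R n m)"
    "symmetric_n e K R" and y: "y \<in> regular e"
  shows "act (field_vec (r0 e) (\<lambda>_. 0) y) (lift R n m) y = act (field_vec (lift R) (\<lambda>_. 0) y) (r0 e n m) y"
proof -
  \<comment> \<open>Row \<open>m\<close> is copied to all other rows along the diagonals and \<beta>
    is set to \<alpha>; nonsingularity in both directions is inherited from row \<open>m\<close>.
    Both sides of the claim read row \<open>m\<close> and \<alpha> only, so they agree at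
    \<open>p\<close> and at \<open>y\<close>.\<close>
  define p where "p v = (case v of PA \<Rightarrow> y PA | PB \<Rightarrow> y PA | U q \<Rightarrow> y (U (fst q + snd q - m, m)))" for v
  have p: "p PA = y PA" "p PB = p PA" "p (U (i, m)) = y (U (i, m))" "p (U (i, m + 1)) = p (U (i + 1, m))" for i
    by (simp_all add: p_def algebra_simps)
  have ne: "y (U (i + 1, m)) \<noteq> y (U (i - 1, m))" for i by (rule regular_ne[OF y])
  have "p (U (i + 1, j)) \<noteq> p (U (i - 1, j))" "p (U (i, j + 1)) \<noteq> p (U (i, j - 1))" for i j
    using ne[of "i + j - m"] by (simp_all add: p_def algebra_simps)
  moreover have "admissible e (p PA) (p PB)"
    using y p(1,2) by (cases e) (auto simp: regular_def)
  ultimately have pr: "p \<in> regular e" by (simp add: regular_def nonsingular_def)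
  have cong: "lift S i m p = lift S i m y" if "chain L S" for S L i
    by (rule lift_cong[OF that]) (simp_all add: p)
  have cong_pd: "pd (U (i + j, m)) (lift S i m) p = pd (U (i + j, m)) (lift S i m) y" if "chain L S" for S L i j
    using cong[OF chain_partial_u[OF that, of j 0]] by (simp add: lift_partial_u)
  have "act (field_vec (r0 e) (\<lambda>_. 0) y) (lift R n m) y = act (field_vec (r0 e) (\<lambda>_. 0) p) (lift R n m) p"
    unfolding act_lift[OF R(1)] by (simp add: cong[OF chain_R0] cong_pd[OF R(1)])
  also have "\<dots> = act (field_vec (lift R) (\<lambda>_. 0) p) (r0 e n m) p"
    using commutes_diag[OF e R pr p(2,4), of "n - 1"] by simp
  also have "\<dots> = act (field_vec (lift R) (\<lambda>_. 0) y) (r0 e n m) y"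
    unfolding act_lift[OF chain_R0] by (simp add: cong[OF R(1)] cong_pd[OF chain_R0])
  finally show ?thesis .
qed

lemma commutator_recursion:
  assumes e: "valid_sign e" and R: "chain K (chi v)" "covariant e (chi v)" "\<And>n m. rational_on e (lift (chi v) n m)"
    "symmetric_n e K (chi v)" and y: "y \<in> regular e"
  shows "lift (chi (commutator (V_n e) v)) n m y =
    (\<Sum>i\<in>{- K..K}. of_int i * r0 e (n + i) m y * pd (U (n + i, m)) (lift (chi v) n m) y)
    - r_fun e (y PA) * pd PA (lift (chi v) n m) y"
proof -
  have "lift (chi (commutator (V_n e) v)) n m y = act (master_vec e y) (lift (chi v) n m) y
      - of_int n * act (field_vec (r0 e) (\<lambda>_. 0) y) (lift (chi v) n m) y"
    unfolding lift_commutator_V_n[OF R(1)] act_scale[OF rat_r0 y] commutes[OF e R y] ..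
  then show ?thesis unfolding act_lift[OF R(1)]
    by (simp add: master_vec_def distrib_right sum.distrib sum_distrib_left mult.assoc)
qed

text \<open>Read off from the recursion formula, where the coefficients are relative positions
  \<open>i\<close> and no explicit n is left.\<close>

lemma covariant_commutator_V_n:
  assumes e: "valid_sign e" and R: "chain K (chi v)" "covariant e (chi v)" "\<And>n m. rational_on e (lift (chi v) n m)"
    "symmetric_n e K (chi v)"
  shows "covariant e (chi (commutator (V_n e) v))"
  unfolding covariant_def
proof (intro allI impI)
  fix n m y y'
  assume y: "y \<in> regular e" "y' \<in> regular e" and a: "y PA = y' PA"
    and c: "\<forall>i. y (U (n + 1 + i, m)) = y' (U (n + i, m + 1))"
  have c': "y (U (i + 1, m)) = y' (U (i, m + 1))" for i
    using c[rule_format, of "i - n"] by (simp add: algebra_simps)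
  have eq: "n + 1 + i = n + i + 1" for i by simp
  show "lift (chi (commutator (V_n e) v)) (n + 1) m y = lift (chi (commutator (V_n e) v)) n (m + 1) y'"
    unfolding commutator_recursion[OF e R y(1)] commutator_recursion[OF e R y(2)] eq
      covariantD[OF covariant_R0 y a c'] covariant_pd[OF R(2,3) y a c'] a ..
qed

section \<open>Invariants of the hierarchy and its outermost derivatives\<close>

lemma hierarchy_invariants:
  assumes e: "valid_sign e"
  shows "chain (int k + 1) (chi (hierarchy (V_n e) (v_n e) k)) \<and>
    covariant e (chi (hierarchy (V_n e) (v_n e) k)) \<and>
    (\<forall>n m. rational_on e (lift (chi (hierarchy (V_n e) (v_n e) k)) n m)) \<and>
    symmetric_n e (int k + 1) (chi (hierarchy (V_n e) (v_n e) k))"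
proof (induction k)
  case 0
  show ?case
    by (auto simp: v_n_def chain_R0 covariant_R0 rat_r0 symmetric_n_def intro: r0_symmetry[OF e])
next
  case (Suc k)
  let ?v = "hierarchy (V_n e) (v_n e) k"
  have inv: "chain (int k + 1) (chi ?v)" "covariant e (chi ?v)" "\<And>n m. rational_on e (lift (chi ?v) n m)"
    "symmetric_n e (int k + 1) (chi ?v)" and K: "int k + 1 \<ge> 0"
    using Suc by auto
  have "int (Suc k) + 1 = (int k + 1) + 1" by simp
  then show ?case
    unfolding hierarchy.simps
    using chain_commutator_V_n[OF inv(1) K] covariant_commutator_V_n[OF e inv]
      rat_commutator_V_n[OF inv(1,3)] symmetric_commutator_V_n[OF e inv(1) K inv(3,4)] by metis
qed

lemma chain_hierarchy:
  "valid_sign e \<Longrightarrow> chain (int k + 1) (chi (hierarchy (V_n e) (v_n e) k))"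
  and rat_hierarchy:
  "valid_sign e \<Longrightarrow> rational_on e (lift (chi (hierarchy (V_n e) (v_n e) k)) n m)"
  and symmetric_hierarchy:
  "valid_sign e \<Longrightarrow> symmetric_n e (int k + 1) (chi (hierarchy (V_n e) (v_n e) k))"
  using hierarchy_invariants by blast+

lemma hierarchy_recursion:
  assumes e: "valid_sign e" and y: "y \<in> regular e"
  shows "lift (chi (hierarchy (V_n e) (v_n e) (Suc k))) n m y =
    (\<Sum>i\<in>{- (int k + 1)..int k + 1}. of_int i * r0 e (n + i) m y *
       pd (U (n + i, m)) (lift (chi (hierarchy (V_n e) (v_n e) k)) n m) y)
    - r_fun e (y PA) * pd PA (lift (chi (hierarchy (V_n e) (v_n e) k)) n m) y"
  unfolding hierarchy.simps
  by (rule commutator_recursion[OF e _ _ _ _ y]) (use hierarchy_invariants[OF e, of k] in blast)+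

text \<open>As a function of one neighbour the characteristic is fractional linear, and the
  numerator of its derivative is, up to sign, the polarisation with both slots at the opposite
  neighbour. That is \<open>f\<close> itself, hence the hypothesis at \<open>n - s\<close>.\<close>

lemma pd_r0_outer:
  assumes y: "y \<in> regular e" and s: "s = 1 \<or> s = - 1"
    and f: "f_poly e n m (y (U (n, m))) (y (U (n - s, m))) (y PA) \<noteq> 0"
  shows "pd (U (n + s, m)) (r0 e n m) y \<noteq> 0"
proof -
  let ?u = "y (U (n, m))" and ?x = "y (U (n + 1, m))" and ?y = "y (U (n - 1, m))"
  have ne: "?x - ?y \<noteq> 0" using regular_ne[OF y] by simp
  have ev: "\<forall>\<^sub>F z in nhds 0. y(v := y v + z) \<in> regular e" for v
    using pd_coord_curve[OF y] by (simp add: curve_def)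
  show ?thesis using s
  proof
    assume s: "s = 1"
    let ?A = "f_polar e n m ?u 0 ?y (y PA)" and ?S = "f_slope e n m ?u ?y (y PA)"
    have "((\<lambda>z. (?A + (?x + z) * ?S) / (?x + z - ?y)) has_field_derivative
        (?S * (?x + 0 - ?y) - (?A + (?x + 0) * ?S) * 1) / ((?x + 0 - ?y) * (?x + 0 - ?y))) (at 0)"
      by (rule DERIV_divide) (use ne in \<open>auto intro!: derivative_eq_intros\<close>)
    then have "((\<lambda>z. r0 e n m (y(U (n + 1, m) := ?x + z))) has_field_derivative
        (?S * (?x + 0 - ?y) - (?A + (?x + 0) * ?S) * 1) / ((?x + 0 - ?y) * (?x + 0 - ?y))) (at 0)"
    proof (rule has_field_derivative_eventually_cong)
      show "\<forall>\<^sub>F z in nhds 0. r0 e n m (y(U (n + 1, m) := ?x + z)) = (?A + (?x + z) * ?S) / (?x + z - ?y)"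
        using ev[of "U (n + 1, m)"]
        by eventually_elim (simp add: r0_eq, subst f_polar_affine, simp)
    qed
    then have "pd (U (n + s, m)) (r0 e n m) y =
        (?S * (?x + 0 - ?y) - (?A + (?x + 0) * ?S) * 1) / ((?x + 0 - ?y) * (?x + 0 - ?y))"
      unfolding s by (rule pd_eqI)
    also have "\<dots> = - (?A + ?y * ?S) / ((?x - ?y) * (?x - ?y))"
      by (simp add: algebra_simps)
    also have "?A + ?y * ?S = f_poly e n m ?u (y (U (n - s, m))) (y PA)"
      unfolding s f_polar_diag[symmetric] by (rule f_polar_affine[symmetric])
    finally show ?thesis using f ne by simp
  next
    assume s: "s = - 1"
    let ?A = "f_polar e n m ?u 0 ?x (y PA)" and ?S = "f_slope e n m ?u ?x (y PA)"
    have "((\<lambda>z. (?A + (?y + z) * ?S) / (?x - (?y + z))) has_field_derivative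
        (?S * (?x - (?y + 0)) - (?A + (?y + 0) * ?S) * - 1) / ((?x - (?y + 0)) * (?x - (?y + 0)))) (at 0)"
      by (rule DERIV_divide) (use ne in \<open>auto intro!: derivative_eq_intros\<close>)
    then have "((\<lambda>z. r0 e n m (y(U (n - 1, m) := ?y + z))) has_field_derivative
        (?S * (?x - (?y + 0)) - (?A + (?y + 0) * ?S) * - 1) / ((?x - (?y + 0)) * (?x - (?y + 0)))) (at 0)"
    proof (rule has_field_derivative_eventually_cong)
      show "\<forall>\<^sub>F z in nhds 0. r0 e n m (y(U (n - 1, m) := ?y + z)) = (?A + (?y + z) * ?S) / (?x - (?y + z))"
        using ev[of "U (n - 1, m)"]
        by eventually_elim (simp add: r0_eq, subst f_polar_sym, subst f_polar_affine, simp)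
    qed
    then have "pd (U (n - 1, m)) (r0 e n m) y =
        (?S * (?x - (?y + 0)) - (?A + (?y + 0) * ?S) * - 1) / ((?x - (?y + 0)) * (?x - (?y + 0)))"
      by (rule pd_eqI)
    then have "pd (U (n + s, m)) (r0 e n m) y =
        (?S * (?x - (?y + 0)) - (?A + (?y + 0) * ?S) * - 1) / ((?x - (?y + 0)) * (?x - (?y + 0)))"
      by (simp add: s)
    also have "\<dots> = (?A + ?x * ?S) / ((?x - ?y) * (?x - ?y))"
      by (simp add: algebra_simps)
    also have "?A + ?x * ?S = f_poly e n m ?u (y (U (n - s, m))) (y PA)"
      unfolding s f_polar_diag[symmetric] using f_polar_affine[symmetric] by simp
    finally show ?thesis using f ne by simp
  qed
qed

text \<open>Only the outermost term of the recursion formula depends on the outermost value of \<open>u\<close>.\<close>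

lemma leading_coefficient:
  assumes e: "valid_sign e" and y: "y \<in> regular e" and s: "s = 1 \<or> s = - (1 :: int)"
    and f: "\<And>i. f_poly e i m (y (U (i, m))) (y (U (i - s, m))) (y PA) \<noteq> 0"
  shows "pd (U (n + s * (int k + 1), m)) (lift (chi (hierarchy (V_n e) (v_n e) k)) n m) y \<noteq> 0"
proof (induction k)
  case 0
  then show ?case using pd_r0_outer[OF y s f] by (simp add: v_n_def)
next
  case (Suc k)
  define K where "K = int k + 1"
  have K: "K \<ge> 1" by (simp add: K_def)
  let ?R = "lift (chi (hierarchy (V_n e) (v_n e) k)) n m"
  let ?R' = "lift (chi (hierarchy (V_n e) (v_n e) (Suc k))) n m"
  let ?v = "U (n + s * (K + 1), m)"
  have inv: "chain K (chi (hierarchy (V_n e) (v_n e) k))" "rational_on e ?R" "rational_on e ?R'"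
    using chain_hierarchy[OF e] rat_hierarchy[OF e] by (simp_all only: K_def)
  \<comment> \<open>\<open>?v\<close> lies one site beyond the support of the previous
    characteristic, so after exchanging the order of differentiation the inner derivative is
    zero.\<close>
  have pd0: "pd ?v (pd w ?R) y = 0" for w
  proof -
    have "pd ?v (pd w ?R) y = pd w (pd ?v ?R) y" by (rule pd_commute[OF inv(2) y])
    also have "pd ?v ?R = (\<lambda>_. 0)"
      by (rule ext, rule pd_lift_zero[OF inv(1)]) (use s in auto)
    finally show ?thesis by simp
  qed
  have pdr0: "pd ?v (r0 e (n + i) m) y = 0" if "i \<in> {- K..K}" "i \<noteq> s * K" for i
    by (rule pd_lift_zero[OF chain_R0]) (use s that in auto)
  let ?c = "\<lambda>z. y(?v := y ?v + z)"
  have d: "((\<lambda>z. g (?c z)) has_field_derivative pd ?v g y) (at 0)" if "rational_on e g" for g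
    by (rule pd_has_derivative[OF that y])
  have "((\<lambda>z. (\<Sum>i\<in>{- K..K}. of_int i * r0 e (n + i) m (?c z) * pd (U (n + i, m)) ?R (?c z))
       - r_fun e (y PA) * pd PA ?R (?c z)) has_field_derivative
      (\<Sum>i\<in>{- K..K}. (of_int i * pd ?v (r0 e (n + i) m) y) * pd (U (n + i, m)) ?R (?c 0)
         + pd ?v (pd (U (n + i, m)) ?R) y * (of_int i * r0 e (n + i) m (?c 0)))
       - r_fun e (y PA) * pd ?v (pd PA ?R) y) (at 0)"
    by (intro DERIV_diff DERIV_sum DERIV_mult DERIV_cmult d rat_r0 rat_pd inv(2))
  then have "((\<lambda>z. ?R' (?c z)) has_field_derivative
      (\<Sum>i\<in>{- K..K}. (of_int i * pd ?v (r0 e (n + i) m) y) * pd (U (n + i, m)) ?R (?c 0)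
         + pd ?v (pd (U (n + i, m)) ?R) y * (of_int i * r0 e (n + i) m (?c 0)))
       - r_fun e (y PA) * pd ?v (pd PA ?R) y) (at 0)"
  proof (rule has_field_derivative_eventually_cong)
    have "\<forall>\<^sub>F z in nhds 0. ?c z \<in> regular e"
      using pd_coord_curve[OF y] by (simp add: curve_def)
    then show "\<forall>\<^sub>F z in nhds 0. ?R' (?c z) =
        (\<Sum>i\<in>{- K..K}. of_int i * r0 e (n + i) m (?c z) * pd (U (n + i, m)) ?R (?c z))
       - r_fun e (y PA) * pd PA ?R (?c z)"
      by eventually_elim (simp only: hierarchy_recursion[OF e] K_def fun_upd_apply var.distinct if_False)
  qed
  then have "pd ?v ?R' y = (\<Sum>i\<in>{- K..K}. (of_int i * pd ?v (r0 e (n + i) m) y) * pd (U (n + i, m)) ?R (?c 0)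
         + pd ?v (pd (U (n + i, m)) ?R) y * (of_int i * r0 e (n + i) m (?c 0)))
       - r_fun e (y PA) * pd ?v (pd PA ?R) y"
    by (rule pd_eqI)
  also have "\<dots> = (\<Sum>i\<in>{- K..K}. of_int i * pd ?v (r0 e (n + i) m) y * pd (U (n + i, m)) ?R y)"
    by (simp add: pd0)
  also have "\<dots> = (\<Sum>i\<in>{s * K}. of_int i * pd ?v (r0 e (n + i) m) y * pd (U (n + i, m)) ?R y)"
    by (rule sum.mono_neutral_right) (use s K pdr0 in auto)
  finally have "pd ?v ?R' y = of_int (s * K) * pd ?v (r0 e (n + s * K) m) y * pd (U (n + s * K, m)) ?R y"
    by simp
  moreover have "pd ?v (r0 e (n + s * K) m) y \<noteq> 0"
    using pd_r0_outer[OF y s f, of "n + s * K"] by (simp add: algebra_simps)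
  moreover have "pd (U (n + s * K, m)) ?R y \<noteq> 0"
    using Suc by (simp add: K_def)
  moreover have "of_int (s * K) \<noteq> (0 :: complex)" using s K by auto
  ultimately have "pd ?v ?R' y \<noteq> 0" by simp
  then show ?case by (simp add: K_def algebra_simps)
qed

section \<open>Dependence on the outermost values\<close>

definition state_of :: "complex \<Rightarrow> complex \<Rightarrow> field_values \<Rightarrow> state" where
  "state_of a b u v = (case v of PA \<Rightarrow> a | PB \<Rightarrow> b | U p \<Rightarrow> u p)"

lemma state_of_simps [simp]:
  "state_of a b u PA = a" "state_of a b u PB = b" "state_of a b u (U p) = u p"
  by (simp_all add: state_of_def)

lemma lift_state_of: "lift R n m (state_of a b u) = R n m a b u"
  by (simp add: lift_def)

lemma state_of_regular: "state_of a b u \<in> regular e \<longleftrightarrow> admissible e a b \<and> nonsingular u"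
  by (simp add: regular_def)

lemma finite_quadratic_roots:
  assumes "c0 \<noteq> 0 \<or> c1 \<noteq> 0 \<or> c2 \<noteq> (0 :: complex)"
  shows "finite {d. c0 + c1 * d + c2 * d^2 = 0}"
proof -
  have "finite {d. poly [:c0, c1, c2:] d = 0}"
    by (rule poly_roots_finite) (use assms in auto)
  moreover have "poly [:c0, c1, c2:] d = c0 + c1 * d + c2 * d^2" for d
    by (simp add: algebra_simps power2_eq_square)
  ultimately show ?thesis by (simp only:)
qed

text \<open>On fields with unit slope \<open>f\<close> is a polynomial of degree at most two in the
  offset \<open>d\<close>, and some coefficient survives. If \<epsilon> = 0, the constant term is 1
  for \<open>H1\<close> and the linear one 4 for \<open>H2\<close>; for \<open>H3\<close> with
  leading coefficient 0 the linear one is \<open>s\<close> or \<open>- s\<close>.\<close>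

lemma finite_f_poly_roots:
  assumes e: "valid_sign e" and s: "s = 1 \<or> s = - (1 :: complex)"
  shows "finite {d. f_poly e n m (d + t) (d + t - s) a = 0}"
proof -
  have "\<exists>c0 c1 c2. (c0 \<noteq> 0 \<or> c1 \<noteq> 0 \<or> c2 \<noteq> 0) \<and>
    (\<forall>d. f_poly e n m (d + t) (d + t - s) a = c0 + c1 * d + c2 * d^2)"
  proof (cases e)
    case (H1 \<epsilon> \<sigma>)
    then have \<sigma>: "\<sigma> \<in> {1, - 1}" using e by simp
    define c where "c = (if X_weight \<sigma> n m = 1 then t - s else t)"
    have c: "f_poly e n m (d + t) (d + t - s) a = 1 - \<epsilon> * (d + c)^2" for d
      by (rule weight_cases[OF \<sigma>, of n m]) (simp_all add: H1 c_def add_diff_eq)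
    show ?thesis unfolding c
      by (rule exI[of _ "1 - \<epsilon> * c^2"], rule exI[of _ "- 2 * \<epsilon> * c"], rule exI[of _ "- \<epsilon>"])
         (auto simp: algebra_simps power2_eq_square)
  next
    case (H2 \<epsilon> \<sigma>)
    then have \<sigma>: "\<sigma> \<in> {1, - 1}" using e by simp
    define c where "c = (if X_weight \<sigma> n m = 1 then t - s + a else t + a)"
    have c: "f_poly e n m (d + t) (d + t - s) a = 2 * (2 * d + 2 * t - s + a - 2 * \<epsilon> * (d + c)^2)" for d
      by (rule weight_cases[OF \<sigma>, of n m]) (simp_all add: H2 c_def algebra_simps)
    show ?thesis unfolding c
      by (rule exI[of _ "2 * (2 * t - s + a - 2 * \<epsilon> * c^2)"], rule exI[of _ "4 - 8 * \<epsilon> * c"], rule exI[of _ "- 4 * \<epsilon>"])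
         (auto simp: algebra_simps power2_eq_square)
  next
    case (H3 \<epsilon> \<delta> \<sigma>)
    then have \<sigma>: "\<sigma> \<in> {1, - 1}" using e by simp
    define k where "k = \<epsilon> / a"
    define c where "c = (if X_weight \<sigma> n m = 1 then t - s else t)"
    have c: "c = t \<or> c = t - s"
      "f_poly e n m (d + t) (d + t - s) a = (d + t) * (d + t - s) + \<delta> * a - k * (d + c)^2" for d
      by (simp add: c_def, rule weight_cases[OF \<sigma>, of n m]) (simp_all add: H3 c_def k_def add_diff_eq)
    show ?thesis unfolding c(2)
      by (rule exI[of _ "t * (t - s) + \<delta> * a - k * c^2"], rule exI[of _ "2 * t - s - 2 * k * c"], rule exI[of _ "1 - k"])
         (use s c(1) in \<open>auto simp: algebra_simps power2_eq_square\<close>)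
  qed
  then show ?thesis using finite_quadratic_roots by auto
qed

text \<open>The witness is the field d + i + j, nonsingular because values two apart differ by 2.
  \<open>leading_coefficient\<close> needs \<open>f\<close> nonzero at all sites of the row; each
  site excludes finitely many d, and countably many finite sets do not exhaust the complex numbers.
  If changing the outermost value never mattered, the leading derivative would be 0.\<close>

lemma involves_outer:
  assumes e: "valid_sign e" and ad: "admissible e a b" and s: "s = 1 \<or> s = - (1 :: int)"
  shows "involves (chi (hierarchy (V_n e) (v_n e) k)) (s * (int k + 1)) 0 n m a b"
proof -
  let ?R = "chi (hierarchy (V_n e) (v_n e) k)"
  have fin: "finite {d. f_poly e i m (d + of_int (i + m)) (d + of_int (i + m) - of_int s) a = 0}" for i
    by (rule finite_f_poly_roots[OF e, of "of_int s" i m "of_int (i + m)" a]) (use s in auto)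
  have "countable (\<Union>i. {d. f_poly e i m (d + of_int (i + m)) (d + of_int (i + m) - of_int s) a = 0})"
    by (rule countable_UN[OF countableI_type countable_finite[OF fin]])
  then have "(\<Union>i. {d. f_poly e i m (d + of_int (i + m)) (d + of_int (i + m) - of_int s) a = 0}) \<noteq> UNIV"
    using uncountable_UNIV_complex by metis
  then obtain d where d: "\<And>i. f_poly e i m (d + of_int (i + m)) (d + of_int (i + m) - of_int s) a \<noteq> 0"
    by blast
  define u :: field_values where "u = (\<lambda>(i, j). d + of_int (i + j))"
  let ?y = "state_of a b u"
  let ?p = "(n + s * (int k + 1), m + 0)"
  have "nonsingular u" by (simp add: nonsingular_def u_def)
  then have y: "?y \<in> regular e" using ad by (simp add: state_of_regular)
  have lead: "pd (U ?p) (lift ?R n m) ?y \<noteq> 0"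
    using leading_coefficient[OF e y s, of m n k] d by (simp add: u_def add_diff_eq algebra_simps)
  show ?thesis
  proof (rule ccontr)
    assume "\<not> involves ?R (s * (int k + 1)) 0 n m a b"
    then have const: "R n m a b (u(?p := z)) = R n m a b u" if "R = ?R" "nonsingular (u(?p := z))" for z R
      using \<open>nonsingular u\<close> that unfolding involves_def by blast
    have "pd (U ?p) (lift ?R n m) ?y = 0"
    proof (rule pd_eqI, rule has_field_derivative_eventually_cong[OF DERIV_const])
      have "\<forall>\<^sub>F z in nhds 0. ?y(U ?p := ?y (U ?p) + z) \<in> regular e"
        using pd_coord_curve[OF y] unfolding curve_def by blast
      then show "\<forall>\<^sub>F z in nhds 0. lift ?R n m (?y(U ?p := ?y (U ?p) + z)) = ?R n m a b u"
      proof eventually_elim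
        case (elim z)
        have eq: "?y(U ?p := ?y (U ?p) + z) = state_of a b (u(?p := u ?p + z))"
          by (auto simp: state_of_def fun_eq_iff split: var.split)
        show ?case using elim const[OF refl] unfolding eq lift_state_of state_of_regular by blast
      qed
    qed
    then show False using lead by simp
  qed
qed

section \<open>Symmetries in terms of states\<close>

lemma lift_E_quad: "lift (E_quad e) n m = Q e n m"
  by (simp add: lift_def E_quad_def Q_def fun_eq_iff)

definition solves :: "quad_eq \<Rightarrow> state \<Rightarrow> bool" where
  "solves e y \<longleftrightarrow> y \<in> regular e \<and> (\<forall>n m. Q e n m y = 0 \<and> (\<forall>p\<in>corners n m. pd (U p) (Q e n m) y \<noteq> 0))"

lemma partial_u_E_quad:
  "partial_u i j (E_quad e) n m a b u = pd (U (n + i, m + j)) (Q e n m) (state_of a b u)"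
  using lift_partial_u[of i j "E_quad e" n m "state_of a b u"] by (simp add: lift_state_of lift_E_quad)

lemma generic_solution_iff:
  "admissible e a b \<and> generic_solution e a b u \<longleftrightarrow> solves e (state_of a b u)"
proof -
  have "E_quad e n m a b u = Q e n m (state_of a b u)" for n m
    by (simp flip: lift_state_of lift_E_quad)
  then show ?thesis
    by (auto simp: generic_solution_def solves_def state_of_regular partial_u_E_quad corners_def)
qed

lemma solves_row_solution: "solves e y \<Longrightarrow> row_solution e m L H y"
  by (auto simp: solves_def row_solution_def corners_def)

definition components :: "vector_field \<Rightarrow> int \<Rightarrow> int \<Rightarrow> state \<Rightarrow> var \<Rightarrow> complex" where
  "components V n m y v = (case v of PA \<Rightarrow> xi V n m (y PA) (y PB) | PB \<Rightarrow> zeta V n m (y PA) (y PB)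
     | U p \<Rightarrow> lift (chi V) (fst p) (snd p) y)"

lemma generates_symmetry_iff:
  "generates_symmetry e V \<longleftrightarrow> (\<exists>D. finite D \<and> depends_only_on (chi V) D) \<and>
     (\<forall>n m y. solves e y \<longrightarrow> act (components V n m y) (Q e n m) y = 0)"
proof -
  have eq: "(\<Sum>i\<in>{0, 1}. \<Sum>j\<in>{0, 1}. shift i j (chi V) n m a b u * partial_u i j (E_quad e) n m a b u)
      + xi V n m a b * partial_\<alpha> (E_quad e) n m a b u + zeta V n m a b * partial_\<beta> (E_quad e) n m a b u
      = act (components V n m (state_of a b u)) (Q e n m) (state_of a b u)" for n m a b u
  proof -
    have "partial_\<alpha> (E_quad e) n m a b u = pd PA (Q e n m) (state_of a b u)"
      using lift_partial_\<alpha>[of "E_quad e" n m "state_of a b u"] by (simp add: lift_state_of lift_E_quad)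
    moreover have "partial_\<beta> (E_quad e) n m a b u = pd PB (Q e n m) (state_of a b u)"
      by (simp add: partial_\<beta>_def pd_def lift_def flip: lift_E_quad)
    ultimately show ?thesis
      by (simp add: act_Q sum_corners components_def partial_u_E_quad shift_def lift_state_of)
  qed
  have st: "y = state_of (y PA) (y PB) (\<lambda>p. y (U p))" for y
    by (auto simp: fun_eq_iff state_of_def split: var.split)
  have "(\<forall>a b u. admissible e a b \<longrightarrow> generic_solution e a b u \<longrightarrow>
      (\<forall>n m. act (components V n m (state_of a b u)) (Q e n m) (state_of a b u) = 0)) \<longleftrightarrow>
      (\<forall>n m y. solves e y \<longrightarrow> act (components V n m y) (Q e n m) y = 0)"
    using generic_solution_iff st by metis
  then show ?thesis unfolding generates_symmetry_def eq by blast
qed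

lemma no_parameter_part_hierarchy:
  "no_parameter_part (hierarchy (V_n e) (v_n e) k)"
  by (cases k) (simp_all add: no_parameter_part_def v_n_def commutator_def)

lemma generalized_symmetry_hierarchy:
  assumes e: "valid_sign e"
  shows "generalized_symmetry e (hierarchy (V_n e) (v_n e) k)"
proof -
  let ?v = "hierarchy (V_n e) (v_n e) k"
  have "act (components ?v n m y) (Q e n m) y = 0" if y: "solves e y" for n m y
  proof -
    have "components ?v n m y = field_vec (lift (chi ?v)) (\<lambda>_. 0) y"
      using no_parameter_part_hierarchy[of e k]
      by (auto simp: fun_eq_iff components_def field_vec_def no_parameter_part_def split: var.split)
    then show ?thesis
      using symmetric_hierarchy[OF e, of k] solves_row_solution[OF y] by (simp add: symmetric_n_def)
  qed
  moreover have "\<exists>D. finite D \<and> depends_only_on (chi ?v) D"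
    using chain_depends[OF chain_hierarchy[OF e, of k]] by (intro exI conjI) auto
  ultimately show ?thesis
    using no_parameter_part_hierarchy by (auto simp: generalized_symmetry_def generates_symmetry_iff)
qed

lemma generates_symmetry_V_n:
  assumes e: "valid_sign e"
  shows "generates_symmetry e (V_n e)"
proof -
  have "act (components (V_n e) n m y) (Q e n m) y = 0" if y: "solves e y" for n m y
  proof -
    have "components (V_n e) n m y = master_vec e y"
      by (auto simp: fun_eq_iff components_def master_vec_def field_vec_def V_n_def lift_def split: var.split)
    then show ?thesis using master_vec_symmetry[OF e solves_row_solution[OF y]] by simp
  qed
  moreover have "\<exists>D. finite D \<and> depends_only_on (chi (V_n e)) D"
    by (rule exI[of _ "{-1..1} \<times> {0}"]) (simp add: chain_depends[OF chain_V_n])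
  ultimately show ?thesis by (simp add: generates_symmetry_iff)
qed

text \<open>Equality on regular states passes to derivatives by \<open>pd_cong\<close>, so the
  iterates may differ elsewhere. The sum in the second direction vanishes, since the characteristic
  reads one row and the term \<open>l = 0\<close> carries the factor 0.\<close>

lemma recursion_op_hierarchy:
  assumes e: "valid_sign e" and y: "y \<in> regular e"
  shows "lift ((recursion_op e ^^ k) (R0_n e)) n m y = lift (chi (hierarchy (V_n e) (v_n e) k)) n m y"
  using y
proof (induction k arbitrary: n m y)
  case 0
  then show ?case by (simp add: v_n_def)
next
  case (Suc k)
  let ?G = "(recursion_op e ^^ k) (R0_n e)" and ?v = "hierarchy (V_n e) (v_n e) k"
  have pd_eq: "pd v (lift ?G n m) y = pd v (lift (chi ?v) n m) y" for v
    by (rule pd_cong[OF Suc.IH rat_hierarchy[OF e] Suc.prems])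
  have "partial_\<beta> ?G n m (y PA) (y PB) (\<lambda>p. y (U p)) = pd PB (lift ?G n m) y"
    by (simp add: partial_\<beta>_def pd_def lift_def)
  then have "lift (recursion_op e ?G) n m y =
     Sum_any (\<lambda>l. of_int l * r0 e (n + l) m y * pd (U (n + l, m)) (lift ?G n m) y)
     + Sum_any (\<lambda>l. of_int l * lift (R0_m e) n (m + l) y * pd (U (n, m + l)) (lift ?G n m) y)
     - r_fun e (y PA) * pd PA (lift ?G n m) y - r_fun e (y PB) * pd PB (lift ?G n m) y"
    using lift_partial_\<alpha>[of ?G n m y] lift_partial_u[of _ 0 ?G n m y] lift_partial_u[of 0 _ ?G n m y]
    by (simp add: lift_def recursion_op_def shift_def)
  also have "Sum_any (\<lambda>l. of_int l * r0 e (n + l) m y * pd (U (n + l, m)) (lift ?G n m) y) =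
      (\<Sum>l\<in>{- (int k + 1)..int k + 1}. of_int l * r0 e (n + l) m y * pd (U (n + l, m)) (lift ?G n m) y)"
  proof (rule Sum_any.expand_superset)
    have "pd (U (n + l, m)) (lift ?G n m) y = 0" if "l \<notin> {- (int k + 1)..int k + 1}" for l
      unfolding pd_eq by (rule pd_lift_zero[OF chain_hierarchy[OF e]]) (use that in auto)
    then show "{l. of_int l * r0 e (n + l) m y * pd (U (n + l, m)) (lift ?G n m) y \<noteq> 0} \<subseteq> {- (int k + 1)..int k + 1}"
      by force
  qed simp
  also have "Sum_any (\<lambda>l. of_int l * lift (R0_m e) n (m + l) y * pd (U (n, m + l)) (lift ?G n m) y) = 0"
  proof -
    have "of_int l * pd (U (n, m + l)) (lift ?G n m) y = 0" for l
    proof (cases "l = 0")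
      case False
      then have "pd (U (n, m + l)) (lift (chi ?v) n m) y = 0"
        by (intro pd_lift_zero[OF chain_hierarchy[OF e]]) auto
      then show ?thesis by (simp add: pd_eq)
    qed simp
    then have "of_int l * lift (R0_m e) n (m + l) y * pd (U (n, m + l)) (lift ?G n m) y = 0" for l
      by (metis mult.assoc mult.commute mult_zero_right)
    then show ?thesis by (rule trans[OF Sum_any.cong Sum_any.neutral])
  qed
  also have "pd PB (lift ?G n m) y = 0"
    unfolding pd_eq by (rule pd_lift_zero[OF chain_hierarchy[OF e]]) auto
  finally show ?case
    unfolding funpow.simps comp_apply hierarchy_recursion[OF e Suc.prems] pd_eq by simp
qed

section \<open>Exchanging the lattice directions\<close>

text \<open>Exchanging the two lattice directions together with \<open>\<alpha>\<close> and \<open>\<beta>\<close> maps each equation to its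
  negative.\<close>

definition transp :: "lattice_fun \<Rightarrow> lattice_fun" where
  "transp R = (\<lambda>n m a b u. R m n b a (u \<circ> prod.swap))"

lemma transp_apply: "transp R n m a b u = R m n b a (u \<circ> prod.swap)"
  by (simp add: transp_def)

definition transp_field :: "vector_field \<Rightarrow> vector_field" where
  "transp_field V = \<lparr>chi = transp (chi V), xi = (\<lambda>n m a b. zeta V m n b a), zeta = (\<lambda>n m a b. xi V m n b a)\<rparr>"

lemma partial_u_transp: "partial_u i j (transp R) = transp (partial_u j i R)"
proof -
  have "u((i, j) := z) \<circ> prod.swap = (u \<circ> prod.swap)((j, i) := z)" for u :: field_values and i j z
    by (auto simp: fun_eq_iff)
  note eq = this
  show ?thesis by (intro ext) (simp add: partial_u_def transp_def eq)
qed

lemma partial_\<alpha>_transp: "partial_\<alpha> (transp R) = transp (partial_\<beta> R)"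
  and partial_\<beta>_transp: "partial_\<beta> (transp R) = transp (partial_\<alpha> R)"
  and shift_transp: "shift i j (transp R) = transp (shift j i R)"
  by (simp_all add: partial_\<alpha>_def partial_\<beta>_def shift_def transp_def)

lemma f_poly_transp: "f_poly e n m = f_poly e m n"
  by (cases e) (simp_all add: fun_eq_iff X_weight_def Y_weight_def add.commute)

lemma R0_m_eq: "R0_m e = transp (R0_n e)"
  by (simp add: R0_m_def R0_n_def transp_def fun_eq_iff f_second_def f_poly_transp)

lemma v_m_eq: "v_m e = transp_field (v_n e)"
  by (simp add: v_m_def v_n_def transp_field_def R0_m_eq)

lemma V_m_eq: "V_m e = transp_field (V_n e)"
  by (simp add: V_m_def V_n_def transp_field_def R0_m_eq transp_def)

lemma Sum_any_swap: "Sum_any (\<lambda>(i, j). g i j) = Sum_any (\<lambda>(i, j). g j i)"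
  by (rule Sum_any.reindex_cong[of prod.swap]) (auto simp: fun_eq_iff)

text \<open>The sums run over the whole plane of shifts and are unaffected by exchanging
  \<open>i\<close> and \<open>j\<close>; thus the second hierarchy is the transposed first
  one.\<close>

lemma commutator_transp: "commutator (transp_field V) (transp_field v) = transp_field (commutator V v)"
proof -
  have "Sum_any (\<lambda>(i, j). shift i j (transp R) n m a b u * partial_u i j (transp S) n m a b u) =
      Sum_any (\<lambda>(i, j). shift i j R m n b a (u \<circ> prod.swap) * partial_u i j S m n b a (u \<circ> prod.swap))" for R S n m a b u
    unfolding shift_transp partial_u_transp by (subst Sum_any_swap) (simp add: transp_def)
  then show ?thesis
    by (simp add: commutator_def transp_field_def partial_\<alpha>_transp partial_\<beta>_transp transp_apply fun_eq_iff)
qed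

lemma hierarchy_transp: "hierarchy (transp_field V) (transp_field v) k = transp_field (hierarchy V v k)"
  by (induction k) (simp_all add: commutator_transp)

text \<open>The operator treats both directions and both parameters alike; the exchange merely
  permutes its two sums and its two parameter terms.\<close>

lemma recursion_op_transp: "recursion_op e (transp G) = transp (recursion_op e G)"
  unfolding recursion_op_def R0_m_eq partial_u_transp partial_\<alpha>_transp partial_\<beta>_transp
  by (simp add: transp_def shift_def fun_eq_iff comp_def)

lemma depends_transp:
  assumes "depends_only_on R D"
  shows "depends_only_on (transp R) (prod.swap ` D)"
  unfolding depends_only_on_def transp_def
proof (intro allI impI)
  fix n m a b and u w :: field_values
  assume "\<forall>(i, j)\<in>prod.swap ` D. u (n + i, m + j) = w (n + i, m + j)"
  then show "R m n b a (u \<circ> prod.swap) = R m n b a (w \<circ> prod.swap)"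
    by (intro depends_only_onD[OF assms]) force
qed

lemma nonsingular_swap: "nonsingular (u \<circ> prod.swap) \<longleftrightarrow> nonsingular u"
  by (auto simp: nonsingular_def)

lemma involves_transp:
  assumes "involves R i j m n b a"
  shows "involves (transp R) j i n m a b"
proof -
  obtain u z where u: "nonsingular u" "nonsingular (u((m + i, n + j) := z))"
    "R m n b a (u((m + i, n + j) := z)) \<noteq> R m n b a u"
    using assms unfolding involves_def by blast
  have eq: "(u \<circ> prod.swap)((n + j, m + i) := z) = u((m + i, n + j) := z) \<circ> prod.swap"
    by (auto simp: fun_eq_iff)
  have sw: "w \<circ> prod.swap \<circ> prod.swap = w" for w :: field_values
    by (simp add: fun_eq_iff)
  show ?thesis unfolding involves_def
    by (intro exI[of _ "u \<circ> prod.swap"] exI[of _ z])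
       (use u in \<open>simp add: eq nonsingular_swap transp_def sw\<close>)
qed

definition swap_state :: "state \<Rightarrow> state" where
  "swap_state y v = (case v of PA \<Rightarrow> y PB | PB \<Rightarrow> y PA | U p \<Rightarrow> y (U (prod.swap p)))"

definition swap_var :: "var \<Rightarrow> var" where
  "swap_var v = (case v of PA \<Rightarrow> PB | PB \<Rightarrow> PA | U p \<Rightarrow> U (prod.swap p))"

lemma swap_state_simps [simp]:
  "swap_state y PA = y PB" "swap_state y PB = y PA" "swap_state y (U p) = y (U (prod.swap p))"
  "swap_var PA = PB" "swap_var PB = PA" "swap_var (U p) = U (prod.swap p)"
  by (simp_all add: swap_state_def swap_var_def)

lemma Q_swap:
  assumes "valid_sign e"
  shows "Q e m n (swap_state y) = - Q e n m y"
proof -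
  have w: "X_weight \<sigma> m n = X_weight \<sigma> n m" "Y_weight \<sigma> m n = Y_weight \<sigma> n m" for \<sigma>
    by (simp_all add: X_weight_def Y_weight_def add.commute)
  have "E_poly e x1 x3 x2 x4 m n b a = - E_poly e x1 x2 x3 x4 n m a b" for x1 x2 x3 x4 a b
  proof (cases e)
    case (H2 \<epsilon> \<sigma>)
    then have "\<sigma> \<in> {1, - 1}" using assms by simp
    then show ?thesis unfolding H2 E_poly.simps w
      by (rule weight_cases[of \<sigma> n m]) (simp_all, simp_all add: algebra_simps power2_eq_square power3_eq_cube)
  qed (simp_all only: E_poly.simps w, simp_all add: divide_inverse algebra_simps)
  then show ?thesis by (simp add: Q_def)
qed

lemma pd_Q_swap:
  assumes "valid_sign e" "y \<in> regular e"
  shows "pd v (Q e m n) (swap_state y) = - pd (swap_var v) (Q e n m) y"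
proof -
  have upd: "(swap_state y)(v := z) = swap_state (y(swap_var v := z))" for z
    by (rule ext) (auto simp: swap_state_def swap_var_def split: var.splits)
  have val: "swap_state y v = y (swap_var v)"
    by (simp add: swap_state_def swap_var_def split: var.split)
  have "pd v (Q e m n) (swap_state y) = pd (swap_var v) (\<lambda>y. (- 1) * Q e n m y) y"
    unfolding pd_def upd val Q_swap[OF assms(1)] by simp
  also have "\<dots> = - pd (swap_var v) (Q e n m) y"
    by (subst pd_mult[OF rat_const rat_Q assms(2)]) simp
  finally show ?thesis .
qed

lemma swap_state_regular: "swap_state y \<in> regular e \<longleftrightarrow> y \<in> regular e"
proof -
  have "(\<lambda>p. swap_state y (U p)) = (\<lambda>p. y (U p)) \<circ> prod.swap" by (simp add: fun_eq_iff)
  moreover have "admissible e (y PB) (y PA) \<longleftrightarrow> admissible e (y PA) (y PB)" by (cases e) auto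
  ultimately show ?thesis using nonsingular_swap[of "\<lambda>p. y (U p)"] by (simp add: regular_def)
qed

lemma solves_swap:
  assumes e: "valid_sign e" and y: "solves e y"
  shows "solves e (swap_state y)"
proof -
  have yr: "y \<in> regular e" using y by (simp add: solves_def)
  have "Q e n m (swap_state y) = 0 \<and> (\<forall>p\<in>corners n m. pd (U p) (Q e n m) (swap_state y) \<noteq> 0)" for n m
    using y unfolding Q_swap[OF e] pd_Q_swap[OF e yr] by (auto simp: solves_def corners_def)
  then show ?thesis using yr by (simp add: solves_def swap_state_regular)
qed

lemma generates_symmetry_transp:
  assumes e: "valid_sign e" and V: "generates_symmetry e V"
  shows "generates_symmetry e (transp_field V)"
  unfolding generates_symmetry_iff
proof (intro conjI allI impI)
  obtain D where "finite D" "depends_only_on (chi V) D"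
    using V by (auto simp: generates_symmetry_iff)
  then have "finite (prod.swap ` D) \<and> depends_only_on (chi (transp_field V)) (prod.swap ` D)"
    by (simp add: transp_field_def depends_transp)
  then show "\<exists>D. finite D \<and> depends_only_on (chi (transp_field V)) D" by blast
next
  fix n m y assume y: "solves e y"
  then have yr: "y \<in> regular e" by (simp add: solves_def)
  have comp: "components (transp_field V) n m y v = components V m n (swap_state y) (swap_var v)" for v
    by (cases v) (auto simp: components_def transp_field_def transp_def lift_def comp_def)
  have "act (components V m n (swap_state y)) (Q e m n) (swap_state y) = 0"
    using V solves_swap[OF e y] by (simp add: generates_symmetry_iff)
  then have "- act (components (transp_field V) n m y) (Q e n m) y = 0"
    unfolding act_Q sum_corners pd_Q_swap[OF e yr] comp by (simp add: algebra_simps)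
  then show "act (components (transp_field V) n m y) (Q e n m) y = 0" by simp
qed

lemma no_parameter_part_transp: "no_parameter_part (transp_field V) \<longleftrightarrow> no_parameter_part V"
  by (auto simp: no_parameter_part_def transp_field_def)

lemma not_no_parameter_part_V_n: "\<not> no_parameter_part (V_n e)"
  unfolding no_parameter_part_def V_n_def by (cases e) (auto intro!: exI[of _ 1])

theorem mainTheorem7:
  fixes \<epsilon> \<delta> \<sigma> :: complex and e :: quad_eq
  assumes "\<sigma> \<in> {1, -1}"
    and "e \<in> {H1 \<epsilon> \<sigma>, H2 \<epsilon> \<sigma>, H3 \<epsilon> \<delta> \<sigma>}"
  shows
    "(extended_generalized_symmetry e (V_n e) \<and> three_point (V_n e) \<and>
      extended_generalized_symmetry e (V_m e) \<and> three_point (V_m e))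
     \<and>
     (master_symmetry e (V_n e) (v_n e) \<and> master_symmetry e (V_m e) (v_m e))
     \<and>
     (\<forall>k.
        depends_only_on (chi (hierarchy (V_n e) (v_n e) k)) ({- int k - 1 .. int k + 1} \<times> {0}) \<and>
        depends_only_on (chi (hierarchy (V_m e) (v_m e) k)) ({0} \<times> {- int k - 1 .. int k + 1}) \<and>
        (\<forall>n m \<alpha> \<beta>. admissible e \<alpha> \<beta> \<longrightarrow>
           involves (chi (hierarchy (V_n e) (v_n e) k)) (- int k - 1) 0 n m \<alpha> \<beta> \<and>
           involves (chi (hierarchy (V_n e) (v_n e) k)) (int k + 1) 0 n m \<alpha> \<beta> \<and>
           involves (chi (hierarchy (V_m e) (v_m e) k)) 0 (- int k - 1) n m \<alpha> \<beta> \<and>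
           involves (chi (hierarchy (V_m e) (v_m e) k)) 0 (int k + 1) n m \<alpha> \<beta>) \<and>
        (\<forall>n m \<alpha> \<beta> u. admissible e \<alpha> \<beta> \<longrightarrow> nonsingular u \<longrightarrow>
           chi (hierarchy (V_n e) (v_n e) k) n m \<alpha> \<beta> u
             = (recursion_op e ^^ k) (R0_n e) n m \<alpha> \<beta> u \<and>
           chi (hierarchy (V_m e) (v_m e) k) n m \<alpha> \<beta> u
             = (recursion_op e ^^ k) (R0_m e) n m \<alpha> \<beta> u))"
proof -
  have e: "valid_sign e" using assms by auto
  have Hm: "hierarchy (V_m e) (v_m e) k = transp_field (hierarchy (V_n e) (v_n e) k)" for k
    by (simp add: V_m_eq v_m_eq hierarchy_transp)
  have chi_transp: "chi (transp_field V) = transp (chi V)" for V by (simp add: transp_field_def)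
  have adm: "admissible e \<beta> \<alpha>" if "admissible e \<alpha> \<beta>" for \<alpha> \<beta> using that by (cases e) auto
  have 1: "extended_generalized_symmetry e (V_n e)" "extended_generalized_symmetry e (V_m e)"
    unfolding extended_generalized_symmetry_def V_m_eq no_parameter_part_transp
    using generates_symmetry_V_n[OF e] generates_symmetry_transp[OF e] not_no_parameter_part_V_n by auto
  have 2: "three_point (V_n e)" "three_point (V_m e)"
  proof -
    have three: "{-1..1 :: int} \<times> {0} = {(-1, 0), (0, 0), (1, 0 :: int)}" by auto
    show "three_point (V_n e)"
      using chain_depends[OF chain_V_n] unfolding three three_point_def by blast
    show "three_point (V_m e)"
      using depends_transp[OF chain_depends[OF chain_V_n, of e]]
      unfolding three three_point_def V_m_eq chi_transp by simp
  qed
  have 3: "master_symmetry e (V_n e) (v_n e)" "master_symmetry e (V_m e) (v_m e)"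
    unfolding master_symmetry_def Hm generalized_symmetry_def no_parameter_part_transp
    using generalized_symmetry_hierarchy[OF e] generates_symmetry_transp[OF e]
    by (auto simp: generalized_symmetry_def)
  have neg: "- int k - 1 = - (int k + 1)" for k by simp
  have 4: "depends_only_on (chi (hierarchy (V_n e) (v_n e) k)) ({- int k - 1 .. int k + 1} \<times> {0})" for k
    unfolding neg by (rule chain_depends[OF chain_hierarchy[OF e]])
  have 5: "depends_only_on (chi (hierarchy (V_m e) (v_m e) k)) ({0} \<times> {- int k - 1 .. int k + 1})" for k
    using depends_transp[OF 4[of k]] unfolding Hm chi_transp product_swap .
  have 6: "involves (chi (hierarchy (V_n e) (v_n e) k)) (- int k - 1) 0 n m \<alpha> \<beta>"
    "involves (chi (hierarchy (V_n e) (v_n e) k)) (int k + 1) 0 n m \<alpha> \<beta>" if "admissible e \<alpha> \<beta>" for k n m \<alpha> \<beta>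
    using involves_outer[OF e that, of "- 1" k] involves_outer[OF e that, of 1 k] by simp_all
  have 7: "involves (chi (hierarchy (V_m e) (v_m e) k)) 0 (- int k - 1) n m \<alpha> \<beta>"
    "involves (chi (hierarchy (V_m e) (v_m e) k)) 0 (int k + 1) n m \<alpha> \<beta>" if "admissible e \<alpha> \<beta>" for k n m \<alpha> \<beta>
    unfolding Hm chi_transp by (rule involves_transp, rule 6, rule adm, rule that)+
  have 8: "chi (hierarchy (V_n e) (v_n e) k) n m \<alpha> \<beta> u = (recursion_op e ^^ k) (R0_n e) n m \<alpha> \<beta> u"
    if "admissible e \<alpha> \<beta>" "nonsingular u" for k n m \<alpha> \<beta> u
    using recursion_op_hierarchy[OF e, of "state_of \<alpha> \<beta> u"] that by (simp add: state_of_regular lift_state_of)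
  have 9: "chi (hierarchy (V_m e) (v_m e) k) n m \<alpha> \<beta> u = (recursion_op e ^^ k) (R0_m e) n m \<alpha> \<beta> u"
    if "admissible e \<alpha> \<beta>" "nonsingular u" for k n m \<alpha> \<beta> u
  proof -
    have "(recursion_op e ^^ k) (R0_m e) = transp ((recursion_op e ^^ k) (R0_n e))"
      by (induction k) (simp_all add: R0_m_eq recursion_op_transp)
    then show ?thesis unfolding Hm chi_transp
      using 8[OF adm, of \<alpha> \<beta> "u \<circ> prod.swap" k m n] that by (simp add: transp_def nonsingular_swap)
  qed
  show ?thesis
    by (intro conjI allI impI) (rule 1 2 3 4 5 | (rule 6 7 8 9; assumption))+
qed

end
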